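(* Let $0<c<1$. The operator system $S_c\subset\mathcal{B}(L^2(S_3)\oplus\mathbb{C})$ is not hyperrigid. However, for every irreducible representation $\pi$ of $C^*(S_c)$, the restriction $\pi|_{S_c}$ has the unique extension property.
   Context: Let $S_3$ be the unit sphere in $\mathbb{R}^4$ (the boundary of the Euclidean open unit ball), let $m$ be the unique rotation-invariant Borel probability measure on $S_3$, and let $L^2(S_3)=L^2(S_3,m)$ be the complex Hilbert space, with inner product linear in the first variable. For $i=1,2,3,4$ let $t_i$ be the projection of $\mathbb{R}^4$ onto the $i$-th coordinate (restricted to $S_3$), and let $M_{t_i}$ be multiplication by $t_i$ on $L^2(S_3)$. Let $P:L^2(S_3)\to\mathbb{C}$, $g\mapsto\langle g,1\rangle=\int_{S_3} g\,dm$, so that $P^*:\mathbb{C}\to L^2(S_3)$ sends $a$ to the constant function $a$. For $c>0$ define operators on $L^2(S_3)\oplus\mathbb{C}$ by $$T_i=M_{t_i}\oplus 0\quad (i=1,2,3,4),\qquad \tilde T_{1,c}=\begin{pmatrix} M_{t_1} & cP^*\\ 0 & 0\end{pmatrix}.$$ Let $S_c$ be the operator system generated by $\tilde T_{1,c},T_2,T_3,T_4$, i.e. the linear span of $1,\tilde T_{1,c},\tilde T_{1,c}^*,T_2,T_3,T_4$ in $\mathcal{B}(L^2(S_3)\oplus\mathbb{C})$ (where $T_2,T_3,T_4$ are self-adjoint), and let $C^*(S_c)$ be the $C^*$-subalgebra of $\mathcal{B}(L^2(S_3)\oplus\mathbb{C})$ generated by $S_c$. For an operator system $S$ generating a $C^*$-algebra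 $C^*(S)$ and a (unital $*$-)representation $\pi:C^*(S)\to\mathcal{B}(H)$, the restriction $\pi|_S$ has the unique extension property if $\pi$ is the only unital completely positive map $C^*(S)\to\mathcal{B}(H)$ that extends $\pi|_S$. The operator system $S$ is hyperrigid if $\pi|_S$ has the unique extension property for every representation $\pi$ of $C^*(S)$. *)

theory Defs
  imports "HOL-Probability.Probability"
begin

section \<open>Complex Hilbert spaces\<close>

text \<open>
  Complex inner product spaces, built on the real inner product spaces of the library: the real
  inner product is the real part of the complex one, so norm and topology are inherited.
  The complex inner product is linear in the first variable.
\<close>

class scaleC =
  fixes scaleC :: "complex \<Rightarrow> 'a \<Rightarrow> 'a"  (infixr \<open>*\<^sub>C\<close> 75)

class complex_vector = real_vector + scaleC +
  assumes scaleC_add_right: "a *\<^sub>C (x + y) = a *\<^sub>C x + a *\<^sub>C y"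
    and scaleC_add_left: "(a + b) *\<^sub>C x = a *\<^sub>C x + b *\<^sub>C x"
    and scaleC_scaleC: "a *\<^sub>C b *\<^sub>C x = (a * b) *\<^sub>C x"
    and scaleR_scaleC: "r *\<^sub>R x = complex_of_real r *\<^sub>C x"

class complex_inner = complex_vector + real_inner +
  fixes cinner :: "'a \<Rightarrow> 'a \<Rightarrow> complex"
  assumes cinner_commute: "cinner x y = cnj (cinner y x)"
    and cinner_add_left: "cinner (x + y) z = cinner x z + cinner y z"
    and cinner_scaleC_left: "cinner (a *\<^sub>C x) y = a * cinner x y"
    and Re_cinner: "Re (cinner x y) = inner x y"

class chilbert_space = complex_inner + complete_space

lemma cinner_self: "cinner x x = complex_of_real ((norm x)\<^sup>2)"
proof (rule complex_eqI)
  show "Im (cinner x x) = Im (complex_of_real ((norm x)\<^sup>2))"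
    using arg_cong[OF cinner_commute[of x x], of Im] by simp
qed (simp add: Re_cinner power2_norm_eq_inner)

lemma norm_scaleC: "norm (a *\<^sub>C x) = cmod a * norm (x::'a::complex_inner)"
proof -
  have "cinner (a *\<^sub>C x) (a *\<^sub>C x) = a * cnj (a * cinner x x)"
    by (subst cinner_scaleC_left, subst cinner_commute, subst cinner_scaleC_left) simp
  also have "\<dots> = complex_of_real ((cmod a * norm x)\<^sup>2)"
    by (simp add: cinner_self complex_norm_square power_mult_distrib del: of_real_power) 
  finally have "(norm (a *\<^sub>C x))\<^sup>2 = (cmod a * norm x)\<^sup>2"
    by (simp only: cinner_self of_real_eq_iff)
  then show ?thesis by simp
qed

lemma bounded_linear_scaleC: "bounded_linear (\<lambda>x::'a::complex_inner. a *\<^sub>C x)"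
proof (rule bounded_linear_intro[where K="cmod a"])
  show "a *\<^sub>C (r *\<^sub>R x) = r *\<^sub>R (a *\<^sub>C x)" for r and x :: 'a
    by (simp add: scaleR_scaleC scaleC_scaleC mult.commute)
qed (auto simp: scaleC_add_right norm_scaleC)

instantiation complex :: chilbert_space
begin
definition scaleC_complex :: "complex \<Rightarrow> complex \<Rightarrow> complex" where
  "scaleC_complex a x = a * x"
definition cinner_complex :: "complex \<Rightarrow> complex \<Rightarrow> complex" where
  "cinner_complex x y = x * cnj y"
instance
  by standard (simp_all add: scaleC_complex_def cinner_complex_def algebra_simps
      inner_complex_def scaleR_conv_of_real)
end

instantiation prod :: (complex_vector, complex_vector) complex_vector
begin
definition scaleC_prod :: "complex \<Rightarrow> 'a \<times> 'b \<Rightarrow> 'a \<times> 'b" where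
  "scaleC_prod a x = (a *\<^sub>C fst x, a *\<^sub>C snd x)"
instance
  by standard (simp_all add: scaleC_prod_def prod_eq_iff
    scaleC_add_left scaleC_add_right scaleC_scaleC scaleR_scaleC)
end

instantiation prod :: (complex_inner, complex_inner) complex_inner
begin
definition cinner_prod :: "'a \<times> 'b \<Rightarrow> 'a \<times> 'b \<Rightarrow> complex" where
  "cinner_prod x y = cinner (fst x) (fst y) + cinner (snd x) (snd y)"
instance
proof
  show "cinner x y = cnj (cinner y x)" for x y :: "'a \<times> 'b"
    unfolding cinner_prod_def complex_cnj_add by (simp flip: cinner_commute)
qed (simp_all add: cinner_prod_def scaleC_prod_def algebra_simps cinner_add_left
    cinner_scaleC_left Re_cinner inner_prod_def)
end

instance prod :: (chilbert_space, chilbert_space) chilbert_space ..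

instantiation blinfun :: (real_normed_vector, complex_inner) complex_vector
begin
lift_definition scaleC_blinfun :: "complex \<Rightarrow> ('a \<Rightarrow>\<^sub>L 'b) \<Rightarrow> ('a \<Rightarrow>\<^sub>L 'b)"
  is "\<lambda>a T x. a *\<^sub>C T x"
  using bounded_linear_compose[OF bounded_linear_scaleC] by blast
instance
proof
  fix a b :: complex and r :: real and S T :: "'a \<Rightarrow>\<^sub>L 'b"
  show "a *\<^sub>C (S + T) = a *\<^sub>C S + a *\<^sub>C T"
    by (rule blinfun_eqI) (simp add: scaleC_blinfun.rep_eq blinfun.add_left scaleC_add_right)
  show "(a + b) *\<^sub>C T = a *\<^sub>C T + b *\<^sub>C T"
    by (rule blinfun_eqI) (simp add: scaleC_blinfun.rep_eq blinfun.add_left scaleC_add_left)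
  show "a *\<^sub>C b *\<^sub>C T = (a * b) *\<^sub>C T"
    by (rule blinfun_eqI) (simp add: scaleC_blinfun.rep_eq scaleC_scaleC)
  show "r *\<^sub>R T = complex_of_real r *\<^sub>C T"
    by (rule blinfun_eqI) (simp only: scaleC_blinfun.rep_eq blinfun.scaleR_left scaleR_scaleC)
qed
end


section \<open>The rotation-invariant probability measure on the sphere\<close>

definition S3 :: "(real^4) set" where
  "S3 = sphere 0 1"

definition rotation_invariant_prob_S3 :: "(real^4) measure \<Rightarrow> bool" where
  "rotation_invariant_prob_S3 \<mu> \<longleftrightarrow>
     sets \<mu> = sets (restrict_space borel S3) \<and> prob_space \<mu> \<and>
     (\<forall>Q :: real^4^4. rotation_matrix Q \<longrightarrow> distr \<mu> \<mu> (\<lambda>x. Q *v x) = \<mu>)"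

lemma rot_S3: 
  fixes Q :: "real^4^4"
  assumes "rotation_matrix Q"
  shows "orthogonal_transformation (\<lambda>x. Q *v x)"
    and "x \<in> S3 \<Longrightarrow> Q *v x \<in> S3"
proof -
  show *: "orthogonal_transformation (\<lambda>x. Q *v x)"
    using assms by (simp add: rotation_matrix_def orthogonal_transformation_matrix)
  show "x \<in> S3 \<Longrightarrow> Q *v x \<in> S3"
    using orthogonal_transformation_norm[OF *] by (simp add: S3_def)
qed

lemma rot_measurable_borel: 
  fixes Q :: "real^4^4"
  shows "(\<lambda>x. Q *v x) \<in> borel_measurable borel"
  by (rule borel_measurable_continuous_onI) (rule linear_continuous_on, simp add: matrix_vector_mul_bounded_linear)

lemma rot_measurable: 
  fixes Q :: "real^4^4"
  assumes "rotation_matrix Q" "sets M = sets (restrict_space borel S3)"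
  shows "(\<lambda>x. Q *v x) \<in> measurable M M"
proof -
  have "(\<lambda>x. Q *v x) \<in> measurable (restrict_space borel S3) (restrict_space borel S3)"
    by (rule measurable_restrict_space3) (use rot_measurable_borel rot_S3[OF assms(1)] in auto)
  then show ?thesis
    using assms(2) measurable_cong_sets by blast
qed

lemma S3_nonempty: "axis 1 1 \<in> S3"
  by (simp add: S3_def)

lemma rotation_invariant_prob_S3_exists: "\<exists>\<mu>. rotation_invariant_prob_S3 \<mu>"
proof -
  let ?B = "ball (0::real^4) 1"
  let ?N = "restrict_space borel S3"
  let ?U = "uniform_measure lborel ?B"
  define g where "g = (\<lambda>x::real^4. if x = 0 then axis 1 1 else sgn x)"
  have B_pos: "emeasure lborel ?B \<noteq> 0"
  proof -
    have "unit_ball_vol 4 > 0" by (rule unit_ball_vol_pos) simp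
    then have "unit_ball_vol 4 \<noteq> 0" by (metis less_irrefl)
    then show ?thesis by (simp add: emeasure_ball)
  qed
  have B_fin: "emeasure lborel ?B \<noteq> \<infinity>"
    using emeasure_lborel_ball_finite by (metis infinity_ennreal_def less_irrefl)
  interpret U: prob_space ?U
    by (rule prob_space_uniform_measure) (use B_pos B_fin in auto)
  have g_meas: "g \<in> measurable ?U ?N"
  proof (rule measurable_restrict_space2)
    show "g \<in> space ?U \<rightarrow> S3"
      by (auto simp: g_def S3_def norm_sgn)
    show "g \<in> measurable ?U borel"
      unfolding g_def sgn_div_norm by simp
  qed
  let ?M = "distr ?U ?N g"
  have "distr ?M ?M (\<lambda>x. Q *v x) = ?M" if Q: "rotation_matrix Q" for Q :: "real^4^4"
  proof -
    let ?f = "\<lambda>x. Q *v x"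
    have ot: "orthogonal_transformation ?f" using rot_S3[OF Q] by simp
    have inj: "inj ?f" using orthogonal_transformation_inj[OF ot] .
    have gf: "g (?f x) = ?f (g x)" if "x \<noteq> 0" for x
      using that orthogonal_transformation_norm[OF ot] inj
      by (auto simp: g_def sgn_div_norm matrix_vector_mult_scaleR inj_def)
    have fm: "?f \<in> measurable ?N ?N" by (rule rot_measurable[OF Q refl])
    have "distr ?M ?M ?f = distr ?M ?N ?f"
      by (rule distr_cong) auto
    also have "\<dots> = distr ?U ?N (?f \<circ> g)"
      by (rule distr_distr[OF fm g_meas])
    also have "\<dots> = distr ?U ?N (g \<circ> ?f)"
    proof (rule distr_cong_AE)
      show "AE x in ?U. (?f \<circ> g) x = (g \<circ> ?f) x"
      proof (rule AE_uniform_measureI)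
        show "AE x in lborel. x \<in> ?B \<longrightarrow> (?f \<circ> g) x = (g \<circ> ?f) x"
          using AE_lborel_singleton[of "0::real^4"] by eventually_elim (simp add: gf)
      qed simp
    qed (use g_meas fm rot_measurable_borel in \<open>auto intro!: measurable_comp[of _ _ borel]\<close>)
    also have "\<dots> = distr (distr ?U borel ?f) ?N g"
    proof (rule distr_distr[symmetric])
      show "g \<in> measurable borel ?N" using g_meas by simp
      show "?f \<in> measurable ?U borel" using rot_measurable_borel by simp
    qed
    also have "distr ?U borel ?f = ?U"
    proof (rule measure_eqI)
      show "sets (distr ?U borel ?f) = sets ?U" by simp
      fix A assume "A \<in> sets (distr ?U borel ?f)"
      then have A: "A \<in> sets borel" by simp
      have A': "?f -` A \<in> sets borel"
        using measurable_sets[OF rot_measurable_borel A] by simp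
      have e: "?f ` (?B \<inter> ?f -` A) = ?B \<inter> A"
      proof (intro set_eqI iffI)
        fix y assume y: "y \<in> ?B \<inter> A"
        obtain x where x: "y = ?f x"
          using orthogonal_transformation_surj[OF ot] by (rule surjE)
        have "x \<in> ?B" using y orthogonal_transformation_norm[OF ot, of x] by (simp add: x)
        then show "y \<in> ?f ` (?B \<inter> ?f -` A)" using y x by blast
      next
        fix y assume "y \<in> ?f ` (?B \<inter> ?f -` A)"
        then show "y \<in> ?B \<inter> A" using orthogonal_transformation_norm[OF ot] by auto
      qed
      have lm: "?B \<inter> ?f -` A \<in> lmeasurable" "?B \<inter> A \<in> lmeasurable"
        using A A' by (auto intro!: bounded_set_imp_lmeasurable)
      have "measure lebesgue (?B \<inter> A) = measure lebesgue (?B \<inter> ?f -` A)"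
        using measure_orthogonal_image[OF ot lm(1)] e by simp
      then have "emeasure lebesgue (?B \<inter> A) = emeasure lebesgue (?B \<inter> ?f -` A)"
        using lm by (simp add: emeasure_eq_measure2)
      then have "emeasure lborel (?B \<inter> A) = emeasure lborel (?B \<inter> ?f -` A)"
        using A A' by (simp add: emeasure_completion)
      then show "emeasure (distr ?U borel ?f) A = emeasure ?U A"
        using A A' rot_measurable_borel by (simp add: emeasure_distr)
    qed
    finally show ?thesis .
  qed
  then have "rotation_invariant_prob_S3 ?M"
    unfolding rotation_invariant_prob_S3_def
    using U.prob_space_distr[OF g_meas] by simp
  then show ?thesis ..
qed

lemma rotation_invariant_ball:
  assumes \<mu>: "rotation_invariant_prob_S3 \<mu>" and x: "x \<in> S3" and y: "y \<in> S3"
  shows "emeasure \<mu> (ball x r \<inter> S3) = emeasure \<mu> (ball y r \<inter> S3)"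
proof -
  obtain f :: "real^4 \<Rightarrow> real^4" where f: "orthogonal_transformation f" "det (matrix f) = 1" "f x = y"
    using rotation_exists[of x y] x y by (auto simp: S3_def)
  let ?Q = "matrix f"
  have Qf: "?Q *v z = f z" for z
    using f(1) by (simp add: orthogonal_transformation_linear matrix_works)
  have Q: "rotation_matrix ?Q"
    using f by (simp add: rotation_matrix_def orthogonal_transformation_matrix)
  have sets: "sets \<mu> = sets (restrict_space borel S3)" and inv: "distr \<mu> \<mu> (\<lambda>x. ?Q *v x) = \<mu>"
    using \<mu> Q by (auto simp: rotation_invariant_prob_S3_def)
  have sp: "space \<mu> = S3" using sets_eq_imp_space_eq[OF sets] by (simp add: space_restrict_space)
  have ms: "ball y r \<inter> S3 \<in> sets \<mu>"
    unfolding sets by (auto simp: sets_restrict_space)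
  have "emeasure \<mu> (ball y r \<inter> S3) = emeasure (distr \<mu> \<mu> (\<lambda>x. ?Q *v x)) (ball y r \<inter> S3)"
    by (simp add: inv)
  also have "\<dots> = emeasure \<mu> ((\<lambda>x. ?Q *v x) -` (ball y r \<inter> S3) \<inter> space \<mu>)"
    by (rule emeasure_distr[OF rot_measurable[OF Q sets] ms])
  also have "(\<lambda>x. ?Q *v x) -` (ball y r \<inter> S3) \<inter> space \<mu> = ball x r \<inter> S3"
    using f(1)[unfolded orthogonal_transformation_isometry] orthogonal_transformation_norm[OF f(1)]
    by (auto simp: sp Qf S3_def f(3)[symmetric])
  finally show ?thesis by simp
qed

lemma rotation_invariant_prob_S3_D:
  assumes "rotation_invariant_prob_S3 \<mu>"
  shows "sets \<mu> = sets (restrict_space borel S3)" "space \<mu> = S3" "prob_space \<mu>"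
    "(\<lambda>x. x) \<in> measurable \<mu> borel"
proof -
  show s: "sets \<mu> = sets (restrict_space borel S3)" and "prob_space \<mu>"
    using assms by (auto simp: rotation_invariant_prob_S3_def)
  show "space \<mu> = S3" using sets_eq_imp_space_eq[OF s] by (simp add: space_restrict_space)
  have "(\<lambda>x. x) \<in> measurable (restrict_space borel S3) borel"
    by (rule measurable_restrict_space1) simp
  then show "(\<lambda>x. x) \<in> measurable \<mu> borel"
    using s measurable_cong_sets by blast
qed

lemma rotation_invariant_ball_pos:
  assumes \<mu>: "rotation_invariant_prob_S3 \<mu>" and x: "x \<in> S3" and r: "r > 0"
  shows "emeasure \<mu> (ball x r \<inter> S3) \<noteq> 0"
proof
  assume 0: "emeasure \<mu> (ball x r \<inter> S3) = 0"
  note D = rotation_invariant_prob_S3_D[OF \<mu>]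
  interpret prob_space \<mu> by (rule D)
  have "compact S3" by (simp add: S3_def)
  moreover have "S3 \<subseteq> (\<Union>y\<in>S3. ball y r)" using r by force
  ultimately obtain C where C: "C \<subseteq> S3" "finite C" "S3 \<subseteq> (\<Union>y\<in>C. ball y r)"
    using compactE_image[of S3 S3 "\<lambda>y. ball y r"] by (metis open_ball)
  have ms: "ball y r \<inter> S3 \<in> sets \<mu>" for y
    unfolding D(1) by (auto simp: sets_restrict_space)
  have "(\<Union>y\<in>C. ball y r \<inter> S3) \<in> null_sets \<mu>"
  proof (rule null_sets.finite_UN)
    fix y assume "y \<in> C"
    then have "emeasure \<mu> (ball y r \<inter> S3) = 0"
      using rotation_invariant_ball[OF \<mu> x, of y r] C 0 by auto
    with ms show "ball y r \<inter> S3 \<in> null_sets \<mu>" by auto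
  qed fact
  moreover have "(\<Union>y\<in>C. ball y r \<inter> S3) = space \<mu>" using C by (auto simp: D)
  ultimately show False using emeasure_space_1 by auto
qed

lemma rotation_invariant_Fubini:
  assumes \<mu>: "rotation_invariant_prob_S3 \<mu>" and \<nu>: "rotation_invariant_prob_S3 \<nu>"
    and p: "p \<in> S3" and U: "U \<in> sets \<nu>"
  shows "(\<integral>\<^sup>+x. emeasure \<nu> (U \<inter> ball x r) \<partial>\<mu>) = emeasure \<mu> (ball p r \<inter> S3) * emeasure \<nu> U"
    and "(\<lambda>x. emeasure \<nu> (U \<inter> ball x r)) \<in> borel_measurable \<mu>"
proof -
  note D = rotation_invariant_prob_S3_D[OF \<mu>]
  note E = rotation_invariant_prob_S3_D[OF \<nu>]
  interpret M: prob_space \<mu> by (rule D)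
  interpret N: prob_space \<nu> by (rule E)
  interpret P: pair_sigma_finite \<mu> \<nu> by unfold_locales
  have ms: "ball y r \<inter> S3 \<in> sets \<mu>" "ball y r \<inter> S3 \<in> sets \<nu>" for y
    unfolding D(1) E(1) by (auto simp: sets_restrict_space)
  have US: "U \<subseteq> S3" using U sets.sets_into_space E(2) by blast
  have i: "(\<lambda>z. fst z) \<in> measurable (\<mu> \<Otimes>\<^sub>M \<nu>) borel" "(\<lambda>z. snd z) \<in> measurable (\<mu> \<Otimes>\<^sub>M \<nu>) borel"
    using measurable_compose[OF measurable_fst D(4)] measurable_compose[OF measurable_snd E(4)] by auto
  have d: "(\<lambda>z. dist (fst z) (snd z)) \<in> borel_measurable (\<mu> \<Otimes>\<^sub>M \<nu>)"
    using i by measurable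
  let ?k = "\<lambda>x y. indicator U y * indicator {..<r} (dist x y) :: ennreal"
  have k: "case_prod ?k \<in> borel_measurable (\<mu> \<Otimes>\<^sub>M \<nu>)"
    using d U by (simp add: case_prod_beta') measurable
  have e: "emeasure \<nu> (U \<inter> ball x r) = (\<integral>\<^sup>+y. ?k x y \<partial>\<nu>)" for x
  proof -
    have "U \<inter> ball x r = U \<inter> (ball x r \<inter> S3)" using US by auto
    then have m: "U \<inter> ball x r \<in> sets \<nu>" using U ms by auto
    have "?k x y = indicator (U \<inter> ball x r) y" for y by (auto split: split_indicator)
    then show ?thesis using m by simp
  qed
  show "(\<lambda>x. emeasure \<nu> (U \<inter> ball x r)) \<in> borel_measurable \<mu>"
    unfolding e using k by (rule N.borel_measurable_nn_integral)
  have "(\<integral>\<^sup>+x. emeasure \<nu> (U \<inter> ball x r) \<partial>\<mu>) = (\<integral>\<^sup>+x. (\<integral>\<^sup>+y. ?k x y \<partial>\<nu>) \<partial>\<mu>)"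
    by (simp only: e)
  also have "\<dots> = (\<integral>\<^sup>+y. (\<integral>\<^sup>+x. ?k x y \<partial>\<mu>) \<partial>\<nu>)"
    using P.Fubini[OF k] by simp
  also have "\<dots> = (\<integral>\<^sup>+y. emeasure \<mu> (ball p r \<inter> S3) * indicator U y \<partial>\<nu>)"
  proof (rule nn_integral_cong)
    fix y assume "y \<in> space \<nu>"
    then have y: "y \<in> S3" by (simp add: E)
    have "(\<integral>\<^sup>+x. ?k x y \<partial>\<mu>) = (\<integral>\<^sup>+x. indicator U y * indicator (ball y r \<inter> S3) x \<partial>\<mu>)"
      by (rule nn_integral_cong) (auto simp: D dist_commute split: split_indicator)
    also have "\<dots> = indicator U y * emeasure \<mu> (ball y r \<inter> S3)"
      using ms by (simp add: nn_integral_cmult)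
    finally show "(\<integral>\<^sup>+x. ?k x y \<partial>\<mu>) = emeasure \<mu> (ball p r \<inter> S3) * indicator U y"
      using rotation_invariant_ball[OF \<mu> p y, of r] by (simp add: mult.commute)
  qed
  also have "\<dots> = emeasure \<mu> (ball p r \<inter> S3) * emeasure \<nu> U"
    using U by (simp add: nn_integral_cmult)
  finally show "(\<integral>\<^sup>+x. emeasure \<nu> (U \<inter> ball x r) \<partial>\<mu>) = emeasure \<mu> (ball p r \<inter> S3) * emeasure \<nu> U" .
qed

lemma rotation_invariant_le:
  assumes \<mu>: "rotation_invariant_prob_S3 \<mu>" and \<nu>: "rotation_invariant_prob_S3 \<nu>" and V: "open V"
  shows "emeasure \<mu> (V \<inter> S3) \<le> emeasure \<nu> (V \<inter> S3)"
proof -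
  note D = rotation_invariant_prob_S3_D[OF \<mu>]
  note E = rotation_invariant_prob_S3_D[OF \<nu>]
  interpret M: prob_space \<mu> by (rule D)
  interpret N: prob_space \<nu> by (rule E)
  obtain p where p: "p \<in> S3" using S3_nonempty by blast
  define g where "g r = emeasure \<mu> (ball p r \<inter> S3)" for r
  have g_eq: "emeasure \<nu> (ball x r \<inter> S3) = g r" if "x \<in> S3" for x r
  proof -
    have "g r = (\<integral>\<^sup>+x. emeasure \<nu> (S3 \<inter> ball x r) \<partial>\<mu>)"
      using rotation_invariant_Fubini(1)[OF \<mu> \<nu> p, of S3 r] sets.top[of \<nu>] N.emeasure_space_1
      by (simp add: E g_def)
    also have "\<dots> = (\<integral>\<^sup>+y. emeasure \<nu> (ball x r \<inter> S3) \<partial>\<mu>)"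
      using rotation_invariant_ball[OF \<nu> that] by (intro nn_integral_cong) (simp add: D Int_commute)
    also have "\<dots> = emeasure \<nu> (ball x r \<inter> S3)"
      using M.emeasure_space_1 by simp
    finally show ?thesis by simp
  qed
  have g0: "g r \<noteq> 0" if "r > 0" for r
    using rotation_invariant_ball_pos[OF \<mu> p that] by (simp add: g_def)
  have gfin: "g r \<noteq> \<infinity>" for r
    using M.emeasure_finite by (simp add: g_def)
  define U where "U = V \<inter> S3"
  have U: "U \<in> sets \<mu>" "U \<in> sets \<nu>"
    unfolding D(1) E(1) U_def using V by (auto simp: sets_restrict_space)
  define rr where "rr n = 1 / real (Suc n)" for n
  have rr: "rr n > 0" for n by (simp add: rr_def)
  define F where "F n x = emeasure \<nu> (U \<inter> ball x (rr n)) / g (rr n)" for n x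
  have F: "F n \<in> borel_measurable \<mu>" for n
    unfolding F_def using rotation_invariant_Fubini(2)[OF \<mu> \<nu> p U(2)] by measurable
  have "indicator U x \<le> liminf (\<lambda>n. F n x)" for x
  proof (cases "x \<in> U")
    case True
    then obtain e where e: "e > 0" "ball x e \<subseteq> V"
      using V by (auto simp: U_def open_contains_ball)
    have "eventually (\<lambda>n. rr n < e) sequentially"
      using order_tendstoD(2)[OF LIMSEQ_inverse_real_of_nat e(1)]
      by (simp add: rr_def inverse_eq_divide)
    then have "eventually (\<lambda>n. F n x = 1) sequentially"
    proof eventually_elim
      case (elim n)
      have "U \<inter> ball x (rr n) = ball x (rr n) \<inter> S3" using elim e by (auto simp: U_def)
      then have "F n x = g (rr n) / g (rr n)"
        unfolding F_def using g_eq True by (simp add: U_def)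
      then show ?case using g0[OF rr] gfin by (simp add: ennreal_divide_self less_top[symmetric])
    qed
    then have "liminf (\<lambda>n. F n x) = liminf (\<lambda>n::nat. (1::ennreal))" by (rule Liminf_eq)
    then show ?thesis using True by (simp add: Liminf_const)
  qed simp
  then have "(\<integral>\<^sup>+x. indicator U x \<partial>\<mu>) \<le> (\<integral>\<^sup>+x. liminf (\<lambda>n. F n x) \<partial>\<mu>)"
    by (intro nn_integral_mono)
  also have "\<dots> \<le> liminf (\<lambda>n. \<integral>\<^sup>+x. F n x \<partial>\<mu>)"
    by (rule nn_integral_liminf) (rule F)
  also have "(\<lambda>n. \<integral>\<^sup>+x. F n x \<partial>\<mu>) = (\<lambda>n. emeasure \<nu> U)"
  proof
    fix n
    have "(\<integral>\<^sup>+x. F n x \<partial>\<mu>) = (g (rr n) * emeasure \<nu> U) / g (rr n)"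
      unfolding F_def
      using rotation_invariant_Fubini[OF \<mu> \<nu> p U(2), of "rr n"] by (simp add: nn_integral_divide g_def)
    also have "\<dots> = emeasure \<nu> U"
      using g0[OF rr] gfin by (metis ennreal_mult_divide_eq mult.commute infinity_ennreal_def)
    finally show "(\<integral>\<^sup>+x. F n x \<partial>\<mu>) = emeasure \<nu> U" .
  qed
  finally show ?thesis using U by (simp add: Liminf_const U_def)
qed

lemma rotation_invariant_prob_S3_unique:
  assumes \<mu>: "rotation_invariant_prob_S3 \<mu>" and \<nu>: "rotation_invariant_prob_S3 \<nu>"
  shows "\<mu> = \<nu>"
proof -
  note D = rotation_invariant_prob_S3_D[OF \<mu>]
  note E = rotation_invariant_prob_S3_D[OF \<nu>]
  interpret M: prob_space \<mu> by (rule D)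
  interpret N: prob_space \<nu> by (rule E)
  have "distr \<mu> borel (\<lambda>x. x) = distr \<nu> borel (\<lambda>x. x)"
  proof (rule measure_eqI_generator_eq[where E="{S. open S}" and \<Omega>=UNIV and A="\<lambda>_. UNIV"])
    show "Int_stable {S::(real^4) set. open S}" by (auto simp: Int_stable_def)
    fix V :: "(real^4) set" assume "V \<in> {S. open S}"
    then have V: "open V" by simp
    have "emeasure (distr \<mu> borel (\<lambda>x. x)) V = emeasure \<mu> (V \<inter> S3)"
      using V D by (subst emeasure_distr) auto
    moreover have "emeasure (distr \<nu> borel (\<lambda>x. x)) V = emeasure \<nu> (V \<inter> S3)"
      using V E by (subst emeasure_distr) auto
    ultimately show "emeasure (distr \<mu> borel (\<lambda>x. x)) V = emeasure (distr \<nu> borel (\<lambda>x. x)) V"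
      using rotation_invariant_le[OF \<mu> \<nu> V] rotation_invariant_le[OF \<nu> \<mu> V] by simp
  next
    show "emeasure (distr \<mu> borel (\<lambda>x. x)) UNIV \<noteq> \<infinity>"
      using D(4) by (subst emeasure_distr) auto
  qed (auto simp: borel_def)
  note eq = this
  show ?thesis
  proof (rule measure_eqI)
    show "sets \<mu> = sets \<nu>" using D E by simp
    fix A assume A: "A \<in> sets \<mu>"
    have "S3 \<in> sets borel" by (simp add: S3_def)
    then have B: "A \<in> sets borel" "A \<subseteq> S3" using A unfolding D(1) by (auto simp: sets_restrict_space)
    have "emeasure (distr \<mu> borel (\<lambda>x. x)) A = emeasure \<mu> A"
      using B D by (subst emeasure_distr) (auto simp: Int_absorb2)
    moreover have "emeasure (distr \<nu> borel (\<lambda>x. x)) A = emeasure \<nu> A"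
      using B E by (subst emeasure_distr) (auto simp: Int_absorb2)
    ultimately show "emeasure \<mu> A = emeasure \<nu> A" using eq by simp
  qed
qed

definition m_S3 :: "(real^4) measure" where
  "m_S3 = (THE \<mu>. rotation_invariant_prob_S3 \<mu>)"

lemma rotation_invariant_m_S3: "rotation_invariant_prob_S3 m_S3"
  unfolding m_S3_def
  using rotation_invariant_prob_S3_exists rotation_invariant_prob_S3_unique by (metis theI)

interpretation m_S3: prob_space m_S3
  using rotation_invariant_m_S3 by (rule rotation_invariant_prob_S3_D)

lemma space_m_S3: "space m_S3 = S3"
  by (rule rotation_invariant_prob_S3_D[OF rotation_invariant_m_S3])


section \<open>The Hilbert space of square-integrable functions on the sphere\<close>

definition square_integrable_S3 :: "(real^4 \<Rightarrow> complex) \<Rightarrow> bool" where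
  "square_integrable_S3 f \<longleftrightarrow>
     f \<in> borel_measurable m_S3 \<and> integrable m_S3 (\<lambda>x. (cmod (f x))\<^sup>2)"

lemma sqi_0: "square_integrable_S3 (\<lambda>x. 0)"
  by (simp add: square_integrable_S3_def)

lemma sqi_mult:
  assumes "square_integrable_S3 f" "k \<in> borel_measurable m_S3"
    and "\<And>x. x \<in> S3 \<Longrightarrow> cmod (k x) \<le> C"
  shows "square_integrable_S3 (\<lambda>x. k x * f x)"
  unfolding square_integrable_S3_def
proof (intro conjI)
  have f: "f \<in> borel_measurable m_S3" and i: "integrable m_S3 (\<lambda>x. (cmod (f x))\<^sup>2)"
    using assms by (auto simp: square_integrable_S3_def)
  show kf: "(\<lambda>x. k x * f x) \<in> borel_measurable m_S3" using f assms(2) by measurable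
  show "integrable m_S3 (\<lambda>x. (cmod (k x * f x))\<^sup>2)"
  proof (rule Bochner_Integration.integrable_bound)
    show "integrable m_S3 (\<lambda>x. C\<^sup>2 * (cmod (f x))\<^sup>2)" using i by simp
    show "AE x in m_S3. norm ((cmod (k x * f x))\<^sup>2) \<le> norm (C\<^sup>2 * (cmod (f x))\<^sup>2)"
      using assms(3) by (intro AE_I2) (auto simp: space_m_S3 norm_mult power_mult_distrib
          intro!: mult_right_mono power_mono)
  qed (use kf in measurable)
qed

lemma sqi_add:
  assumes "square_integrable_S3 f" "square_integrable_S3 g"
  shows "square_integrable_S3 (\<lambda>x. f x + g x)"
  unfolding square_integrable_S3_def
proof (intro conjI)
  have f: "f \<in> borel_measurable m_S3" "g \<in> borel_measurable m_S3"
    and i: "integrable m_S3 (\<lambda>x. (cmod (f x))\<^sup>2)" "integrable m_S3 (\<lambda>x. (cmod (g x))\<^sup>2)"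
    using assms by (auto simp: square_integrable_S3_def)
  show fg: "(\<lambda>x. f x + g x) \<in> borel_measurable m_S3" using f by measurable
  show "integrable m_S3 (\<lambda>x. (cmod (f x + g x))\<^sup>2)"
  proof (rule Bochner_Integration.integrable_bound)
    show "integrable m_S3 (\<lambda>x. 2 * (cmod (f x))\<^sup>2 + 2 * (cmod (g x))\<^sup>2)" using i by simp
    have "(cmod (f x + g x))\<^sup>2 \<le> 2 * (cmod (f x))\<^sup>2 + 2 * (cmod (g x))\<^sup>2" for x
    proof -
      have "(cmod (f x + g x))\<^sup>2 \<le> (cmod (f x) + cmod (g x))\<^sup>2"
        by (intro power_mono norm_triangle_ineq) simp
      also have "\<dots> \<le> 2 * (cmod (f x))\<^sup>2 + 2 * (cmod (g x))\<^sup>2"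
        using sum_squares_bound[of "cmod (f x)" "cmod (g x)"] by (simp add: power2_sum)
      finally show ?thesis .
    qed
    then show "AE x in m_S3. norm ((cmod (f x + g x))\<^sup>2) \<le> norm (2 * (cmod (f x))\<^sup>2 + 2 * (cmod (g x))\<^sup>2)"
      by (intro AE_I2) simp
  qed (use fg in measurable)
qed

lemma sqi_cmult: "square_integrable_S3 f \<Longrightarrow> square_integrable_S3 (\<lambda>x. a * f x)"
  by (rule sqi_mult[where C="cmod a"]) auto

lemma sqi_minus: "square_integrable_S3 f \<Longrightarrow> square_integrable_S3 (\<lambda>x. - f x)"
  using sqi_cmult[of f "-1"] by simp

lemma sqi_diff: "square_integrable_S3 f \<Longrightarrow> square_integrable_S3 g \<Longrightarrow> square_integrable_S3 (\<lambda>x. f x - g x)"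
  using sqi_add[OF _ sqi_minus, of f g] by simp

lemma sqi_integrable:
  assumes "square_integrable_S3 f" "square_integrable_S3 g"
  shows "integrable m_S3 (\<lambda>x. f x * cnj (g x))"
proof (rule Bochner_Integration.integrable_bound)
  have f: "f \<in> borel_measurable m_S3" "g \<in> borel_measurable m_S3"
    and i: "integrable m_S3 (\<lambda>x. (cmod (f x))\<^sup>2)" "integrable m_S3 (\<lambda>x. (cmod (g x))\<^sup>2)"
    using assms by (auto simp: square_integrable_S3_def)
  show "integrable m_S3 (\<lambda>x. (cmod (f x))\<^sup>2 + (cmod (g x))\<^sup>2)" using i by simp
  have "(\<lambda>x. cnj (g x)) \<in> borel_measurable m_S3"
    by (rule measurable_compose[OF f(2)]) (intro borel_measurable_continuous_onI continuous_intros)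
  then show "(\<lambda>x. f x * cnj (g x)) \<in> borel_measurable m_S3" using f by measurable
  have "cmod (f x) * cmod (g x) \<le> (cmod (f x))\<^sup>2 + (cmod (g x))\<^sup>2" for x
    using sum_squares_bound[of "cmod (f x)" "cmod (g x)"] mult_nonneg_nonneg[of "cmod (f x)" "cmod (g x)"]
    by (simp del: mult_nonneg_nonneg) 
  then show "AE x in m_S3. norm (f x * cnj (g x)) \<le> norm ((cmod (f x))\<^sup>2 + (cmod (g x))\<^sup>2)"
    by (intro AE_I2) (simp add: norm_mult)
qed

lemma integral_mult_cnj: "(\<integral>x. f x * cnj (g x) \<partial>M) = cnj (\<integral>x. g x * cnj (f x) \<partial>M)"
proof -
  have "(\<integral>x. f x * cnj (g x) \<partial>M) = (\<integral>x. cnj (g x * cnj (f x)) \<partial>M)"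
    by (simp add: mult.commute del: Bochner_Integration.integral_cnj)
  also have "\<dots> = cnj (\<integral>x. g x * cnj (f x) \<partial>M)" by (rule Bochner_Integration.integral_cnj)
  finally show ?thesis .
qed

quotient_type L2_S3 = "real^4 \<Rightarrow> complex" / partial:
  "\<lambda>f g. square_integrable_S3 f \<and> square_integrable_S3 g \<and> (AE x in m_S3. f x = g x)"
proof (rule part_equivpI)
  show "\<exists>f. square_integrable_S3 f \<and> square_integrable_S3 f \<and> (AE x in m_S3. f x = f x)"
    using sqi_0 by auto
qed (auto intro!: sympI transpI)

instantiation L2_S3 :: complex_inner
begin

lift_definition zero_L2_S3 :: L2_S3 is "\<lambda>x. 0"
  using sqi_0 by simp
lift_definition plus_L2_S3 :: "L2_S3 \<Rightarrow> L2_S3 \<Rightarrow> L2_S3" is "\<lambda>f g x. f x + g x"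
proof (elim conjE, intro conjI)
  fix f f' g g' :: "real^4 \<Rightarrow> complex"
  assume "AE x in m_S3. f x = f' x" "AE x in m_S3. g x = g' x"
  then show "AE x in m_S3. f x + g x = f' x + g' x" by eventually_elim simp
qed (assumption | rule sqi_add)+
lift_definition uminus_L2_S3 :: "L2_S3 \<Rightarrow> L2_S3" is "\<lambda>f x. - f x"
proof (elim conjE, intro conjI)
  fix f f' :: "real^4 \<Rightarrow> complex"
  assume "AE x in m_S3. f x = f' x"
  then show "AE x in m_S3. - f x = - f' x" by eventually_elim simp
qed (assumption | rule sqi_minus)+
lift_definition minus_L2_S3 :: "L2_S3 \<Rightarrow> L2_S3 \<Rightarrow> L2_S3" is "\<lambda>f g x. f x - g x"
proof (elim conjE, intro conjI)
  fix f f' g g' :: "real^4 \<Rightarrow> complex"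
  assume "AE x in m_S3. f x = f' x" "AE x in m_S3. g x = g' x"
  then show "AE x in m_S3. f x - g x = f' x - g' x" by eventually_elim simp
qed (assumption | rule sqi_diff)+
lift_definition scaleC_L2_S3 :: "complex \<Rightarrow> L2_S3 \<Rightarrow> L2_S3" is "\<lambda>a f x. a * f x"
proof (elim conjE, intro conjI)
  fix f f' :: "real^4 \<Rightarrow> complex" and a :: complex
  assume "AE x in m_S3. f x = f' x"
  then show "AE x in m_S3. a * f x = a * f' x" by eventually_elim simp
qed (assumption | rule sqi_cmult)+
lift_definition cinner_L2_S3 :: "L2_S3 \<Rightarrow> L2_S3 \<Rightarrow> complex"
  is "\<lambda>f g. \<integral>x. f x * cnj (g x) \<partial>m_S3"
proof -
  fix f f' g g' :: "real^4 \<Rightarrow> complex"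
  assume 1: "square_integrable_S3 f \<and> square_integrable_S3 f' \<and> (AE x in m_S3. f x = f' x)"
    and 2: "square_integrable_S3 g \<and> square_integrable_S3 g' \<and> (AE x in m_S3. g x = g' x)"
  show "(\<integral>x. f x * cnj (g x) \<partial>m_S3) = (\<integral>x. f' x * cnj (g' x) \<partial>m_S3)"
  proof (rule integral_cong_AE)
    show "(\<lambda>x. f x * cnj (g x)) \<in> borel_measurable m_S3" "(\<lambda>x. f' x * cnj (g' x)) \<in> borel_measurable m_S3"
      using 1 2 by (simp_all add: borel_measurable_integrable sqi_integrable)
    show "AE x in m_S3. f x * cnj (g x) = f' x * cnj (g' x)"
      using 1[THEN conjunct2, THEN conjunct2] 2[THEN conjunct2, THEN conjunct2] by eventually_elim simp
  qed
qed
definition scaleR_L2_S3 :: "real \<Rightarrow> L2_S3 \<Rightarrow> L2_S3" where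
  "scaleR_L2_S3 r f = complex_of_real r *\<^sub>C f"
definition inner_L2_S3 :: "L2_S3 \<Rightarrow> L2_S3 \<Rightarrow> real" where
  "inner_L2_S3 f g = Re (cinner f g)"
definition norm_L2_S3 :: "L2_S3 \<Rightarrow> real" where
  "norm_L2_S3 f = sqrt (inner f f)"
definition sgn_L2_S3 :: "L2_S3 \<Rightarrow> L2_S3" where
  "sgn_L2_S3 f = scaleR (inverse (norm f)) f"
definition dist_L2_S3 :: "L2_S3 \<Rightarrow> L2_S3 \<Rightarrow> real" where
  "dist_L2_S3 f g = norm (f - g)"
definition uniformity_L2_S3 :: "(L2_S3 \<times> L2_S3) filter" where
  "uniformity_L2_S3 = (INF e\<in>{0<..}. principal {(x, y). dist x y < e})"
definition open_L2_S3 :: "L2_S3 set \<Rightarrow> bool" where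
  "open_L2_S3 U = (\<forall>x\<in>U. eventually (\<lambda>(x', y). x' = x \<longrightarrow> y \<in> U) uniformity)"

instance
proof
  fix x y z :: L2_S3 and a b :: complex and r s :: real
  show "x + y + z = x + (y + z)" by transfer (simp add: add.assoc sqi_add)
  show "x + y = y + x" by transfer (simp add: add.commute sqi_add)
  show "0 + x = x" by transfer simp
  show "- x + x = 0" by transfer (simp add: sqi_0)
  show "x - y = x + - y" by transfer (simp add: sqi_diff)
  show C1: "a *\<^sub>C (x + y) = a *\<^sub>C x + a *\<^sub>C y" for a and x y :: L2_S3
    by transfer (simp add: distrib_left sqi_add sqi_cmult)
  show C2: "(a + b) *\<^sub>C x = a *\<^sub>C x + b *\<^sub>C x" for a b and x :: L2_S3
    by transfer (simp add: distrib_right sqi_add sqi_cmult)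
  show C3: "a *\<^sub>C b *\<^sub>C x = (a * b) *\<^sub>C x" for a b and x :: L2_S3
    by transfer (simp add: mult.assoc sqi_cmult)
  have C4: "1 *\<^sub>C x = x" for x :: L2_S3 by transfer simp
  show R: "r *\<^sub>R x = complex_of_real r *\<^sub>C x" for r and x :: L2_S3 by (fact scaleR_L2_S3_def)
  show "r *\<^sub>R (x + y) = r *\<^sub>R x + r *\<^sub>R y" by (simp add: R C1)
  show "(r + s) *\<^sub>R x = r *\<^sub>R x + s *\<^sub>R x" by (simp add: R C2)
  show "r *\<^sub>R s *\<^sub>R x = (r * s) *\<^sub>R x" by (simp add: R C3)
  show "1 *\<^sub>R x = x" by (simp add: R C4)
  show I1: "cinner x y = cnj (cinner y x)" for x y :: L2_S3
    by transfer (rule integral_mult_cnj)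
  show I2: "cinner (x + y) z = cinner x z + cinner y z" for x y z :: L2_S3
    by transfer (simp add: distrib_right Bochner_Integration.integral_add sqi_integrable)
  show I3: "cinner (a *\<^sub>C x) y = a * cinner x y" for a and x y :: L2_S3
    by transfer (simp add: mult.assoc)
  show "Re (cinner x y) = inner x y" by (simp add: inner_L2_S3_def)
  show "inner x y = inner y x"
    unfolding inner_L2_S3_def by (subst I1) simp
  show "inner (x + y) z = inner x z + inner y z" by (simp add: inner_L2_S3_def I2)
  show "inner (r *\<^sub>R x) y = r * inner x y" by (simp add: inner_L2_S3_def R I3)
  have xx: "cinner f f = complex_of_real (\<integral>t. (cmod (f' t))\<^sup>2 \<partial>m_S3)" 
    if "f = abs_L2_S3 f'" "square_integrable_S3 f'" for f f'
    using that by (simp add: cinner_L2_S3.abs_eq complex_norm_square[symmetric] del: of_real_power)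
  have ex: "\<exists>f. x = abs_L2_S3 f \<and> square_integrable_S3 f"
    by (rule L2_S3.abs_induct[of _ x]) auto
  obtain f where f: "x = abs_L2_S3 f" "square_integrable_S3 f"
    using ex by blast
  have fi: "integrable m_S3 (\<lambda>t. (cmod (f t))\<^sup>2)" and fm: "f \<in> borel_measurable m_S3"
    using f(2) by (auto simp: square_integrable_S3_def)
  show "0 \<le> inner x x" unfolding inner_L2_S3_def xx[OF f] by simp
  have "inner x x = 0 \<longleftrightarrow> (AE t in m_S3. (cmod (f t))\<^sup>2 = 0)"
    unfolding inner_L2_S3_def xx[OF f] Re_complex_of_real
    by (rule integral_nonneg_eq_0_iff_AE) (use fi in auto)
  also have "\<dots> \<longleftrightarrow> x = 0"
    using Quotient3_rel[OF Quotient3_L2_S3, of f "\<lambda>x. 0"] f sqi_0 by (simp add: zero_L2_S3_def)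
  finally show "inner x x = 0 \<longleftrightarrow> x = 0" .
  show "dist x y = norm (x - y)" by (rule dist_L2_S3_def)
  show "sgn x = scaleR (inverse (norm x)) x" by (rule sgn_L2_S3_def)
  show "norm x = sqrt (inner x x)" by (rule norm_L2_S3_def)
  show "(uniformity :: (L2_S3 \<times> L2_S3) filter) = (INF e\<in>{0<..}. principal {(x, y). dist x y < e})"
    by (rule uniformity_L2_S3_def)
  show "open U = (\<forall>x\<in>U. \<forall>\<^sub>F (x', y) in uniformity. x' = x \<longrightarrow> y \<in> U)" for U :: "L2_S3 set"
    by (rule open_L2_S3_def)
qed

end

lemma obtain_rep_L2:
  obtains f where "x = abs_L2_S3 f" "square_integrable_S3 f"
proof -
  have "\<exists>f. x = abs_L2_S3 f \<and> square_integrable_S3 f"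
    by (rule L2_S3.abs_induct[of _ x]) auto
  then show ?thesis using that by blast
qed

lemma norm_abs_L2:
  assumes "square_integrable_S3 f"
  shows "(norm (abs_L2_S3 f))\<^sup>2 = (\<integral>t. (cmod (f t))\<^sup>2 \<partial>m_S3)"
proof -
  have "cinner (abs_L2_S3 f) (abs_L2_S3 f) = complex_of_real (\<integral>t. (cmod (f t))\<^sup>2 \<partial>m_S3)"
    using assms by (simp add: cinner_L2_S3.abs_eq complex_norm_square[symmetric] del: of_real_power)
  then show ?thesis by (simp only: cinner_self of_real_eq_iff)
qed

lemma nn_integral_L2:
  assumes "square_integrable_S3 f"
  shows "(\<integral>\<^sup>+t. ennreal ((cmod (f t))\<^sup>2) \<partial>m_S3) = ennreal ((norm (abs_L2_S3 f))\<^sup>2)"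
  unfolding norm_abs_L2[OF assms]
  by (rule nn_integral_eq_integral) (use assms in \<open>auto simp: square_integrable_S3_def\<close>)

lemma minus_abs_L2:
  assumes "square_integrable_S3 f" "square_integrable_S3 g"
  shows "abs_L2_S3 f - abs_L2_S3 g = abs_L2_S3 (\<lambda>t. f t - g t)"
  using assms by (simp add: minus_L2_S3.abs_eq)

lemma nn_integral_norm_L2_le:
  assumes f: "square_integrable_S3 f" and a: "norm (abs_L2_S3 f) \<le> a" "0 < a"
  shows "(\<integral>\<^sup>+t. ennreal (cmod (f t)) \<partial>m_S3) \<le> ennreal a"
proof -
  have fm: "f \<in> borel_measurable m_S3" and i: "integrable m_S3 (\<lambda>t. (cmod (f t))\<^sup>2)"
    using f by (auto simp: square_integrable_S3_def)
  have le: "cmod (f t) \<le> a / 2 + (cmod (f t))\<^sup>2 / (2 * a)" for t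
  proof -
    have "2 * cmod (f t) * a \<le> (cmod (f t))\<^sup>2 + a\<^sup>2" by (rule sum_squares_bound)
    then show ?thesis using a(2) by (simp add: field_simps power2_eq_square)
  qed
  have "(\<integral>\<^sup>+t. ennreal (cmod (f t)) \<partial>m_S3) \<le> (\<integral>\<^sup>+t. ennreal (a / 2 + (cmod (f t))\<^sup>2 / (2 * a)) \<partial>m_S3)"
    by (intro nn_integral_mono ennreal_leI le)
  also have "\<dots> = ennreal (\<integral>t. a / 2 + (cmod (f t))\<^sup>2 / (2 * a) \<partial>m_S3)"
    by (rule nn_integral_eq_integral) (use i a(2) in auto)
  also have "(\<integral>t. a / 2 + (cmod (f t))\<^sup>2 / (2 * a) \<partial>m_S3) = a / 2 + (norm (abs_L2_S3 f))\<^sup>2 / (2 * a)"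
    using i by (simp add: norm_abs_L2[OF f] m_S3.prob_space)
  also have "\<dots> \<le> a / 2 + a\<^sup>2 / (2 * a)"
    using a by (intro add_left_mono divide_right_mono power_mono) auto
  also have "\<dots> = a" using a(2) by (simp add: field_simps power2_eq_square)
  finally show ?thesis by (simp add: ennreal_leI)
qed

lemma summable_AE_L2:
  assumes g: "\<And>k. square_integrable_S3 (g k)"
    and d: "\<And>k::nat. norm (abs_L2_S3 (\<lambda>t. g (Suc k) t - g k t)) \<le> (1/2)^k"
  shows "AE t in m_S3. convergent (\<lambda>k. g k t)"
proof -
  have gm: "g k \<in> borel_measurable m_S3" for k using g[of k] by (auto simp: square_integrable_S3_def)
  have [measurable]: "(\<lambda>t. ennreal (cmod (g (Suc k) t - g k t))) \<in> borel_measurable m_S3" for k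
    using gm[of k] gm[of "Suc k"] by measurable
  have "(\<integral>\<^sup>+t. (\<Sum>k. ennreal (cmod (g (Suc k) t - g k t))) \<partial>m_S3)
      = (\<Sum>k. \<integral>\<^sup>+t. ennreal (cmod (g (Suc k) t - g k t)) \<partial>m_S3)"
    by (rule nn_integral_suminf) measurable
  also have "\<dots> \<le> (\<Sum>k. ennreal ((1/2)^k))"
    by (intro suminf_le nn_integral_norm_L2_le sqi_diff g d) auto
  also have "\<dots> < \<infinity>"
    using summable_geometric[of "1/2::real"] by (subst suminf_ennreal2) auto
  finally have "AE t in m_S3. (\<Sum>k. ennreal (cmod (g (Suc k) t - g k t))) \<noteq> \<infinity>"
    by (intro nn_integral_PInf_AE) (auto, measurable)
  then show ?thesis
  proof eventually_elim
    case (elim t)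
    have "summable (\<lambda>k. cmod (g (Suc k) t - g k t))"
      by (rule summable_suminf_not_top) (use elim in auto)
    then have "summable (\<lambda>k. g (Suc k) t - g k t)" by (rule summable_norm_cancel)
    then obtain s where "(\<lambda>k. g (Suc k) t - g k t) sums s" by (auto simp: summable_def)
    then have "(\<lambda>n. g n t - g 0 t) \<longlonglongrightarrow> s"
      by (simp add: sums_def sum_lessThan_telescope[of "\<lambda>k. g k t"])
    then have "(\<lambda>n. (g n t - g 0 t) + g 0 t) \<longlonglongrightarrow> s + g 0 t" by (intro tendsto_intros)
    then show "convergent (\<lambda>k. g k t)" by (auto simp: convergent_def)
  qed
qed

lemma complete_L2_aux:
  assumes g: "\<And>k. square_integrable_S3 (g k)"
    and d: "\<And>k j::nat. k \<le> j \<Longrightarrow> norm (abs_L2_S3 (\<lambda>t. g j t - g k t)) \<le> (1/2)^k"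
  shows "\<exists>l. (\<lambda>k. abs_L2_S3 (g k)) \<longlonglongrightarrow> l"
proof -
  have gm: "g k \<in> borel_measurable m_S3" for k using g[of k] by (auto simp: square_integrable_S3_def)
  define F where "F t = lim (\<lambda>k. g k t)" for t
  have Fm: "F \<in> borel_measurable m_S3"
    unfolding F_def using gm by (rule borel_measurable_lim_metric)
  have lim: "AE t in m_S3. (\<lambda>k. g k t) \<longlonglongrightarrow> F t"
    using summable_AE_L2[OF g d[OF le_SucI[OF order_refl]]]
    by eventually_elim (simp add: F_def convergent_LIMSEQ_iff)
  have le: "(\<integral>\<^sup>+t. ennreal ((cmod (F t - g k t))\<^sup>2) \<partial>m_S3) \<le> ennreal (((1/2)^k)\<^sup>2)" for k
  proof -
    have "(\<integral>\<^sup>+t. ennreal ((cmod (F t - g k t))\<^sup>2) \<partial>m_S3)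
        = (\<integral>\<^sup>+t. liminf (\<lambda>j. ennreal ((cmod (g j t - g k t))\<^sup>2)) \<partial>m_S3)"
    proof (rule nn_integral_cong_AE)
      show "AE t in m_S3. ennreal ((cmod (F t - g k t))\<^sup>2) = liminf (\<lambda>j. ennreal ((cmod (g j t - g k t))\<^sup>2))"
        using lim
      proof eventually_elim
        case (elim t)
        have "(\<lambda>j. ennreal ((cmod (g j t - g k t))\<^sup>2)) \<longlonglongrightarrow> ennreal ((cmod (F t - g k t))\<^sup>2)"
          using elim by (intro tendsto_intros)
        from lim_imp_Liminf[OF _ this] show ?case by simp
      qed
    qed
    also have "\<dots> \<le> liminf (\<lambda>j. \<integral>\<^sup>+t. ennreal ((cmod (g j t - g k t))\<^sup>2) \<partial>m_S3)"
    proof (rule nn_integral_liminf)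
      show "(\<lambda>t. ennreal ((cmod (g j t - g k t))\<^sup>2)) \<in> borel_measurable m_S3" for j
        using gm[of j] gm[of k] by measurable
    qed
    also have "\<dots> \<le> ennreal (((1/2)^k)\<^sup>2)"
    proof (rule Liminf_le)
      show "\<forall>\<^sub>F j in sequentially. (\<integral>\<^sup>+t. ennreal ((cmod (g j t - g k t))\<^sup>2) \<partial>m_S3) \<le> ennreal (((1/2)^k)\<^sup>2)"
      proof (rule eventually_sequentiallyI[of k])
        fix j assume j: "k \<le> j"
        show "(\<integral>\<^sup>+t. ennreal ((cmod (g j t - g k t))\<^sup>2) \<partial>m_S3) \<le> ennreal (((1/2)^k)\<^sup>2)"
          unfolding nn_integral_L2[OF sqi_diff[OF g g]]
          by (intro ennreal_leI power_mono d j norm_ge_zero)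
      qed
    qed simp
    finally show ?thesis .
  qed
  have dF: "square_integrable_S3 (\<lambda>t. F t - g k t)" for k
    unfolding square_integrable_S3_def
  proof (intro conjI integrableI_bounded)
    show m: "(\<lambda>t. F t - g k t) \<in> borel_measurable m_S3" using Fm gm by measurable
    then show "(\<lambda>t. (cmod (F t - g k t))\<^sup>2) \<in> borel_measurable m_S3" by measurable
    show "(\<integral>\<^sup>+t. ennreal (norm ((cmod (F t - g k t))\<^sup>2)) \<partial>m_S3) < \<infinity>"
      using le[of k] by (auto intro: le_less_trans)
  qed
  have F: "square_integrable_S3 F"
    using sqi_add[OF dF[of 0] g[of 0]] by simp
  have "norm (abs_L2_S3 (g k) - abs_L2_S3 F) \<le> (1/2)^k" for k
  proof -
    have "ennreal ((norm (abs_L2_S3 (\<lambda>t. F t - g k t)))\<^sup>2) \<le> ennreal (((1/2)^k)\<^sup>2)"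
      using le[of k] unfolding nn_integral_L2[OF dF] .
    then have "(norm (abs_L2_S3 (\<lambda>t. F t - g k t)))\<^sup>2 \<le> ((1/2)^k)\<^sup>2"
      by (subst (asm) ennreal_le_iff) auto
    then have "norm (abs_L2_S3 (\<lambda>t. F t - g k t)) \<le> (1/2)^k"
      by (rule power2_le_imp_le) simp
    then show ?thesis by (simp add: minus_abs_L2[OF F g, symmetric] norm_minus_commute)
  qed
  then have "\<forall>\<^sub>F k in sequentially. norm (abs_L2_S3 (g k) - abs_L2_S3 F) \<le> (1/2)^k"
    by (rule always_eventually[OF allI])
  moreover have "(\<lambda>k. (1/2)^k :: real) \<longlonglongrightarrow> 0" by (rule LIMSEQ_power_zero) simp
  ultimately have "(\<lambda>k. abs_L2_S3 (g k) - abs_L2_S3 F) \<longlonglongrightarrow> 0"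
    by (rule Lim_null_comparison)
  then have "(\<lambda>k. abs_L2_S3 (g k)) \<longlonglongrightarrow> abs_L2_S3 F" by (simp add: LIM_zero_iff)
  then show ?thesis ..
qed

instance L2_S3 :: chilbert_space
proof
  fix X :: "nat \<Rightarrow> L2_S3" assume X: "Cauchy X"
  have "\<forall>k. \<exists>M. \<forall>m\<ge>M. \<forall>n\<ge>M. dist (X m) (X n) < (1/2)^k"
    using X unfolding Cauchy_def by simp
  then obtain M where M: "\<And>k m n. m \<ge> M k \<Longrightarrow> n \<ge> M k \<Longrightarrow> dist (X m) (X n) < (1/2)^k"
    by metis
  define r where "r k = k + (\<Sum>j\<le>k. M j)" for k
  have rM: "r k \<ge> M k" for k unfolding r_def by (simp add: sum.remove[of "{..k}" k] trans_le_add2)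
  have r: "strict_mono r" by (rule strict_monoI_Suc) (simp add: r_def)
  have "\<forall>k. \<exists>f. X (r k) = abs_L2_S3 f \<and> square_integrable_S3 f" by (metis obtain_rep_L2)
  then obtain g where g: "\<And>k. X (r k) = abs_L2_S3 (g k)" "\<And>k. square_integrable_S3 (g k)" by metis
  have "\<exists>l. (\<lambda>k. abs_L2_S3 (g k)) \<longlonglongrightarrow> l"
  proof (rule complete_L2_aux)
    fix k j :: nat assume kj: "k \<le> j"
    have "r j \<ge> M k" using rM[of k] strict_mono_leD[OF r kj] by simp
    then have "dist (X (r j)) (X (r k)) < (1/2)^k" using M rM by blast
    then show "norm (abs_L2_S3 (\<lambda>t. g j t - g k t)) \<le> (1/2)^k"
      by (simp add: g dist_norm minus_abs_L2)
  qed (rule g)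
  then obtain l where "(X \<circ> r) \<longlonglongrightarrow> l" by (auto simp: g o_def)
  then have "X \<longlonglongrightarrow> l" using Cauchy_converges_subseq[of X r l] X r by blast
  then show "convergent X" by (auto simp: convergent_def)
qed

lemma cinner_add_right: "cinner x (y + z) = cinner x y + cinner x (z::'a::complex_inner)"
  by (subst (1 2 3) cinner_commute) (simp add: cinner_add_left)

lemma cinner_scaleC_right: "cinner x (a *\<^sub>C y) = cnj a * cinner x (y::'a::complex_inner)"
  by (subst (1 2) cinner_commute) (simp add: cinner_scaleC_left)

lemma cmod_cinner_le: "cmod (cinner x y) \<le> norm x * norm (y::'a::complex_inner)"
proof -
  define a where "a = cnj (sgn (cinner x y))"
  have "cnj (sgn z) * z = complex_of_real (cmod z)" for z
  proof (cases "z = 0")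
    case False
    have "cnj (sgn z) * z = (z * cnj z) / complex_of_real (cmod z)" by (simp add: sgn_eq)
    also have "z * cnj z = complex_of_real (cmod z) * complex_of_real (cmod z)"
      by (simp only: complex_norm_square[symmetric] power2_eq_square of_real_mult)
    finally show ?thesis using False by simp
  qed simp
  then have "cinner (a *\<^sub>C x) y = complex_of_real (cmod (cinner x y))"
    by (simp add: a_def cinner_scaleC_left)
  then have "cmod (cinner x y) = inner (a *\<^sub>C x) y"
    using Re_cinner[of "a *\<^sub>C x" y] by simp
  also have "\<dots> \<le> norm (a *\<^sub>C x) * norm y" by (rule norm_cauchy_schwarz)
  also have "\<dots> \<le> norm x * norm y"
    by (intro mult_right_mono) (auto simp: norm_scaleC a_def norm_sgn)
  finally show ?thesis .
qed

lemma bounded_linear_cinner_left: "bounded_linear (\<lambda>x::'a::complex_inner. cinner x y)"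
  by (rule bounded_linear_intro[where K="norm y"])
    (simp_all add: cinner_add_left scaleR_scaleC cinner_scaleC_left scaleC_complex_def cmod_cinner_le)

lemma sqi_const: "square_integrable_S3 (\<lambda>x. a)"
  by (simp add: square_integrable_S3_def)

lemma coord_measurable: "(\<lambda>x. complex_of_real (x $ i)) \<in> borel_measurable m_S3"
  by (rule measurable_compose[OF rotation_invariant_prob_S3_D(4)[OF rotation_invariant_m_S3]])
    (intro borel_measurable_continuous_onI continuous_intros)

lemma coord_le_1: "x \<in> S3 \<Longrightarrow> cmod (complex_of_real (x $ i)) \<le> 1"
  using component_le_norm_cart[of x i] by (simp add: S3_def)

lemma sqi_mult_coord: "square_integrable_S3 f \<Longrightarrow> square_integrable_S3 (\<lambda>x. complex_of_real (x $ i) * f x)"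
  by (rule sqi_mult[OF _ coord_measurable coord_le_1])

lift_definition mult_coord_S3 :: "4 \<Rightarrow> L2_S3 \<Rightarrow> L2_S3"
  is "\<lambda>i f x. complex_of_real (x $ i) * f x"
proof (elim conjE, intro conjI)
  fix f f' :: "real^4 \<Rightarrow> complex" and i :: 4
  assume "AE x in m_S3. f x = f' x"
  then show "AE x in m_S3. complex_of_real (x $ i) * f x = complex_of_real (x $ i) * f' x"
    by eventually_elim simp
qed (assumption | rule sqi_mult_coord)+

lemma bounded_linear_mult_coord: "bounded_linear (mult_coord_S3 i)"
proof (rule bounded_linear_intro[where K=1])
  show "mult_coord_S3 i (x + y) = mult_coord_S3 i x + mult_coord_S3 i y" for x y
    by transfer (simp add: distrib_left sqi_add sqi_mult_coord)
  have C: "mult_coord_S3 i (a *\<^sub>C x) = a *\<^sub>C mult_coord_S3 i x" for a x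
    by transfer (simp add: mult.left_commute sqi_cmult sqi_mult_coord)
  show "mult_coord_S3 i (r *\<^sub>R x) = r *\<^sub>R mult_coord_S3 i x" for r x
    by (simp only: scaleR_scaleC C)
  fix x
  obtain f where f: "x = abs_L2_S3 f" "square_integrable_S3 f" by (rule obtain_rep_L2)
  have "(norm (mult_coord_S3 i x))\<^sup>2 = (\<integral>t. (cmod (complex_of_real (t $ i) * f t))\<^sup>2 \<partial>m_S3)"
    using f by (simp add: mult_coord_S3.abs_eq norm_abs_L2 sqi_mult_coord)
  also have "\<dots> \<le> (\<integral>t. (cmod (f t))\<^sup>2 \<partial>m_S3)"
  proof (rule integral_mono)
    show "integrable m_S3 (\<lambda>t. (cmod (complex_of_real (t $ i) * f t))\<^sup>2)"
      using sqi_mult_coord[OF f(2), of i] by (simp only: square_integrable_S3_def)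
    show "integrable m_S3 (\<lambda>t. (cmod (f t))\<^sup>2)"
      using f(2) by (simp only: square_integrable_S3_def)
    fix t assume "t \<in> space m_S3"
    then have "cmod (complex_of_real (t $ i)) \<le> 1" using coord_le_1 space_m_S3 by blast
    then show "(cmod (complex_of_real (t $ i) * f t))\<^sup>2 \<le> (cmod (f t))\<^sup>2"
      unfolding norm_mult by (intro power_mono mult_left_le_one_le) auto
  qed
  also have "\<dots> = (norm x)\<^sup>2" by (simp add: f norm_abs_L2)
  finally have "(norm (mult_coord_S3 i x))\<^sup>2 \<le> (norm x)\<^sup>2" .
  then have "norm (mult_coord_S3 i x) \<le> norm x" by (rule power2_le_imp_le) simp
  then show "norm (mult_coord_S3 i x) \<le> norm x * 1" by simp
qed

lift_definition M_t :: "4 \<Rightarrow> L2_S3 \<Rightarrow>\<^sub>L L2_S3" is mult_coord_S3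
  by (rule bounded_linear_mult_coord)

lift_definition const_S3 :: "complex \<Rightarrow> L2_S3" is "\<lambda>a x. a"
  using sqi_const by simp

lift_definition P_S3 :: "L2_S3 \<Rightarrow>\<^sub>L complex" is "\<lambda>g. cinner g (const_S3 1)"
  by (rule bounded_linear_cinner_left)

lemma P_S3_integral:
  "square_integrable_S3 f \<Longrightarrow> P_S3 (abs_L2_S3 f) = (\<integral>x. f x \<partial>m_S3)"
  by (simp add: P_S3.rep_eq cinner_L2_S3.abs_eq const_S3.abs_eq sqi_const)


section \<open>Operators on complex Hilbert spaces\<close>

text \<open>
  The elements of \<^typ>\<open>'a \<Rightarrow>\<^sub>L 'b\<close> are the bounded real-linear maps, with the operator norm.
  The bounded complex-linear ones are singled out by \<open>clinear_op\<close>; between Hilbert spaces they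
  are the maps that have an adjoint.
\<close>

definition clinear_op :: "('a::complex_inner \<Rightarrow>\<^sub>L 'b::complex_inner) \<Rightarrow> bool" where
  "clinear_op T \<longleftrightarrow> (\<forall>a x. T (a *\<^sub>C x) = a *\<^sub>C T x)"

definition cadjoint :: "('a::complex_inner \<Rightarrow>\<^sub>L 'b::complex_inner) \<Rightarrow> ('b \<Rightarrow>\<^sub>L 'a)" where
  "cadjoint T = (THE S :: 'b \<Rightarrow>\<^sub>L 'a. \<forall>x y. cinner (T x) y = cinner x (S y))"

lemma cadjoint_eqI:
  fixes T :: "'a::complex_inner \<Rightarrow>\<^sub>L 'b::complex_inner" and S :: "'b \<Rightarrow>\<^sub>L 'a"
  assumes "\<And>x y. cinner (T x) y = cinner x (S y)"
  shows "cadjoint T = S"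
  unfolding cadjoint_def
proof (rule the_equality)
  show "\<forall>x y. cinner (T x) y = cinner x (S y)" using assms by blast
  fix S' :: "'b \<Rightarrow>\<^sub>L 'a" assume S': "\<forall>x y. cinner (T x) y = cinner x (S' y)"
  show "S' = S"
  proof (rule blinfun_eqI)
    fix y
    have "inner x (S' y) = inner x (S y)" for x
      using S' assms by (metis Re_cinner)
    then have "inner (S' y - S y) (S' y - S y) = 0"
      by (simp only: inner_diff_right)
    then show "S' y = S y" by simp
  qed
qed

lemma cadjoint_P_S3: "cadjoint P_S3 a = const_S3 a"
proof -
  have C: "const_S3 (a * b) = a *\<^sub>C const_S3 b" for a b
    by transfer (simp add: sqi_const)
  have P: "const_S3 (a + b) = const_S3 a + const_S3 b" for a b
    by transfer (simp add: sqi_const)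
  have const: "const_S3 b = b *\<^sub>C const_S3 1" for b
    using C[of b 1] by simp
  have "bounded_linear const_S3"
  proof (rule bounded_linear_intro[where K="norm (const_S3 1)"])
    show "const_S3 (r *\<^sub>R b) = r *\<^sub>R const_S3 b" for r b
      by (simp only: scaleR_conv_of_real C scaleR_scaleC[of r "const_S3 b"])
    show "norm (const_S3 b) \<le> norm b * norm (const_S3 1)" for b
      by (subst const) (simp only: norm_scaleC order_refl)
  qed (rule P)
  then have app: "Blinfun const_S3 b = const_S3 b" for b
    by (rule bounded_linear_Blinfun_apply[THEN fun_cong])
  have "cadjoint P_S3 = Blinfun const_S3"
  proof (rule cadjoint_eqI)
    show "cinner (P_S3 g) b = cinner g (Blinfun const_S3 b)" for g b
      unfolding app const[of b] cinner_scaleC_right P_S3.rep_eq cinner_complex_def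
      by (rule mult.commute)
  qed
  then show ?thesis by (simp add: app)
qed

definition csubspace :: "'a::complex_vector set \<Rightarrow> bool" where
  "csubspace V \<longleftrightarrow>
     0 \<in> V \<and> (\<forall>x\<in>V. \<forall>y\<in>V. x + y \<in> V) \<and> (\<forall>a. \<forall>x\<in>V. a *\<^sub>C x \<in> V)"

definition cspan :: "'a::complex_vector set \<Rightarrow> 'a set" where
  "cspan X = csubspace hull X"

definition cstar_subalgebra :: "('k::chilbert_space \<Rightarrow>\<^sub>L 'k) set \<Rightarrow> bool" where
  "cstar_subalgebra A \<longleftrightarrow>
     (\<forall>a\<in>A. clinear_op a) \<and> csubspace A \<and> closed A \<and>
     (\<forall>a\<in>A. \<forall>b\<in>A. a o\<^sub>L b \<in> A) \<and> (\<forall>a\<in>A. cadjoint a \<in> A)"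

definition Cstar :: "('k::chilbert_space \<Rightarrow>\<^sub>L 'k) set \<Rightarrow> ('k \<Rightarrow>\<^sub>L 'k) set" where
  "Cstar S = cstar_subalgebra hull S"

text \<open>
  The Hilbert spaces on which representations act range over the closed subspaces \<open>H\<close> of a
  complex Hilbert space type \<open>'h\<close>, that is, up to unitary equivalence, over all Hilbert spaces
  whose dimension is at most that of \<open>'h\<close>. \<open>B(H)\<close> is identified with the corner of
  \<open>B('h)\<close> consisting of the operators with range in \<open>H\<close> that vanish on the orthogonal
  complement of \<open>H\<close>. The identity of \<open>H\<close> thus becomes the projection onto \<open>H\<close>, and adjoints
  formed in \<open>B(H)\<close> and in \<open>B('h)\<close> agree.
\<close>

definition closed_csubspace :: "'h::chilbert_space set \<Rightarrow> bool" where
  "closed_csubspace H \<longleftrightarrow> csubspace H \<and> closed H"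

definition bops_on :: "'h::chilbert_space set \<Rightarrow> ('h \<Rightarrow>\<^sub>L 'h) set" where
  "bops_on H = {T. clinear_op T \<and> (\<forall>x. T x \<in> H) \<and>
     (\<forall>x. (\<forall>y\<in>H. cinner x y = 0) \<longrightarrow> T x = 0)}"

definition unital_clinear_map ::
  "('k::chilbert_space \<Rightarrow>\<^sub>L 'k) set \<Rightarrow> 'h::chilbert_space set \<Rightarrow> (('k \<Rightarrow>\<^sub>L 'k) \<Rightarrow> ('h \<Rightarrow>\<^sub>L 'h)) \<Rightarrow> bool"
where
  "unital_clinear_map A H \<phi> \<longleftrightarrow>
     (\<forall>a\<in>A. \<phi> a \<in> bops_on H) \<and>
     (\<forall>a\<in>A. \<forall>b\<in>A. \<phi> (a + b) = \<phi> a + \<phi> b) \<and>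
     (\<forall>z. \<forall>a\<in>A. \<phi> (z *\<^sub>C a) = z *\<^sub>C \<phi> a) \<and>
     (\<forall>x\<in>H. \<phi> id_blinfun x = x)"

definition representation ::
  "('k::chilbert_space \<Rightarrow>\<^sub>L 'k) set \<Rightarrow> 'h::chilbert_space set \<Rightarrow> (('k \<Rightarrow>\<^sub>L 'k) \<Rightarrow> ('h \<Rightarrow>\<^sub>L 'h)) \<Rightarrow> bool"
where
  "representation A H \<pi> \<longleftrightarrow>
     closed_csubspace H \<and> unital_clinear_map A H \<pi> \<and>
     (\<forall>a\<in>A. \<forall>b\<in>A. \<pi> (a o\<^sub>L b) = \<pi> a o\<^sub>L \<pi> b) \<and>
     (\<forall>a\<in>A. \<pi> (cadjoint a) = cadjoint (\<pi> a))"

definition irreducible_representation ::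
  "('k::chilbert_space \<Rightarrow>\<^sub>L 'k) set \<Rightarrow> 'h::chilbert_space set \<Rightarrow> (('k \<Rightarrow>\<^sub>L 'k) \<Rightarrow> ('h \<Rightarrow>\<^sub>L 'h)) \<Rightarrow> bool"
where
  "irreducible_representation A H \<pi> \<longleftrightarrow>
     representation A H \<pi> \<and> H \<noteq> {0} \<and>
     (\<forall>L. closed_csubspace L \<and> L \<subseteq> H \<and> (\<forall>a\<in>A. \<forall>x\<in>L. \<pi> a x \<in> L) \<longrightarrow> L = {0} \<or> L = H)"

text \<open>
  The operator matrix \<open>(a i j)\<close>, with \<open>i, j < n\<close>, is positive as an operator on the
  \<open>n\<close>-fold direct sum of the underlying Hilbert space.
\<close>

definition positive_op_matrix :: "nat \<Rightarrow> (nat \<Rightarrow> nat \<Rightarrow> ('k::chilbert_space \<Rightarrow>\<^sub>L 'k)) \<Rightarrow> bool" where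
  "positive_op_matrix n a \<longleftrightarrow>
     (\<forall>x :: nat \<Rightarrow> 'k. (\<Sum>i<n. \<Sum>j<n. cinner (a i j (x j)) (x i)) \<in> \<real>\<^sub>\<ge>\<^sub>0)"

definition completely_positive ::
  "('k::chilbert_space \<Rightarrow>\<^sub>L 'k) set \<Rightarrow> (('k \<Rightarrow>\<^sub>L 'k) \<Rightarrow> ('h::chilbert_space \<Rightarrow>\<^sub>L 'h)) \<Rightarrow> bool"
where
  "completely_positive A \<phi> \<longleftrightarrow>
     (\<forall>n a. (\<forall>i<n. \<forall>j<n. a i j \<in> A) \<and> positive_op_matrix n a
        \<longrightarrow> positive_op_matrix n (\<lambda>i j. \<phi> (a i j)))"

definition ucp ::
  "('k::chilbert_space \<Rightarrow>\<^sub>L 'k) set \<Rightarrow> 'h::chilbert_space set \<Rightarrow> (('k \<Rightarrow>\<^sub>L 'k) \<Rightarrow> ('h \<Rightarrow>\<^sub>L 'h)) \<Rightarrow> bool"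
where
  "ucp A H \<phi> \<longleftrightarrow> unital_clinear_map A H \<phi> \<and> completely_positive A \<phi>"

text \<open>
  Maps on \<open>Cstar S\<close> are total functions on the operator type, so uniqueness of the extension
  is agreement on \<open>Cstar S\<close>.
\<close>

definition unique_extension_property ::
  "('k::chilbert_space \<Rightarrow>\<^sub>L 'k) set \<Rightarrow> 'h::chilbert_space set \<Rightarrow> (('k \<Rightarrow>\<^sub>L 'k) \<Rightarrow> ('h \<Rightarrow>\<^sub>L 'h)) \<Rightarrow> bool"
where
  "unique_extension_property S H \<pi> \<longleftrightarrow>
     (\<forall>\<phi>. ucp (Cstar S) H \<phi> \<and> (\<forall>s\<in>S. \<phi> s = \<pi> s) \<longrightarrow> (\<forall>a\<in>Cstar S. \<phi> a = \<pi> a))"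

text \<open>
  HOL cannot quantify over the type \<open>'h\<close> inside a formula, so the range of Hilbert spaces is a
  parameter. If \<open>'h\<close> is infinite-dimensional and \<open>Cstar S\<close> is separable, this is hyperrigidity
  with respect to all Hilbert spaces: every representation is a direct sum of representations on
  separable spaces, and the unique extension property passes to direct sums. In any case a
  failure of \<open>hyperrigid TYPE('h) S\<close> for one \<open>'h\<close> is a failure of hyperrigidity.
\<close>

definition hyperrigid :: "'h::chilbert_space itself \<Rightarrow> ('k::chilbert_space \<Rightarrow>\<^sub>L 'k) set \<Rightarrow> bool" where
  "hyperrigid (_ :: 'h itself) S \<longleftrightarrow>
     (\<forall>(H :: 'h set) \<pi>. representation (Cstar S) H \<pi> \<longrightarrow> unique_extension_property S H \<pi>)"


section \<open>The operator system\<close>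

lift_definition T_op :: "4 \<Rightarrow> (L2_S3 \<times> complex) \<Rightarrow>\<^sub>L (L2_S3 \<times> complex)"
  is "\<lambda>i x. (M_t i (fst x), 0)"
  by (intro bounded_linear_Pair bounded_linear_zero
      bounded_linear_compose[OF blinfun.bounded_linear_right bounded_linear_fst])

lift_definition T1_tilde :: "real \<Rightarrow> (L2_S3 \<times> complex) \<Rightarrow>\<^sub>L (L2_S3 \<times> complex)"
  is "\<lambda>c x. (M_t 1 (fst x) + c *\<^sub>R cadjoint P_S3 (snd x), 0)"
  by (intro bounded_linear_Pair bounded_linear_zero bounded_linear_add
      bounded_linear_compose[OF blinfun.bounded_linear_right bounded_linear_fst]
      bounded_linear_compose[OF bounded_linear_scaleR_right
        bounded_linear_compose[OF blinfun.bounded_linear_right bounded_linear_snd]])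

definition S_sys :: "real \<Rightarrow> ((L2_S3 \<times> complex) \<Rightarrow>\<^sub>L (L2_S3 \<times> complex)) set" where
  "S_sys c = cspan {id_blinfun, T1_tilde c, cadjoint (T1_tilde c), T_op 2, T_op 3, T_op 4}"

end

theory Submission
  imports Defs
begin

text \<open>
  Let \<open>E\<close> be the projection onto \<open>L\<^sup>2(S\<^sub>3)\<close> and \<open>Q\<close> the projection onto the constant functions.
  Concentrating unit vectors at a point of the sphere shows that \<open>C*(S\<^sub>c)\<close> has a symbol map onto functions on
  the sphere under which both \<open>T\<^sub>1\<close> and its adjoint become \<open>t\<^sub>1\<close>. The resulting representation by multiplication operators
  and the compression \<open>a \<mapsto> E a E\<close> agree on \<open>S\<^sub>c\<close> but not on \<open>T\<^sub>1 T\<^sub>1\<^sup>*\<close>.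

  Let now \<open>\<pi>\<close> be irreducible and \<open>\<phi>\<close> a completely positive extension. The vectors whose states under \<open>\<phi>\<close> and
  \<open>\<pi>\<close> coincide form an invariant subspace, so one such vector is enough. If \<open>\<pi>(Q) \<noteq> 0\<close>, any vector in the range of
  \<open>\<pi>(Q)\<close> will do: \<open>T\<^sub>1 T\<^sub>1\<^sup>* + T\<^sub>2\<^sup>2 + T\<^sub>3\<^sup>2 + T\<^sub>4\<^sup>2 = E + c\<^sup>2 Q\<close> has its largest eigenvalue exactly on the range of \<open>Q\<close>, which
  forces equality in the Schwarz inequality. If \<open>\<pi>(Q) = 0\<close>, then \<open>\<pi>\<close> is the evaluation at a point \<open>x\<close>. There
  \<open>D = 1 - x\<^sub>1 Re T\<^sub>1 - x\<^sub>2 T\<^sub>2 - x\<^sub>3 T\<^sub>3 - x\<^sub>4 T\<^sub>4\<close> satisfies \<open>\<phi>(D) = \<pi>(D) = 0\<close>, while every \<open>(s - s(x))\<^sup>* (s - s(x))\<close> with a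
  generator \<open>s\<close> is bounded by a multiple of \<open>D\<close>. This estimate rests on the integrability of
  \<open>1 / (1 - \<langle>x, t\<rangle>)\<close> over the sphere, with integral 2.
\<close>

section \<open>Adjoints of operators on complex Hilbert spaces\<close>

text \<open>Multiplication by the coordinates on L^2 is a direct integral of point evaluations. Each
  of these has the unique extension property, yet the whole does not: the constant function, into
  which \<open>T1_tilde\<close> maps the extra summand C, is a vector of L^2 without a counterpart
  at a single point. Near a point x the coupling fades, since 1 - <x,t> = |x - t|^2 / 2 on the unit
  sphere and |x - t|^-2 is integrable in dimension three; on a circle or a 2-sphere it is not. The
  resulting bound of the constants by the form of 1 - <x,t> serves both halves. Against
  hyperrigidity, it makes the constants asymptotically orthogonal to vectors concentrating at x, so
  that the adjoint of \<open>T1_tilde\<close> has a symbol at all. For unique extension, it absorbs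
  the cross term in the form of D and leaves at least 1 - c times the diagonal part. D lies in the
  operator system, where both maps coincide, while the squares that it dominates need not; this is
  how one affine combination of generators controls products.\<close>

lemma scaleC_of_real: "complex_of_real r *\<^sub>C x = r *\<^sub>R (x::'a::complex_vector)"
  by (simp add: scaleR_scaleC)

lemma scaleC_one: "1 *\<^sub>C x = (x::'a::complex_vector)"
  using scaleC_of_real[of 1 x] by simp

lemma scaleC_minus_one: "(- 1) *\<^sub>C x = - (x::'a::complex_vector)"
  using scaleC_of_real[of "-1" x] by simp

lemma scaleC_zero_left: "0 *\<^sub>C x = (0::'a::complex_vector)"
  using scaleC_of_real[of 0 x] by simp

lemma scaleC_zero_right: "a *\<^sub>C 0 = (0::'a::complex_vector)"
  using scaleC_add_right[of a 0 "0::'a"] by simp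

lemma scaleC_minus_right: "a *\<^sub>C (- x) = - (a *\<^sub>C (x::'a::complex_vector))"
  using scaleC_add_right[of a x "- x"] by (simp add: scaleC_zero_right eq_neg_iff_add_eq_0 add.commute)

lemma scaleC_minus_left: "(- a) *\<^sub>C x = - (a *\<^sub>C (x::'a::complex_vector))"
  using scaleC_add_left[of a "- a" x] by (simp add: scaleC_zero_left eq_neg_iff_add_eq_0 add.commute)

lemma scaleC_diff_right: "a *\<^sub>C (x - y) = a *\<^sub>C x - a *\<^sub>C (y::'a::complex_vector)"
  using scaleC_add_right[of a x "- y"] by (simp add: scaleC_minus_right)

lemma scaleC_diff_left: "(a - b) *\<^sub>C x = a *\<^sub>C x - b *\<^sub>C (x::'a::complex_vector)"
  using scaleC_add_left[of a "- b" x] by (simp add: scaleC_minus_left)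

lemma cinner_zero_left [simp]: "cinner 0 (x::'a::complex_inner) = 0"
  using cinner_add_left[of 0 0 x] by simp

lemma cinner_zero_right [simp]: "cinner (x::'a::complex_inner) 0 = 0"
  using cinner_add_right[of x 0 0] by simp

lemma cinner_minus_left: "cinner (- x) y = - cinner x (y::'a::complex_inner)"
  using cinner_add_left[of x "- x" y] by (simp add: eq_neg_iff_add_eq_0 add.commute)

lemma cinner_minus_right: "cinner x (- y) = - cinner x (y::'a::complex_inner)"
  using cinner_add_right[of x y "- y"] by (simp add: eq_neg_iff_add_eq_0 add.commute)

lemma cinner_diff_left: "cinner (x - y) z = cinner x z - cinner y (z::'a::complex_inner)"
  using cinner_add_left[of x "- y" z] by (simp add: cinner_minus_left)

lemma cinner_diff_right: "cinner x (y - z) = cinner x y - cinner x (z::'a::complex_inner)"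
  using cinner_add_right[of x y "- z"] by (simp add: cinner_minus_right)

lemma cinner_scaleR_left: "cinner (r *\<^sub>R x) y = complex_of_real r * cinner x (y::'a::complex_inner)"
  by (simp add: scaleR_scaleC cinner_scaleC_left)

lemma cinner_scaleR_right: "cinner x (r *\<^sub>R y) = complex_of_real r * cinner x (y::'a::complex_inner)"
  by (simp add: scaleR_scaleC cinner_scaleC_right)

lemmas cinner_simps = cinner_add_left cinner_add_right cinner_diff_left cinner_diff_right
  cinner_minus_left cinner_minus_right cinner_scaleC_left cinner_scaleC_right
  cinner_scaleR_left cinner_scaleR_right

lemma cinner_eqI:
  fixes x y :: "'a::complex_inner"
  assumes "\<And>z. cinner x z = cinner y z"
  shows "x = y"
proof -
  have "cinner (x - y) (x - y) = 0" using assms by (simp add: cinner_diff_left)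
  then show ?thesis by (simp add: cinner_self)
qed

lemma cinner_eqI':
  fixes x y :: "'a::complex_inner"
  assumes "\<And>z. cinner z x = cinner z y"
  shows "x = y"
  by (rule cinner_eqI) (metis assms cinner_commute)

text \<open>The representing vector minimises J(x) = |x|^2 - 2 f(x): a minimising sequence is Cauchy
  by the parallelogram law, and the vanishing first variation at its limit y reads f z =
  <z,y>.\<close>

lemma riesz_real:
  fixes f :: "'a::{real_inner,complete_space} \<Rightarrow> real"
  assumes "bounded_linear f"
  shows "\<exists>y. \<forall>x. f x = inner x y"
proof -
  interpret f: bounded_linear f by fact
  obtain K where K: "\<And>x. norm (f x) \<le> norm x * K" using f.bounded by blast
  define J where "J x = (norm x)\<^sup>2 - 2 * f x" for x
  have low: "J x \<ge> - K\<^sup>2" for x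
  proof -
    have "f x \<le> norm x * K" using K[of x] by simp
    moreover have "0 \<le> (norm x - K)\<^sup>2" by simp
    ultimately show ?thesis unfolding J_def by (simp add: power2_diff)
  qed
  define L where "L = Inf (range J)"
  have bdd: "bdd_below (range J)" using low by (intro bdd_belowI[of _ "- K\<^sup>2"]) auto
  have L: "L \<le> J x" for x unfolding L_def by (rule cInf_lower[OF _ bdd]) simp
  have "\<exists>x. J x < L + 1 / real (Suc n)" for n
  proof -
    have "Inf (range J) < L + 1 / real (Suc n)" by (simp add: L_def)
    then show ?thesis using cInf_less_iff[OF _ bdd] by auto
  qed
  then obtain x where x: "\<And>n. J (x n) < L + 1 / real (Suc n)" by metis
  \<comment> \<open>The f-terms cancel by linearity, so this is the parallelogram law; nearly
    minimal values at u and v force u and v together.\<close>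
  have par: "(norm (u - v))\<^sup>2 = 2 * (J u + J v - 2 * J ((1/2) *\<^sub>R (u + v)))" for u v
    by (simp add: J_def f.add f.scaleR power2_norm_eq_inner inner_simps inner_commute algebra_simps)
  have dd: "(norm (x n - x m))\<^sup>2 \<le> 2 * (1 / real (Suc n) + 1 / real (Suc m))" for n m
  proof -
    have "J (x n) + J (x m) - 2 * J ((1/2) *\<^sub>R (x n + x m)) \<le> (L + 1 / real (Suc n)) + (L + 1 / real (Suc m)) - 2 * L"
      using L[of "(1/2) *\<^sub>R (x n + x m)"] less_imp_le[OF x[of n]] less_imp_le[OF x[of m]]
      by (intro diff_mono add_mono) auto
    then show ?thesis unfolding par by simp
  qed
  have "Cauchy x"
  proof (rule metric_CauchyI)
    fix e :: real assume e: "e > 0"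
    obtain N where N: "1 / real (Suc N) < e\<^sup>2 / 4"
      using e nat_approx_posE[of "e\<^sup>2 / 4"] by auto
    have "dist (x m) (x n) < e" if "m \<ge> N" "n \<ge> N" for m n
    proof -
      have "1 / real (Suc m) \<le> 1 / real (Suc N)" "1 / real (Suc n) \<le> 1 / real (Suc N)"
        using that by (auto simp: frac_le)
      then have "(norm (x m - x n))\<^sup>2 < e\<^sup>2" using dd[of m n] N by argo
      then show ?thesis using e by (simp add: dist_norm power2_less_imp_less)
    qed
    then show "\<exists>M. \<forall>m\<ge>M. \<forall>n\<ge>M. dist (x m) (x n) < e" by blast
  qed
  then obtain y where y: "x \<longlonglongrightarrow> y" using Cauchy_convergent convergent_def by blast
  have "(\<lambda>n. J (x n)) \<longlonglongrightarrow> J y"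
    unfolding J_def by (intro tendsto_intros y f.tendsto)
  moreover have "(\<lambda>n. L + 1 / real (Suc n)) \<longlonglongrightarrow> L + 0"
    by (intro tendsto_intros LIMSEQ_Suc[OF lim_inverse_n'])
  ultimately have "J y \<le> L + 0"
    by (rule LIMSEQ_le) (use x less_imp_le in blast)
  then have min: "J y \<le> J z" for z using L[of z] by simp
  have "f z = inner z y" for z
  proof (rule ccontr)
    assume ne: "f z \<noteq> inner z y"
    define d where "d = f z - inner z y"
    have q: "0 \<le> t\<^sup>2 * (norm z)\<^sup>2 - 2 * t * d" for t
    proof -
      have "(norm (y + t *\<^sub>R z))\<^sup>2 = (norm y)\<^sup>2 + 2 * t * inner z y + t\<^sup>2 * (norm z)\<^sup>2"
        unfolding power2_norm_eq_inner by (simp add: inner_simps inner_commute algebra_simps power2_eq_square)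
      then show ?thesis using min[of "y + t *\<^sub>R z"]
        by (simp add: J_def d_def f.add f.scaleR algebra_simps)
    qed
    \<comment> \<open>The quadratic inequality is tested at d / s; the summand 1 keeps s positive
      even for z = 0.\<close>
    define s where "s = (norm z)\<^sup>2 + 1"
    have s: "s > 0" by (simp add: s_def add_nonneg_pos)
    have "0 \<le> ((d/s)\<^sup>2 * (norm z)\<^sup>2 - 2 * (d/s) * d) * s\<^sup>2" using q[of "d/s"] by simp
    also have "\<dots> = d\<^sup>2 * ((norm z)\<^sup>2 - 2 * s)"
      using s by (simp add: field_simps power2_eq_square)
    also have "\<dots> < 0"
    proof (rule mult_pos_neg)
      show "0 < d\<^sup>2" using ne by (simp add: d_def)
      show "(norm z)\<^sup>2 - 2 * s < 0" using zero_le_power2[of "norm z"] unfolding s_def by argo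
    qed
    finally show False by simp
  qed
  then show ?thesis by blast
qed

lemma clinear_opD: "clinear_op T \<Longrightarrow> T (a *\<^sub>C x) = a *\<^sub>C T x"
  by (simp add: clinear_op_def)

text \<open>The imaginary part is again a real inner product, after a factor -i in the first
  argument. For complex-linear operators, adjoint identities therefore need checking only for the
  real inner product.\<close>

lemma cinner_via_inner: "cinner x y = Complex (inner x y) (inner ((- \<i>) *\<^sub>C x) (y::'a::complex_inner))"
  by (rule complex_eqI) (simp_all flip: Re_cinner add: cinner_scaleC_left)

text \<open>\<open>cadjoint\<close> is a definite description; this is its existence. The real Riesz
  theorem yields S pointwise, and complex linearity of T upgrades the real identity to the complex
  one.\<close>

lemma cinner_cadjoint:
  fixes T :: "'a::chilbert_space \<Rightarrow>\<^sub>L 'b::complex_inner"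
  assumes "clinear_op T"
  shows "cinner (T x) y = cinner x (cadjoint T y)"
proof -
  have "\<exists>z. \<forall>x. inner (T x) y = inner x z" for y
    by (rule riesz_real) (rule bounded_linear_compose[OF bounded_linear_inner_left blinfun.bounded_linear_right])
  then obtain S where S: "\<And>x y. inner (T x) y = inner x (S y)" by metis
  have C: "cinner (T x) y = cinner x (S y)" for x y
    unfolding cinner_via_inner[of "T x" y] cinner_via_inner[of x "S y"]
    using S[of x y] S[of "(- \<i>) *\<^sub>C x" y] by (simp only: clinear_opD[OF assms])
  have bl: "bounded_linear S"
  proof (rule bounded_linear_intro[where K="norm T"])
    show "S (u + v) = S u + S v" for u v
      by (rule cinner_eqI') (simp add: C[symmetric] cinner_simps)
    show "S (r *\<^sub>R u) = r *\<^sub>R S u" for r u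
      by (rule cinner_eqI') (simp add: C[symmetric] cinner_simps)
    show "norm (S u) \<le> norm u * norm T" for u
    proof (cases "S u = 0")
      case False
      have "(norm (S u))\<^sup>2 = inner (T (S u)) u" by (simp add: S power2_norm_eq_inner)
      also have "\<dots> \<le> norm (T (S u)) * norm u" by (rule norm_cauchy_schwarz)
      also have "\<dots> \<le> norm T * norm (S u) * norm u"
        by (intro mult_right_mono norm_blinfun) simp
      finally show ?thesis using False by (simp add: power2_eq_square mult.commute mult.left_commute)
    qed simp
  qed
  have "cadjoint T = Blinfun S"
    by (rule cadjoint_eqI) (simp add: bounded_linear_Blinfun_apply[OF bl] C)
  then show ?thesis by (simp add: bounded_linear_Blinfun_apply[OF bl] C)
qed

lemma cinner_cadjoint':
  fixes T :: "'a::chilbert_space \<Rightarrow>\<^sub>L 'b::complex_inner"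
  assumes "clinear_op T"
  shows "cinner (cadjoint T y) x = cinner y (T x)"
  by (metis assms cinner_cadjoint cinner_commute)

lemma clinear_op_cadjoint:
  fixes T :: "'a::chilbert_space \<Rightarrow>\<^sub>L 'b::complex_inner"
  assumes "clinear_op T"
  shows "clinear_op (cadjoint T)"
  unfolding clinear_op_def
  by (rule allI, rule allI, rule cinner_eqI) (simp add: cinner_cadjoint'[OF assms] cinner_simps)

lemma cadjoint_cadjoint:
  fixes T :: "'a::chilbert_space \<Rightarrow>\<^sub>L 'b::complex_inner"
  assumes "clinear_op T"
  shows "cadjoint (cadjoint T) = T"
  by (rule cadjoint_eqI) (simp add: cinner_cadjoint'[OF assms])

lemma cadjoint_add:
  fixes S T :: "'a::chilbert_space \<Rightarrow>\<^sub>L 'b::complex_inner"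
  assumes "clinear_op S" "clinear_op T"
  shows "cadjoint (S + T) = cadjoint S + cadjoint T"
  by (rule cadjoint_eqI) (simp add: cinner_cadjoint assms blinfun.add_left cinner_simps)

lemma cadjoint_diff:
  fixes S T :: "'a::chilbert_space \<Rightarrow>\<^sub>L 'b::complex_inner"
  assumes "clinear_op S" "clinear_op T"
  shows "cadjoint (S - T) = cadjoint S - cadjoint T"
  by (rule cadjoint_eqI) (simp add: cinner_cadjoint assms blinfun.diff_left cinner_simps)

lemma cadjoint_scaleC:
  fixes T :: "'a::chilbert_space \<Rightarrow>\<^sub>L 'b::chilbert_space"
  assumes "clinear_op T"
  shows "cadjoint (a *\<^sub>C T) = cnj a *\<^sub>C cadjoint T"
  by (rule cadjoint_eqI) (simp add: cinner_cadjoint assms scaleC_blinfun.rep_eq cinner_simps)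

lemma cadjoint_compose:
  fixes S :: "'b::chilbert_space \<Rightarrow>\<^sub>L 'c::complex_inner" and T :: "'a::chilbert_space \<Rightarrow>\<^sub>L 'b"
  assumes "clinear_op S" "clinear_op T"
  shows "cadjoint (S o\<^sub>L T) = cadjoint T o\<^sub>L cadjoint S"
  by (rule cadjoint_eqI) (simp add: cinner_cadjoint assms)

lemma cadjoint_id: "cadjoint (id_blinfun :: 'a::complex_inner \<Rightarrow>\<^sub>L 'a) = id_blinfun"
  by (rule cadjoint_eqI) simp

lemma clinear_op_add: "clinear_op S \<Longrightarrow> clinear_op T \<Longrightarrow> clinear_op (S + T)"
  by (simp add: clinear_op_def blinfun.add_left scaleC_add_right)

lemma clinear_op_diff: "clinear_op S \<Longrightarrow> clinear_op T \<Longrightarrow> clinear_op (S - T)"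
  by (simp add: clinear_op_def blinfun.diff_left scaleC_diff_right)

lemma clinear_op_scaleC: "clinear_op T \<Longrightarrow> clinear_op (a *\<^sub>C T)"
  by (simp add: clinear_op_def scaleC_blinfun.rep_eq scaleC_scaleC mult.commute)

lemma clinear_op_compose: "clinear_op S \<Longrightarrow> clinear_op T \<Longrightarrow> clinear_op (S o\<^sub>L T)"
  by (simp add: clinear_op_def)

lemma clinear_op_zero: "clinear_op 0"
  by (simp add: clinear_op_def scaleC_zero_right)

lemma clinear_op_id: "clinear_op id_blinfun"
  by (simp add: clinear_op_def)

lemma norm_cadjoint_le:
  fixes T :: "'a::chilbert_space \<Rightarrow>\<^sub>L 'b::complex_inner"
  assumes "clinear_op T"
  shows "norm (cadjoint T) \<le> norm T"
proof (rule norm_blinfun_bound)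
  fix u show "norm (cadjoint T u) \<le> norm T * norm u"
  proof (cases "cadjoint T u = 0")
    case False
    have "(norm (cadjoint T u))\<^sup>2 = cmod (cinner (cadjoint T u) (cadjoint T u))"
      by (simp add: cinner_self norm_power)
    also have "\<dots> = cmod (cinner (T (cadjoint T u)) u)" by (simp add: cinner_cadjoint[OF assms])
    also have "\<dots> \<le> norm (T (cadjoint T u)) * norm u" by (rule cmod_cinner_le)
    also have "\<dots> \<le> norm T * norm (cadjoint T u) * norm u"
      by (intro mult_right_mono norm_blinfun) simp
    finally show ?thesis using False by (simp add: power2_eq_square mult.commute mult.left_commute)
  qed simp
qed simp

lemma tendsto_cadjoint:
  fixes f :: "nat \<Rightarrow> ('a::chilbert_space \<Rightarrow>\<^sub>L 'b::complex_inner)"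
  assumes "f \<longlonglongrightarrow> T" "\<And>n. clinear_op (f n)" "clinear_op T"
  shows "(\<lambda>n. cadjoint (f n)) \<longlonglongrightarrow> cadjoint T"
proof -
  have lim: "(\<lambda>n. norm (f n - T)) \<longlonglongrightarrow> 0"
    using assms(1) by (simp add: LIM_zero tendsto_norm_zero)
  have le: "norm (cadjoint (f n) - cadjoint T) \<le> norm (f n - T)" for n
    using norm_cadjoint_le[of "f n - T"] assms by (simp add: cadjoint_diff clinear_op_diff)
  have "(\<lambda>n. cadjoint (f n) - cadjoint T) \<longlonglongrightarrow> 0"
    by (rule Lim_null_comparison[OF always_eventually lim]) (simp add: le)
  then show ?thesis by (simp add: LIM_zero_iff)
qed

lemma tendsto_scaleC: "(f \<longlongrightarrow> x) F \<Longrightarrow> ((\<lambda>n. a *\<^sub>C f n) \<longlongrightarrow> a *\<^sub>C (x::'a::complex_inner)) F"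
  by (rule bounded_linear.tendsto[OF bounded_linear_scaleC])

lemma tendsto_blinfun_compose:
  assumes "(f \<longlongrightarrow> S) F" "(g \<longlongrightarrow> T) F"
  shows "((\<lambda>n. f n o\<^sub>L g n) \<longlongrightarrow> S o\<^sub>L T) F"
  by (rule bounded_bilinear.tendsto[OF bounded_bilinear_blinfun_compose assms])

lemma closed_clinear_op: "closed {T :: 'a::complex_inner \<Rightarrow>\<^sub>L 'b::complex_inner. clinear_op T}"
  unfolding closed_sequential_limits
proof (intro allI impI)
  fix f and T :: "'a \<Rightarrow>\<^sub>L 'b"
  assume "(\<forall>n. f n \<in> {T. clinear_op T}) \<and> f \<longlonglongrightarrow> T"
  then have f: "\<And>n. clinear_op (f n)" and l: "f \<longlonglongrightarrow> T" by auto
  have ev: "(\<lambda>n. f n x) \<longlonglongrightarrow> T x" for x by (intro tendsto_intros l)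
  have "T (a *\<^sub>C x) = a *\<^sub>C T x" for a x
  proof (rule LIMSEQ_unique[OF ev])
    show "(\<lambda>n. f n (a *\<^sub>C x)) \<longlonglongrightarrow> a *\<^sub>C T x"
      using tendsto_scaleC[OF ev] by (simp add: clinear_opD[OF f])
  qed
  then show "T \<in> {T. clinear_op T}" by (simp add: clinear_op_def)
qed

section \<open>Generated C*-algebras\<close>

text \<open>A member of the family intersected in \<open>Cstar\<close>; with an empty family the
  hull would be the whole type, which also contains operators that are only real-linear.\<close>

lemma cstar_subalgebra_clinear: "cstar_subalgebra {T :: 'k::chilbert_space \<Rightarrow>\<^sub>L 'k. clinear_op T}"
  unfolding cstar_subalgebra_def csubspace_def
  using closed_clinear_op
  by (auto intro: clinear_op_add clinear_op_scaleC clinear_op_compose clinear_op_zero clinear_op_cadjoint)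

lemma cstar_subalgebra_Inter:
  assumes "\<And>B. B \<in> F \<Longrightarrow> cstar_subalgebra B" "F \<noteq> {}"
  shows "cstar_subalgebra (\<Inter>F)"
  unfolding cstar_subalgebra_def csubspace_def
proof (intro conjI ballI allI)
  show "closed (\<Inter>F)" using assms(1) by (intro closed_Inter) (simp add: cstar_subalgebra_def)
qed (use assms in \<open>auto simp: cstar_subalgebra_def csubspace_def\<close>)

lemma Cstar_cstar_subalgebra:
  assumes "\<And>s. s \<in> S \<Longrightarrow> clinear_op s"
  shows "cstar_subalgebra (Cstar S)"
  unfolding Cstar_def hull_def
  using assms by (intro cstar_subalgebra_Inter) (auto intro: cstar_subalgebra_clinear)

lemma Cstar_superset: "S \<subseteq> Cstar S"
  unfolding Cstar_def by (rule hull_subset)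

lemma Cstar_least: "cstar_subalgebra B \<Longrightarrow> S \<subseteq> B \<Longrightarrow> Cstar S \<subseteq> B"
  unfolding Cstar_def by (rule hull_minimal)

lemma cspan_superset: "X \<subseteq> cspan X"
  unfolding cspan_def by (rule hull_subset)

lemma cspan_least: "csubspace V \<Longrightarrow> X \<subseteq> V \<Longrightarrow> cspan X \<subseteq> V"
  unfolding cspan_def by (rule hull_minimal)

lemma Cstar_cspan_least:
  assumes "cstar_subalgebra B" "G \<subseteq> B"
  shows "Cstar (cspan G) \<subseteq> B"
  using assms by (intro Cstar_least cspan_least) (auto simp: cstar_subalgebra_def)

text \<open>
  A C*-subalgebra can be cut out by a condition that is not itself invariant under adjoints, by
  imposing it on an operator and its adjoint.
\<close>

lemma Cstar_cspan_induct:
  fixes G :: "('k::chilbert_space \<Rightarrow>\<^sub>L 'k) set"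
  assumes a: "a \<in> Cstar (cspan G)"
    and G: "\<And>g. g \<in> G \<Longrightarrow> clinear_op g" "\<And>g. g \<in> G \<Longrightarrow> cadjoint g \<in> G"
    and gen: "\<And>g. g \<in> G \<Longrightarrow> P g"
    and zero: "P 0"
    and add: "\<And>a b. a \<in> Cstar (cspan G) \<Longrightarrow> b \<in> Cstar (cspan G) \<Longrightarrow> P a \<Longrightarrow> P b \<Longrightarrow> P (a + b)"
    and scale: "\<And>z a. a \<in> Cstar (cspan G) \<Longrightarrow> P a \<Longrightarrow> P (z *\<^sub>C a)"
    and mult: "\<And>a b. a \<in> Cstar (cspan G) \<Longrightarrow> b \<in> Cstar (cspan G) \<Longrightarrow> P a \<Longrightarrow> P b \<Longrightarrow> P (a o\<^sub>L b)"
    and lim: "\<And>f a. (\<And>n::nat. f n \<in> Cstar (cspan G)) \<Longrightarrow> a \<in> Cstar (cspan G) \<Longrightarrow> (\<And>n. P (f n)) \<Longrightarrow> f \<longlonglongrightarrow> a \<Longrightarrow> P a"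
  shows "P a"
proof -
  let ?A = "Cstar (cspan G)"
  have cl: "cspan G \<subseteq> {T. clinear_op T}"
    using cstar_subalgebra_clinear G(1) by (intro cspan_least) (auto simp: cstar_subalgebra_def)
  then have A: "cstar_subalgebra ?A" by (intro Cstar_cstar_subalgebra) auto
  note A' = A[unfolded cstar_subalgebra_def csubspace_def]
  have GA: "G \<subseteq> ?A" using Cstar_superset[of "cspan G"] cspan_superset[of G] by blast
  define B where "B = {a \<in> ?A. P a \<and> P (cadjoint a)}"
  have "cstar_subalgebra B"
    unfolding cstar_subalgebra_def csubspace_def
  proof (intro conjI ballI allI)
    have "cadjoint (0 :: 'k \<Rightarrow>\<^sub>L 'k) = 0" by (rule cadjoint_eqI) simp
    then show "0 \<in> B" using A' zero by (simp add: B_def)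
    fix a assume "a \<in> B"
    then have a: "a \<in> ?A" "P a" "P (cadjoint a)" "clinear_op a" "cadjoint a \<in> ?A" using A' by (auto simp: B_def)
    show "clinear_op a" by fact
    show "cadjoint a \<in> B" using a by (simp add: B_def cadjoint_cadjoint)
    show "z *\<^sub>C a \<in> B" for z using a A' scale by (simp add: B_def cadjoint_scaleC)
    fix b assume "b \<in> B"
    then have b: "b \<in> ?A" "P b" "P (cadjoint b)" "clinear_op b" "cadjoint b \<in> ?A" using A' by (auto simp: B_def)
    show "a + b \<in> B" using a b A' add by (simp add: B_def cadjoint_add)
    show "a o\<^sub>L b \<in> B" using a b A' mult by (simp add: B_def cadjoint_compose)
  next
    show "closed B"
      unfolding closed_sequential_limits
    proof (intro allI impI)
      fix f l assume "(\<forall>n. f n \<in> B) \<and> f \<longlonglongrightarrow> l"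
      then have f: "\<And>n. f n \<in> ?A" "\<And>n. P (f n)" "\<And>n. P (cadjoint (f n))" and l: "f \<longlonglongrightarrow> l" by (auto simp: B_def)
      have lA: "l \<in> ?A" using A' f(1) l closed_sequentially by blast
      have "P l" by (rule lim[OF f(1) lA f(2) l])
      moreover have "P (cadjoint l)"
      proof (rule lim[of "\<lambda>n. cadjoint (f n)"])
        show "(\<lambda>n. cadjoint (f n)) \<longlonglongrightarrow> cadjoint l" using l lA f(1) A' by (intro tendsto_cadjoint) auto
      qed (use f lA A' in auto)
      ultimately show "l \<in> B" using lA by (simp add: B_def)
    qed
  qed
  moreover have "G \<subseteq> B" using G(2) gen GA by (auto simp: B_def)
  ultimately have "?A \<subseteq> B" by (rule Cstar_cspan_least)
  then show ?thesis using a by (auto simp: B_def)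
qed

section \<open>Representations and completely positive maps\<close>

text \<open>This makes the operator spaces complete, as the contraction principle in
  \<open>sqrt_one_minus\<close> requires.\<close>

instance chilbert_space \<subseteq> banach ..

lemma blinfun_compose_id: "T o\<^sub>L id_blinfun = T" "id_blinfun o\<^sub>L T = T"
  by (rule blinfun_eqI, simp)+

locale unital_cstar =
  fixes A :: "('k::chilbert_space \<Rightarrow>\<^sub>L 'k) set"
  assumes cstar: "cstar_subalgebra A" and one: "id_blinfun \<in> A"
begin

lemma clinear: "a \<in> A \<Longrightarrow> clinear_op a"
  and zero: "0 \<in> A"
  and add: "a \<in> A \<Longrightarrow> b \<in> A \<Longrightarrow> a + b \<in> A"
  and scaleC: "a \<in> A \<Longrightarrow> z *\<^sub>C a \<in> A"
  and compose: "a \<in> A \<Longrightarrow> b \<in> A \<Longrightarrow> a o\<^sub>L b \<in> A"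
  and adj: "a \<in> A \<Longrightarrow> cadjoint a \<in> A"
  and closed: "closed A"
  using cstar by (auto simp: cstar_subalgebra_def csubspace_def)

lemma scaleR: "a \<in> A \<Longrightarrow> r *\<^sub>R a \<in> A"
  by (simp add: scaleR_scaleC scaleC)

lemma uminus: "a \<in> A \<Longrightarrow> - a \<in> A"
  using scaleC[of a "-1"] by (simp add: scaleC_minus_one)

lemma diff: "a \<in> A \<Longrightarrow> b \<in> A \<Longrightarrow> a - b \<in> A"
  using add[OF _ uminus, of a b] by simp

lemma lim: "(\<And>n::nat. f n \<in> A) \<Longrightarrow> f \<longlonglongrightarrow> a \<Longrightarrow> a \<in> A"
  using closed closed_sequentially by blast

text \<open>
  The square root \<open>1 - y\<close> of \<open>1 - a\<^sup>* a\<close> is found through the fixed point equation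
  \<open>y = (a\<^sup>* a + y\<^sup>2) / 2\<close>, a contraction on a ball of radius less than 1.
\<close>

lemma sqrt_one_minus:
  assumes a: "a \<in> A" and n: "norm a < 1"
  obtains y where "y \<in> A" "cadjoint y = y"
    "(id_blinfun - y) o\<^sub>L (id_blinfun - y) = id_blinfun - (cadjoint a o\<^sub>L a)"
proof -
  define x where "x = cadjoint a o\<^sub>L a"
  define q where "q = (norm a)\<^sup>2"
  \<comment> \<open>The smaller root of r^2 - 2 r + q = 0. The map \<open>f\<close> below then
    preserves the ball of radius r, and r is also its contraction factor there, because y^2 - z^2 =
    y (y - z) + (y - z) z.\<close>
  define r where "r = 1 - sqrt (1 - q)"
  have q: "0 \<le> q" "q < 1" using n by (auto simp: q_def power_less_one_iff)
  then have sq: "0 < sqrt (1 - q)" "sqrt (1 - q) \<le> 1" "(sqrt (1 - q))\<^sup>2 = 1 - q" by auto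
  have r: "0 \<le> r" "r < 1" "(q + r\<^sup>2) / 2 = r" using sq by (auto simp: r_def power2_diff)
  have ca: "clinear_op a" using a clinear by blast
  have x: "x \<in> A" "cadjoint x = x"
    using a compose adj cadjoint_compose[OF clinear_op_cadjoint[OF ca] ca] by (auto simp: x_def cadjoint_cadjoint[OF ca])
  have nx: "norm x \<le> q"
  proof -
    have "norm x \<le> norm (cadjoint a) * norm a" unfolding x_def by (rule norm_blinfun_compose)
    also have "\<dots> \<le> norm a * norm a" by (intro mult_right_mono norm_cadjoint_le ca) simp
    finally show ?thesis by (simp add: q_def power2_eq_square)
  qed
  define s where "s = {y\<in>A. cadjoint y = y \<and> norm y \<le> r}"
  define f where "f y = (1/2) *\<^sub>R (x + (y o\<^sub>L y))" for y
  have closed_s: "closed s"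
    unfolding closed_sequential_limits
  proof (intro allI impI)
    fix g l assume "(\<forall>n. g n \<in> s) \<and> g \<longlonglongrightarrow> l"
    then have g: "\<And>n. g n \<in> A" "\<And>n. cadjoint (g n) = g n" "\<And>n. norm (g n) \<le> r" and l: "g \<longlonglongrightarrow> l"
      by (auto simp: s_def)
    have lA: "l \<in> A" by (rule lim[OF g(1) l])
    have "(\<lambda>n. cadjoint (g n)) \<longlonglongrightarrow> cadjoint l"
      by (rule tendsto_cadjoint) (use l g lA clinear in auto)
    then have "cadjoint l = l" using l g(2) LIMSEQ_unique by auto
    moreover have "norm l \<le> r"
      by (rule LIMSEQ_le_const2[OF tendsto_norm[OF l]]) (use g in auto)
    ultimately show "l \<in> s" using lA by (simp add: s_def)
  qed
  have "\<exists>!y\<in>s. f y = y"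
  proof (rule Banach_fix[OF closed_s[folded complete_eq_closed]])
    have "cadjoint (0 :: 'k \<Rightarrow>\<^sub>L 'k) = 0" by (rule cadjoint_eqI) simp
    then have "0 \<in> s" using r zero by (simp add: s_def)
    then show "s \<noteq> {}" by auto
    show "0 \<le> r" "r < 1" by fact+
    show "f ` s \<subseteq> s"
    proof (rule image_subsetI)
      fix y assume "y \<in> s"
      then have y: "y \<in> A" "cadjoint y = y" "norm y \<le> r" "clinear_op y" using clinear by (auto simp: s_def)
      have "f y \<in> A" unfolding f_def using x y by (intro scaleR add compose)
      moreover have "cadjoint (f y) = f y"
      proof (rule cadjoint_eqI)
        have "clinear_op x" using x clinear by blast
        then have 1: "cinner (x u) v = cinner u (x v)" for u v
          using cinner_cadjoint[of x u v] x by simp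
        have 2: "cinner (y u) v = cinner u (y v)" for u v
          using cinner_cadjoint[OF y(4), of u v] y by simp
        show "cinner (f y u) v = cinner u (f y v)" for u v
          by (simp add: f_def blinfun.add_left blinfun.scaleR_left cinner_simps 1 2)
      qed
      moreover have "norm (f y) \<le> r"
      proof -
        have "norm (f y) \<le> (norm x + norm (y o\<^sub>L y)) / 2" unfolding f_def
          using norm_triangle_ineq[of x "y o\<^sub>L y"] by simp
        also have "norm (y o\<^sub>L y) \<le> norm y * norm y" by (rule norm_blinfun_compose)
        also have "norm y * norm y \<le> r * r" using y r by (intro mult_mono) auto
        finally show ?thesis using nx r(3) by (simp add: power2_eq_square)
      qed
      ultimately show "f y \<in> s" by (simp add: s_def)
    qed
    show "dist (f y) (f z) \<le> r * dist y z" if "y \<in> s" "z \<in> s" for y z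
    proof -
      have yz: "norm y \<le> r" "norm z \<le> r" using that by (auto simp: s_def)
      have "f y - f z = (1/2) *\<^sub>R ((y o\<^sub>L (y - z)) + ((y - z) o\<^sub>L z))"
        by (rule blinfun_eqI) (simp add: f_def blinfun.add_left blinfun.diff_left blinfun.diff_right
            blinfun.scaleR_left algebra_simps)
      then have "norm (f y - f z) \<le> (norm (y o\<^sub>L (y - z)) + norm ((y - z) o\<^sub>L z)) / 2"
        using norm_triangle_ineq[of "y o\<^sub>L (y - z)" "(y - z) o\<^sub>L z"] by simp
      also have "norm (y o\<^sub>L (y - z)) \<le> norm y * norm (y - z)" by (rule norm_blinfun_compose)
      also have "\<dots> \<le> r * norm (y - z)" using yz by (intro mult_right_mono) auto
      also have "norm ((y - z) o\<^sub>L z) \<le> norm (y - z) * norm z" by (rule norm_blinfun_compose)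
      also have "\<dots> \<le> norm (y - z) * r" using yz by (intro mult_left_mono) auto
      finally show ?thesis by (simp add: dist_norm mult.commute)
    qed
  qed
  then obtain y where y: "y \<in> A" "cadjoint y = y" and "f y = y" by (auto simp: s_def)
  then have "2 *\<^sub>R y = 2 *\<^sub>R f y" by simp
  then have fy: "2 *\<^sub>R y = x + (y o\<^sub>L y)" by (simp add: f_def)
  have "(id_blinfun - y) o\<^sub>L (id_blinfun - y) = id_blinfun - x"
  proof (rule blinfun_eqI)
    fix v
    have "2 *\<^sub>R y v = x v + y (y v)" using arg_cong[OF fy, of "\<lambda>T. T v"]
      by (simp add: blinfun.scaleR_left blinfun.add_left)
    then show "((id_blinfun - y) o\<^sub>L (id_blinfun - y)) v = (id_blinfun - x) v"
      by (simp add: blinfun.diff_left blinfun.diff_right scaleR_2 algebra_simps)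
  qed
  then show ?thesis using that y by (simp add: x_def)
qed

end

section \<open>Representations on a closed subspace and their contractivity\<close>

lemma bops_onD:
  assumes "T \<in> bops_on H"
  shows "clinear_op T" "T x \<in> H"
  using assms by (auto simp: bops_on_def)

locale unital_cstar_rep = unital_cstar A for A :: "('k::chilbert_space \<Rightarrow>\<^sub>L 'k) set" +
  fixes H :: "'h::chilbert_space set" and \<pi> :: "('k \<Rightarrow>\<^sub>L 'k) \<Rightarrow> ('h \<Rightarrow>\<^sub>L 'h)"
  assumes rep: "representation A H \<pi>"
begin

lemma H: "csubspace H" "closed H"
  and pi_bops: "a \<in> A \<Longrightarrow> \<pi> a \<in> bops_on H"
  and pi_add: "a \<in> A \<Longrightarrow> b \<in> A \<Longrightarrow> \<pi> (a + b) = \<pi> a + \<pi> b"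
  and pi_scaleC: "a \<in> A \<Longrightarrow> \<pi> (z *\<^sub>C a) = z *\<^sub>C \<pi> a"
  and pi_id: "x \<in> H \<Longrightarrow> \<pi> id_blinfun x = x"
  and pi_compose: "a \<in> A \<Longrightarrow> b \<in> A \<Longrightarrow> \<pi> (a o\<^sub>L b) = \<pi> a o\<^sub>L \<pi> b"
  and pi_adj: "a \<in> A \<Longrightarrow> \<pi> (cadjoint a) = cadjoint (\<pi> a)"
  using rep by (auto simp: representation_def unital_clinear_map_def closed_csubspace_def)

lemma H_simps: "0 \<in> H" "x \<in> H \<Longrightarrow> y \<in> H \<Longrightarrow> x + y \<in> H" "x \<in> H \<Longrightarrow> z *\<^sub>C x \<in> H"
  using H by (auto simp: csubspace_def)

lemma H_uminus: "x \<in> H \<Longrightarrow> - x \<in> H"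
  using H_simps(3)[of x "-1"] by (simp add: scaleC_minus_one)

lemma pi_H: "a \<in> A \<Longrightarrow> \<pi> a x \<in> H"
  using pi_bops bops_onD by blast

lemma pi_clinear: "a \<in> A \<Longrightarrow> clinear_op (\<pi> a)"
  using pi_bops bops_onD by blast

lemma pi_diff: "a \<in> A \<Longrightarrow> b \<in> A \<Longrightarrow> \<pi> (a - b) = \<pi> a - \<pi> b"
  using pi_add[of a "(-1) *\<^sub>C b"] pi_scaleC[of b "-1"] scaleC[of b "-1"] by (simp add: scaleC_minus_one)

lemma pi_zero: "\<pi> 0 = 0"
  using pi_scaleC[OF zero, of 0] by (simp add: scaleC_zero_left)

lemma cinner_pi_adj: "a \<in> A \<Longrightarrow> cinner (\<pi> (cadjoint a) x) y = cinner x (\<pi> a y)"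
  by (simp add: pi_adj cinner_cadjoint' pi_clinear)

text \<open>\<open>\<pi> id_blinfun\<close> is self-adjoint and fixes H pointwise, so it is the
  orthogonal projection onto H. Elements of \<open>bops_on H\<close> are thus determined by their
  values on H.\<close>

lemma proj_orth:
  assumes "y \<in> H"
  shows "cinner (x - \<pi> id_blinfun x) y = 0"
  using cinner_pi_adj[OF one, of x y] assms by (simp add: cadjoint_id cinner_diff_left pi_id)

lemma bops_proj: "T \<in> bops_on H \<Longrightarrow> T x = T (\<pi> id_blinfun x)"
  using proj_orth[of _ x] blinfun.diff_right[of T x "\<pi> id_blinfun x"] unfolding bops_on_def by fastforce

lemma bops_on_eqI:
  assumes "S \<in> bops_on H" "T \<in> bops_on H" "\<And>x. x \<in> H \<Longrightarrow> S x = T x"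
  shows "S = T"
  by (rule blinfun_eqI) (metis assms bops_proj pi_H one)

text \<open>Continuity is not part of \<open>representation\<close>; it follows algebraically. If
  norm b < 1, then 1 - b^* b is the square of a self-adjoint u in A, whence |x|^2 - |\<pi>(b) x|^2 =
  |\<pi>(u) x|^2 is nonnegative.\<close>

lemma norm_pi_le:
  assumes a: "a \<in> A" and x: "x \<in> H"
  shows "norm (\<pi> a x) \<le> norm a * norm x"
proof -
  have le: "norm (\<pi> b x) \<le> norm x" if b: "b \<in> A" "norm b < 1" for b
  proof -
    obtain y where y: "y \<in> A" "cadjoint y = y"
      "(id_blinfun - y) o\<^sub>L (id_blinfun - y) = id_blinfun - (cadjoint b o\<^sub>L b)"
      using sqrt_one_minus[OF b] by blast
    define u where "u = id_blinfun - y"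
    have u: "u \<in> A" "cadjoint u = u"
      using y one diff clinear by (auto simp: u_def cadjoint_diff clinear_op_id cadjoint_id)
    have "cinner (\<pi> (u o\<^sub>L u) x) x = cinner (\<pi> u x) (\<pi> u x)"
      using cinner_pi_adj[OF u(1), of "\<pi> u x" x] u by (simp add: pi_compose)
    moreover have "cinner (\<pi> (cadjoint b o\<^sub>L b) x) x = cinner (\<pi> b x) (\<pi> b x)"
      using cinner_pi_adj[OF b(1), of "\<pi> b x" x] b adj by (simp add: pi_compose)
    moreover have "\<pi> (u o\<^sub>L u) x = x - \<pi> (cadjoint b o\<^sub>L b) x"
      using y(3) b one x compose adj by (simp add: u_def pi_diff blinfun.diff_left pi_id)
    ultimately have "complex_of_real ((norm (\<pi> u x))\<^sup>2) = complex_of_real ((norm x)\<^sup>2) - complex_of_real ((norm (\<pi> b x))\<^sup>2)"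
      by (simp only: cinner_diff_left cinner_self)
    then have "(norm (\<pi> u x))\<^sup>2 = (norm x)\<^sup>2 - (norm (\<pi> b x))\<^sup>2"
      by (simp only: of_real_diff[symmetric] of_real_eq_iff)
    then have "(norm (\<pi> b x))\<^sup>2 \<le> (norm x)\<^sup>2" by (smt (verit) zero_le_power2)
    then show ?thesis by (rule power2_le_imp_le) simp
  qed
  \<comment> \<open>The square root needs norm strictly below 1; scaling by any t > norm a provides
    it, and t then decreases to norm a.\<close>
  have "norm (\<pi> a x) \<le> t * norm x" if t: "t > norm a" for t
  proof -
    have t0: "t > 0" using t norm_ge_zero[of a] by linarith
    have "norm (\<pi> ((1/t) *\<^sub>R a) x) \<le> norm x"
      using t t0 by (intro le scaleR a) (simp add: field_simps)
    moreover have "\<pi> ((1/t) *\<^sub>R a) x = (1/t) *\<^sub>R \<pi> a x"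
      by (simp only: scaleR_scaleC pi_scaleC[OF a] scaleC_blinfun.rep_eq)
    ultimately show ?thesis using t0 by (simp add: field_simps)
  qed
  note t = this
  show ?thesis
  proof (rule field_le_epsilon)
    fix e :: real assume e: "e > 0"
    have "norm (\<pi> a x) \<le> (norm a + e / (norm x + 1)) * norm x"
      using e by (intro t) (simp add: add_nonneg_pos)
    also have "\<dots> = norm a * norm x + e * (norm x / (norm x + 1))" by (simp add: algebra_simps)
    also have "\<dots> \<le> norm a * norm x + e * 1"
      using e by (intro add_left_mono mult_left_mono divide_le_eq_1_pos[THEN iffD2]) (auto simp: add_nonneg_pos)
    finally show "norm (\<pi> a x) \<le> norm a * norm x + e" by simp
  qed
qed

end

section \<open>Schwarz inequality and multiplicativity for unital completely positive maps\<close>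

lemma nonneg_of_real: "0 \<le> r \<Longrightarrow> complex_of_real r \<in> \<real>\<^sub>\<ge>\<^sub>0"
  by (simp add: complex_nonneg_Reals_iff)

lemma nonneg_RealsD: "z \<in> \<real>\<^sub>\<ge>\<^sub>0 \<Longrightarrow> Im z = 0 \<and> 0 \<le> Re z"
  by (simp add: complex_nonneg_Reals_iff)

locale ucp_extension = unital_cstar_rep A H \<pi>
  for A :: "('k::chilbert_space \<Rightarrow>\<^sub>L 'k) set" and H :: "'h::chilbert_space set" and \<pi> +
  fixes \<phi> :: "('k \<Rightarrow>\<^sub>L 'k) \<Rightarrow> ('h \<Rightarrow>\<^sub>L 'h)"
  assumes ucp: "ucp A H \<phi>"
begin

lemma phi_bops: "a \<in> A \<Longrightarrow> \<phi> a \<in> bops_on H"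
  and phi_add: "a \<in> A \<Longrightarrow> b \<in> A \<Longrightarrow> \<phi> (a + b) = \<phi> a + \<phi> b"
  and phi_scaleC: "a \<in> A \<Longrightarrow> \<phi> (z *\<^sub>C a) = z *\<^sub>C \<phi> a"
  and phi_id: "x \<in> H \<Longrightarrow> \<phi> id_blinfun x = x"
  and phi_cp: "(\<And>i j. i < n \<Longrightarrow> j < n \<Longrightarrow> m i j \<in> A) \<Longrightarrow> positive_op_matrix n m \<Longrightarrow>
    positive_op_matrix n (\<lambda>i j. \<phi> (m i j))"
  using ucp by (auto simp: ucp_def unital_clinear_map_def completely_positive_def)

lemma phi_H: "a \<in> A \<Longrightarrow> \<phi> a x \<in> H"
  using phi_bops bops_onD by blast

lemma phi_clinear: "a \<in> A \<Longrightarrow> clinear_op (\<phi> a)"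
  using phi_bops bops_onD by blast

lemma phi_diff: "a \<in> A \<Longrightarrow> b \<in> A \<Longrightarrow> \<phi> (a - b) = \<phi> a - \<phi> b"
  using phi_add[of a "(-1) *\<^sub>C b"] phi_scaleC[of b "-1"] scaleC[of b "-1"] by (simp add: scaleC_minus_one)

lemma phi_zero: "\<phi> 0 = 0"
  using phi_scaleC[OF zero, of 0] by (simp add: scaleC_zero_left)

text \<open>The form of the matrix with entries b_i^* b_j at v is the squared norm of the sum of the
  b_i v_i. Apart from \<open>phi_pos\<close>, complete positivity is used below only through these
  matrices, with at most three rows.\<close>

lemma phi_gram:
  fixes n :: nat
  assumes b: "\<And>i. i < n \<Longrightarrow> b i \<in> A"
  shows "(\<Sum>i<n. \<Sum>j<n. cinner (\<phi> (cadjoint (b i) o\<^sub>L b j) (x j)) (x i)) \<in> \<real>\<^sub>\<ge>\<^sub>0"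
proof -
  have sum_left: "cinner (\<Sum>i\<in>I. f i) y = (\<Sum>i\<in>I. cinner (f i) y)" for f :: "nat \<Rightarrow> 'k" and I y
    by (induction I rule: infinite_finite_induct) (simp_all add: cinner_add_left)
  have sum_right: "cinner y (\<Sum>i\<in>I. f i) = (\<Sum>i\<in>I. cinner y (f i))" for f :: "nat \<Rightarrow> 'k" and I y
    by (induction I rule: infinite_finite_induct) (simp_all add: cinner_add_right)
  have "positive_op_matrix n (\<lambda>i j. cadjoint (b i) o\<^sub>L b j)"
    unfolding positive_op_matrix_def
  proof
    fix v :: "nat \<Rightarrow> 'k"
    define w where "w = (\<Sum>i<n. b i (v i))"
    have "(\<Sum>i<n. \<Sum>j<n. cinner ((cadjoint (b i) o\<^sub>L b j) (v j)) (v i)) = (\<Sum>i<n. \<Sum>j<n. cinner (b j (v j)) (b i (v i)))"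
      using b clinear by (intro sum.cong) (auto simp: cinner_cadjoint')
    also have "\<dots> = cinner w w" unfolding w_def by (simp add: sum_left sum_right)
    also have "\<dots> \<in> \<real>\<^sub>\<ge>\<^sub>0" unfolding cinner_self by (rule nonneg_of_real) simp
    finally show "(\<Sum>i<n. \<Sum>j<n. cinner ((cadjoint (b i) o\<^sub>L b j) (v j)) (v i)) \<in> \<real>\<^sub>\<ge>\<^sub>0" .
  qed
  then have "positive_op_matrix n (\<lambda>i j. \<phi> (cadjoint (b i) o\<^sub>L b j))"
    using b by (intro phi_cp compose adj)
  then show ?thesis by (simp add: positive_op_matrix_def)
qed

lemma phi_pos:
  assumes a: "a \<in> A" and pos: "\<And>v. cinner (a v) v \<in> \<real>\<^sub>\<ge>\<^sub>0"
  shows "cinner (\<phi> a h) h \<in> \<real>\<^sub>\<ge>\<^sub>0"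
proof -
  have "positive_op_matrix 1 (\<lambda>i j. a)" using pos by (simp add: positive_op_matrix_def)
  then have "positive_op_matrix 1 (\<lambda>i j. \<phi> a)" using a by (intro phi_cp)
  from this[unfolded positive_op_matrix_def, rule_format, of "\<lambda>_. h"] show ?thesis by simp
qed

lemma phi_square_pos: "a \<in> A \<Longrightarrow> cinner (\<phi> (cadjoint a o\<^sub>L a) h) h \<in> \<real>\<^sub>\<ge>\<^sub>0"
  using phi_gram[of 1 "\<lambda>_. a" "\<lambda>_. h"] by simp

lemma phi_gram2:
  assumes a: "a \<in> A"
  shows "cinner (\<phi> id_blinfun k) k + cinner (\<phi> a h) k + (cinner (\<phi> (cadjoint a) k) h
        + cinner (\<phi> (cadjoint a o\<^sub>L a) h) h) \<in> \<real>\<^sub>\<ge>\<^sub>0"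
  using phi_gram[of 2 "\<lambda>i. if i = 0 then id_blinfun else a" "\<lambda>i. if i = 0 then k else h"] a one
  by (simp add: numeral_2_eq_2 cadjoint_id blinfun_compose_id)

text \<open>Nonnegative values are in particular real. Hence the off-diagonal part of the 2 x 2 Gram
  form has imaginary part 0, for h as well as for i h, and the two conditions together say that its
  two entries are conjugate.\<close>

lemma phi_adj:
  assumes a: "a \<in> A"
  shows "cinner (\<phi> (cadjoint a) k) h = cinner k (\<phi> a h)"
proof -
  have im: "Im (cinner (\<phi> a h) k + cinner (\<phi> (cadjoint a) k) h) = 0" for h
  proof -
    have "cinner (\<phi> id_blinfun k) k + cinner (\<phi> a h) k + (cinner (\<phi> (cadjoint a) k) h
        + cinner (\<phi> (cadjoint a o\<^sub>L a) h) h) \<in> \<real>\<^sub>\<ge>\<^sub>0"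
      by (rule phi_gram2[OF a])
    moreover have "cinner (\<phi> id_blinfun k) k \<in> \<real>\<^sub>\<ge>\<^sub>0" using phi_square_pos[OF one, of k] by (simp add: cadjoint_id blinfun_compose_id)
    moreover have "cinner (\<phi> (cadjoint a o\<^sub>L a) h) h \<in> \<real>\<^sub>\<ge>\<^sub>0" by (rule phi_square_pos[OF a])
    ultimately show ?thesis by (auto dest!: nonneg_RealsD)
  qed
  from im[of h] im[of "\<i> *\<^sub>C h"] a adj[OF a]
  have "cinner (\<phi> (cadjoint a) k) h = cnj (cinner (\<phi> a h) k)"
    by (auto simp: complex_eq_iff clinear_opD[OF phi_clinear] cinner_simps)
  then show ?thesis by (metis cinner_commute)
qed

lemma phi_schwarz:
  assumes a: "a \<in> A" and h: "h \<in> H"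
  shows "(norm (\<phi> a h))\<^sup>2 \<le> Re (cinner (\<phi> (cadjoint a o\<^sub>L a) h) h)"
proof -
  \<comment> \<open>This choice completes the square in the 2 x 2 Gram form; what remains is the
    difference of the two sides of the claim.\<close>
  define k where "k = - \<phi> a h"
  have k: "k \<in> H" using phi_H[OF a] H_uminus by (simp add: k_def)
  have "cinner k k + cinner (\<phi> a h) k + (cinner (\<phi> (cadjoint a) k) h
        + cinner (\<phi> (cadjoint a o\<^sub>L a) h) h) \<in> \<real>\<^sub>\<ge>\<^sub>0"
    using phi_gram2[OF a, of k h] by (simp add: phi_id[OF k])
  moreover have "cinner (\<phi> (cadjoint a) k) h = - cinner k k"
    by (simp add: phi_adj[OF a]) (simp add: k_def cinner_simps)
  moreover have "cinner (\<phi> a h) k = - complex_of_real ((norm (\<phi> a h))\<^sup>2)"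
    unfolding cinner_self[symmetric] by (simp add: k_def cinner_simps)
  ultimately show ?thesis by (auto dest!: nonneg_RealsD)
qed

text \<open>
  Pointwise version of the multiplicative domain of a unital completely positive map.
\<close>

lemma phi_mult_domain:
  assumes a: "a \<in> A" and b: "b \<in> A" and h: "h \<in> H"
    and eq: "cinner (\<phi> (cadjoint b o\<^sub>L b) h) h = complex_of_real ((norm (\<phi> b h))\<^sup>2)"
  shows "\<phi> (a o\<^sub>L b) h = \<phi> a (\<phi> b h)"
proof (rule cinner_eqI)
  fix k
  define z where "z = cinner (\<phi> (a o\<^sub>L b) h - \<phi> a (\<phi> b h)) k"
  define M where "M = Re (cinner (\<phi> (a o\<^sub>L cadjoint a) k) k)"
  define n where "n = complex_of_real ((norm (\<phi> b h))\<^sup>2)"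
  have lin: "clinear_op a" "clinear_op b" "clinear_op (a o\<^sub>L b)" using a b clinear compose by auto
  have q: "0 \<le> - 2 * s * (cmod z)\<^sup>2 + M" for s :: real
  proof -
    define t where "t = - complex_of_real s * cnj z"
    \<comment> \<open>The Gram form of b, 1, a^* at the vectors t h, - t \<phi>(b) h, k. Equality in
      the Schwarz inequality cancels everything quadratic in t, so a real-affine function of t
      remains that is bounded below; its linear coefficient z must vanish.\<close>
    define B where "B = (\<lambda>i::nat. if i = 0 then b else if i = 1 then id_blinfun else cadjoint a)"
    define x where "x = (\<lambda>i::nat. if i = 0 then t *\<^sub>C h else if i = 1 then - (t *\<^sub>C \<phi> b h) else k)"
    have "(\<Sum>i<3. \<Sum>j<3. cinner (\<phi> (cadjoint (B i) o\<^sub>L B j) (x j)) (x i)) \<in> \<real>\<^sub>\<ge>\<^sub>0"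
      by (rule phi_gram) (auto simp: B_def a b one adj)
    then have pos: "0 \<le> Re (\<Sum>i<3. \<Sum>j<3. cinner (\<phi> (cadjoint (B i) o\<^sub>L B j) (x j)) (x i))"
      by (auto dest!: nonneg_RealsD)
    have 01: "cinner (\<phi> (cadjoint b) (\<phi> b h)) h = n"
      by (simp add: phi_adj[OF b] cinner_self n_def)
    have 02: "cinner (\<phi> (cadjoint b o\<^sub>L cadjoint a) k) h = cnj (cinner (\<phi> (a o\<^sub>L b) h) k)"
      using phi_adj[OF compose[OF a b], of k h] cinner_commute[of k]
      by (simp add: cadjoint_compose lin)
    have 12: "cinner (\<phi> (cadjoint a) k) (\<phi> b h) = cnj (cinner (\<phi> a (\<phi> b h)) k)"
      using phi_adj[OF a, of k "\<phi> b h"] cinner_commute[of k] by simp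
    have 11: "cinner (\<phi> b h) (\<phi> b h) = n" "cinner (\<phi> id_blinfun (\<phi> b h)) (\<phi> b h) = n"
      by (simp_all add: phi_id[OF phi_H[OF b]] cinner_self n_def)
    have "(\<Sum>i<3. \<Sum>j<3. cinner (\<phi> (cadjoint (B i) o\<^sub>L B j) (x j)) (x i))
        = cnj (t * z) + t * z + cinner (\<phi> (a o\<^sub>L cadjoint a) k) k"
      by (simp add: numeral_3_eq_3 B_def x_def cadjoint_id blinfun_compose_id cadjoint_cadjoint lin
          clinear_opD[OF phi_clinear] a b one adj compose blinfun.minus_right cinner_simps
          01 02 12 11 eq[folded n_def] z_def algebra_simps)
    then have "0 \<le> Re (cnj (t * z) + t * z) + M" using pos by (simp add: M_def)
    moreover have "t * z = - complex_of_real (s * (cmod z)\<^sup>2)"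
      unfolding t_def by (simp add: mult.assoc mult.commute[of "cnj z"] complex_norm_square[symmetric] del: of_real_power)
    ultimately show ?thesis by simp
  qed
  have "z = 0"
  proof (rule ccontr)
    assume "z \<noteq> 0"
    then have "(cmod z)\<^sup>2 > 0" by simp
    \<comment> \<open>At this s the affine bound would take the value -1.\<close>
    then show False using q[of "(M + 1) / (2 * (cmod z)\<^sup>2)"] by (simp add: field_simps)
  qed
  then show "cinner (\<phi> (a o\<^sub>L b) h) k = cinner (\<phi> a (\<phi> b h)) k" by (simp add: z_def cinner_simps)
qed

text \<open>A vanishing right-hand side forces equality in the Schwarz inequality, so
  \<open>phi_mult_domain\<close> applies: elements whose square is null in the state of h form a
  left ideal annihilated at h.\<close>

lemma phi_null_square:
  assumes a: "a \<in> A" and b: "b \<in> A" and h: "h \<in> H"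
    and eq: "cinner (\<phi> (cadjoint b o\<^sub>L b) h) h = 0"
  shows "\<phi> b h = 0" "\<phi> (a o\<^sub>L b) h = 0"
proof -
  show *: "\<phi> b h = 0" using phi_schwarz[OF b h] eq by simp
  show "\<phi> (a o\<^sub>L b) h = 0" using phi_mult_domain[OF a b h] eq * by simp
qed

text \<open>The form of |a|^2 - a^* a is nonnegative, which bounds the right-hand side of the
  Schwarz inequality.\<close>

lemma norm_phi_le:
  assumes a: "a \<in> A" and h: "h \<in> H"
  shows "norm (\<phi> a h) \<le> norm a * norm h"
proof -
  define d where "d = complex_of_real ((norm a)\<^sup>2) *\<^sub>C id_blinfun - (cadjoint a o\<^sub>L a)"
  have d: "d \<in> A" unfolding d_def using a one by (intro diff scaleC compose adj)
  have "cinner (d v) v \<in> \<real>\<^sub>\<ge>\<^sub>0" for v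
  proof -
    have "cinner (d v) v = complex_of_real ((norm a)\<^sup>2 * (norm v)\<^sup>2 - (norm (a v))\<^sup>2)"
      by (simp add: d_def blinfun.diff_left scaleC_blinfun.rep_eq cinner_simps cinner_self
          cinner_cadjoint' clinear[OF a])
    moreover have "(norm (a v))\<^sup>2 \<le> (norm a)\<^sup>2 * (norm v)\<^sup>2"
      using power_mono[OF norm_blinfun[of a v], of 2] by (simp add: power_mult_distrib)
    ultimately show ?thesis by (simp only:) (rule nonneg_of_real, simp)
  qed
  then have "cinner (\<phi> d h) h \<in> \<real>\<^sub>\<ge>\<^sub>0" by (rule phi_pos[OF d])
  moreover have "\<phi> d h = complex_of_real ((norm a)\<^sup>2) *\<^sub>C h - \<phi> (cadjoint a o\<^sub>L a) h"
    unfolding d_def using a one h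
    by (simp only: phi_diff scaleC compose adj phi_scaleC blinfun.diff_left scaleC_blinfun.rep_eq phi_id)
  ultimately have "Re (cinner (\<phi> (cadjoint a o\<^sub>L a) h) h) \<le> (norm a)\<^sup>2 * (norm h)\<^sup>2"
    by (auto dest!: nonneg_RealsD simp: cinner_simps cinner_self)
  then have "(norm (\<phi> a h))\<^sup>2 \<le> (norm a * norm h)\<^sup>2"
    using phi_schwarz[OF a h] by (simp add: power_mult_distrib)
  then show ?thesis by (rule power2_le_imp_le) simp
qed

text \<open>Only the vector states are compared, not the vectors \<phi>(a) h and \<pi>(a) h;
  equality of the vectors is the content of \<open>agree_eq\<close>.\<close>

definition agree :: "'h \<Rightarrow> bool" where
  "agree h \<longleftrightarrow> h \<in> H \<and> (\<forall>a\<in>A. cinner (\<phi> a h) h = cinner (\<pi> a h) h)"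

text \<open>Since the states coincide at b^* b and \<pi> is multiplicative, equality \<phi>(b) h =
  \<pi>(b) h is equality in the Schwarz inequality. The state of \<pi>(b) h at a is then the state
  of h at b^* a b, on which both maps coincide.\<close>

lemma agree_step:
  assumes h: "agree h" and b: "b \<in> A" and eq: "\<phi> b h = \<pi> b h"
  shows "a \<in> A \<Longrightarrow> \<phi> (a o\<^sub>L b) h = \<phi> a (\<pi> b h)" and "agree (\<pi> b h)"
proof -
  have hH: "h \<in> H" using h by (simp add: agree_def)
  have *: "\<phi> (a o\<^sub>L b) h = \<phi> a (\<pi> b h)" if a: "a \<in> A" for a
  proof -
    have "cinner (\<phi> (cadjoint b o\<^sub>L b) h) h = cinner (\<pi> (cadjoint b o\<^sub>L b) h) h"
      using h b adj compose by (simp add: agree_def)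
    also have "\<dots> = cinner (\<pi> b h) (\<pi> b h)"
      using b adj by (simp add: pi_compose cinner_pi_adj)
    finally show ?thesis using phi_mult_domain[OF a b hH] by (simp add: eq cinner_self)
  qed
  then show "a \<in> A \<Longrightarrow> \<phi> (a o\<^sub>L b) h = \<phi> a (\<pi> b h)" .
  have "cinner (\<phi> a (\<pi> b h)) (\<pi> b h) = cinner (\<pi> a (\<pi> b h)) (\<pi> b h)" if a: "a \<in> A" for a
  proof -
    note mem = a b adj[OF b] adj[OF a] compose
    have "cinner (\<phi> a (\<pi> b h)) (\<pi> b h) = cinner (\<phi> (cadjoint (cadjoint a)) (\<pi> b h)) (\<pi> b h)"
      by (simp add: cadjoint_cadjoint clinear a)
    also have "\<dots> = cinner (\<pi> b h) (\<phi> (cadjoint a) (\<pi> b h))"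
      by (rule phi_adj[OF adj[OF a]])
    also have "\<dots> = cnj (cinner (\<phi> (cadjoint a o\<^sub>L b) h) (\<phi> b h))"
      using *[OF adj[OF a]] eq cinner_commute by metis
    also have "cinner (\<phi> (cadjoint a o\<^sub>L b) h) (\<phi> b h) = cinner (\<phi> (cadjoint b) (\<phi> (cadjoint a o\<^sub>L b) h)) h"
      by (rule phi_adj[OF b, symmetric])
    also have "\<dots> = cnj (cinner h (\<phi> (cadjoint b) (\<phi> (cadjoint a o\<^sub>L b) h)))"
      by (rule cinner_commute)
    finally have 1: "cinner (\<phi> a (\<pi> b h)) (\<pi> b h) = cinner h (\<phi> (cadjoint b) (\<phi> (cadjoint a o\<^sub>L b) h))" by simp
    \<comment> \<open>The multiplication rule only splits off b on the right. Conjugating the inner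
      product brings the other factor b into that position, so that a single \<phi> of (a b)^* b at
      h remains.\<close>
    have "cinner (\<phi> a (\<pi> b h)) (\<pi> b h) = cinner (\<phi> (a o\<^sub>L b) h) (\<phi> b h)" using *[OF a] eq by simp
    also have "\<dots> = cnj (cinner (\<phi> b h) (\<phi> (a o\<^sub>L b) h))" by (rule cinner_commute)
    also have "cinner (\<phi> b h) (\<phi> (a o\<^sub>L b) h) = cinner (\<phi> (cadjoint (a o\<^sub>L b)) (\<phi> b h)) h"
      using a b by (intro phi_adj[symmetric] compose)
    also have "\<phi> (cadjoint (a o\<^sub>L b)) (\<phi> b h) = \<phi> (cadjoint (a o\<^sub>L b) o\<^sub>L b) h"
      using *[of "cadjoint (a o\<^sub>L b)"] eq a b by (simp add: adj compose)
    also have "cinner \<dots> h = cinner (\<pi> (cadjoint (a o\<^sub>L b) o\<^sub>L b) h) h"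
      using h a b by (simp add: agree_def adj compose)
    also have "\<dots> = cinner (\<pi> b h) (\<pi> a (\<pi> b h))"
      using a b by (simp add: pi_compose cinner_pi_adj adj compose)
    also have "cnj \<dots> = cinner (\<pi> a (\<pi> b h)) (\<pi> b h)" by (rule cinner_commute[symmetric])
    finally show ?thesis .
  qed
  then show "agree (\<pi> b h)" by (simp add: agree_def pi_H[OF b])
qed

end

section \<open>From one common vector state to equality of the maps\<close>

locale ucp_extension_gen = ucp_extension "Cstar (cspan G)" H \<pi> \<phi>
  for G :: "('k::chilbert_space \<Rightarrow>\<^sub>L 'k) set" and H :: "'h::chilbert_space set" and \<pi> \<phi> +
  assumes G_adj: "g \<in> G \<Longrightarrow> cadjoint g \<in> G"
    and ext: "g \<in> G \<Longrightarrow> \<phi> g = \<pi> g"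
begin

abbreviation "A \<equiv> Cstar (cspan G)"

lemma G_A: "g \<in> G \<Longrightarrow> g \<in> A"
  using Cstar_superset[of "cspan G"] cspan_superset[of G] by blast

lemma tendsto_contraction:
  fixes \<psi> :: "('k \<Rightarrow>\<^sub>L 'k) \<Rightarrow> ('h \<Rightarrow>\<^sub>L 'h)"
  assumes le: "\<And>b. b \<in> A \<Longrightarrow> norm (\<psi> b h) \<le> norm b * norm h"
    and d: "\<And>a b. a \<in> A \<Longrightarrow> b \<in> A \<Longrightarrow> \<psi> (a - b) = \<psi> a - \<psi> b"
    and f: "\<And>n. f n \<in> A" "a \<in> A" "f \<longlonglongrightarrow> a"
  shows "(\<lambda>n. \<psi> (f n) h) \<longlonglongrightarrow> \<psi> a h"
proof -
  have lim: "(\<lambda>n. norm (f n - a) * norm h) \<longlonglongrightarrow> 0"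
    using f(3) by (auto intro!: tendsto_mult_left_zero tendsto_norm_zero LIM_zero)
  have "norm (\<psi> (f n) h - \<psi> a h) \<le> norm (f n - a) * norm h" for n
    using le[OF diff[OF f(1,2)], of n] by (simp add: d f blinfun.diff_left)
  then have "(\<lambda>n. \<psi> (f n) h - \<psi> a h) \<longlonglongrightarrow> 0"
    by (rule Lim_null_comparison[OF always_eventually[OF allI] lim])
  then show ?thesis by (simp add: LIM_zero_iff)
qed

lemma tendsto_phi:
  "(\<And>n. f n \<in> A) \<Longrightarrow> a \<in> A \<Longrightarrow> f \<longlonglongrightarrow> a \<Longrightarrow> h \<in> H \<Longrightarrow> (\<lambda>n. \<phi> (f n) h) \<longlonglongrightarrow> \<phi> a h"
  by (rule tendsto_contraction[where \<psi>=\<phi>]) (simp_all add: norm_phi_le phi_diff)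

lemma tendsto_pi:
  "(\<And>n. f n \<in> A) \<Longrightarrow> a \<in> A \<Longrightarrow> f \<longlonglongrightarrow> a \<Longrightarrow> h \<in> H \<Longrightarrow> (\<lambda>n. \<pi> (f n) h) \<longlonglongrightarrow> \<pi> a h"
  by (rule tendsto_contraction[where \<psi>=\<pi>]) (simp_all add: norm_pi_le pi_diff)

text \<open>The induction ranges over all agreeing h at once, since in the product step the left
  factor acts on \<pi>(b) h, which agrees by \<open>agree_step\<close>.\<close>

lemma agree_eq:
  assumes "a \<in> A"
  shows "\<forall>h. agree h \<longrightarrow> \<phi> a h = \<pi> a h"
  using assms
proof (rule Cstar_cspan_induct)
  show "clinear_op g" if "g \<in> G" for g using G_A clinear that by blast
  show "cadjoint g \<in> G" if "g \<in> G" for g using G_adj that by blast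
  show "\<forall>h. agree h \<longrightarrow> \<phi> g h = \<pi> g h" if "g \<in> G" for g using ext that by simp
  show "\<forall>h. agree h \<longrightarrow> \<phi> 0 h = \<pi> 0 h" by (simp add: phi_zero pi_zero)
  fix a assume a: "a \<in> A" "\<forall>h. agree h \<longrightarrow> \<phi> a h = \<pi> a h"
  show "\<forall>h. agree h \<longrightarrow> \<phi> (z *\<^sub>C a) h = \<pi> (z *\<^sub>C a) h" for z
    using a by (simp add: phi_scaleC pi_scaleC scaleC_blinfun.rep_eq)
  fix b assume b: "b \<in> A" "\<forall>h. agree h \<longrightarrow> \<phi> b h = \<pi> b h"
  show "\<forall>h. agree h \<longrightarrow> \<phi> (a + b) h = \<pi> (a + b) h"
    using a b by (simp add: phi_add pi_add blinfun.add_left)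
  show "\<forall>h. agree h \<longrightarrow> \<phi> (a o\<^sub>L b) h = \<pi> (a o\<^sub>L b) h"
    using a b agree_step by (simp add: pi_compose)
next
  fix f :: "nat \<Rightarrow> _" and a
  assume f: "\<And>n. f n \<in> A" "a \<in> A" "\<And>n. \<forall>h. agree h \<longrightarrow> \<phi> (f n) h = \<pi> (f n) h" "f \<longlonglongrightarrow> a"
  show "\<forall>h. agree h \<longrightarrow> \<phi> a h = \<pi> a h"
  proof (intro allI impI)
    fix h assume h: "agree h"
    then have hH: "h \<in> H" by (simp add: agree_def)
    show "\<phi> a h = \<pi> a h"
      using tendsto_phi[OF f(1,2,4) hH] tendsto_pi[OF f(1,2,4) hH] f(3) h LIMSEQ_unique by auto
  qed
qed

text \<open>The vectors on which both maps coincide form an invariant subspace.\<close>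

lemma phi_eq_pi:
  assumes irr: "irreducible_representation A H \<pi>" and h: "agree h" "h \<noteq> 0" and a: "a \<in> A"
  shows "\<phi> a = \<pi> a"
proof -
  define N where "N = {x\<in>H. \<forall>a\<in>A. \<phi> a x = \<pi> a x}"
  have "closed_csubspace N"
    unfolding closed_csubspace_def
  proof
    show "csubspace N"
      by (auto simp: csubspace_def N_def H_simps blinfun.add_right clinear_opD phi_clinear pi_clinear)
    show "closed N"
      unfolding closed_sequential_limits
    proof (intro allI impI)
      fix f l assume "(\<forall>n. f n \<in> N) \<and> f \<longlonglongrightarrow> l"
      then have f: "\<And>n. f n \<in> H" "\<And>n a. a \<in> A \<Longrightarrow> \<phi> a (f n) = \<pi> a (f n)" and l: "f \<longlonglongrightarrow> l"
        by (auto simp: N_def)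
      have "l \<in> H" using H(2) f(1) l closed_sequentially by blast
      moreover have "\<phi> a l = \<pi> a l" if "a \<in> A" for a
      proof (rule LIMSEQ_unique)
        show "(\<lambda>n. \<phi> a (f n)) \<longlonglongrightarrow> \<phi> a l" by (intro tendsto_intros l)
        show "(\<lambda>n. \<phi> a (f n)) \<longlonglongrightarrow> \<pi> a l" unfolding f(2)[OF that] by (intro tendsto_intros l)
      qed
      ultimately show "l \<in> N" by (simp add: N_def)
    qed
  qed
  \<comment> \<open>Equality at x gives agreement of the states at x, then at \<pi>(b) x, and
    \<open>agree_eq\<close> turns this back into equality of vectors.\<close>
  moreover have "\<pi> b x \<in> N" if b: "b \<in> A" and x: "x \<in> N" for b x
  proof -
    have "agree x" using x by (auto simp: N_def agree_def)
    then have "agree (\<pi> b x)" using x b agree_step(2) by (simp add: N_def)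
    then show ?thesis using agree_eq by (simp add: N_def agree_def)
  qed
  moreover have "N \<subseteq> H" by (auto simp: N_def)
  ultimately have "N = {0} \<or> N = H" using irr by (simp add: irreducible_representation_def)
  moreover have "h \<in> N" using h agree_eq by (simp add: N_def agree_def)
  ultimately have "N = H" using h by auto
  then show ?thesis
    using a by (intro bops_on_eqI phi_bops pi_bops) (auto simp: N_def)
qed

end

section \<open>Integrals over the sphere\<close>

lemma integral_rotation:
  fixes Q :: "real^4^4" and f :: "real^4 \<Rightarrow> real"
  assumes Q: "rotation_matrix Q" and f: "f \<in> borel_measurable borel"
  shows "(\<integral>t. f (Q *v t) \<partial>m_S3) = (\<integral>t. f t \<partial>m_S3)"
proof -
  note I = rotation_invariant_m_S3
  note D = rotation_invariant_prob_S3_D[OF I]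
  have fm: "f \<in> borel_measurable m_S3"
    using measurable_compose[OF D(4) f] by simp
  have "(\<integral>t. f t \<partial>m_S3) = (\<integral>t. f t \<partial>distr m_S3 m_S3 (\<lambda>x. Q *v x))"
    using I Q by (simp add: rotation_invariant_prob_S3_def)
  also have "\<dots> = (\<integral>t. f (Q *v t) \<partial>m_S3)"
    by (rule integral_distr[OF rot_measurable[OF Q D(1)] fm])
  finally show ?thesis by simp
qed

text \<open>A rotation carrying the first axis to x turns x \<bullet> t into the first
  coordinate.\<close>

lemma integral_zonal:
  fixes x :: "real^4" and k :: "real \<Rightarrow> real"
  assumes x: "x \<in> S3" and k: "k \<in> borel_measurable borel"
  shows "(\<integral>t. k (x \<bullet> t) \<partial>m_S3) = (\<integral>t. k (t $ 1) \<partial>m_S3)"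
proof -
  have "norm (axis 1 1 :: real^4) = norm x" using x by (simp add: S3_def)
  then obtain f :: "real^4 \<Rightarrow> real^4"
    where f: "orthogonal_transformation f" "det (matrix f) = 1" "f (axis 1 1) = x"
    using rotation_exists[of "axis 1 1" x] by (auto simp: S3_def)
  have Qf: "matrix f *v z = f z" for z
    using f(1) by (simp add: orthogonal_transformation_linear matrix_works)
  have Q: "rotation_matrix (matrix f)"
    using f by (simp add: rotation_matrix_def orthogonal_transformation_matrix)
  have *: "x \<bullet> f t = t $ 1" for t
  proof -
    have "x \<bullet> f t = f (axis 1 1) \<bullet> f t" by (simp add: f)
    also have "\<dots> = axis 1 1 \<bullet> t" using f(1) by (simp add: orthogonal_transformation_def)
    finally show ?thesis by (simp add: inner_axis inner_commute)
  qed
  have "(\<lambda>t. k (x \<bullet> t)) \<in> borel_measurable borel" using k by measurable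
  from integral_rotation[OF Q this] show ?thesis by (simp add: Qf *)
qed

text \<open>The rotation by the angle \<theta> in the plane of the coordinates 1 and
  \<open>j\<close>. For \<open>j = 1\<close> the formula degenerates, hence the assumption
  \<open>j \<noteq> 1\<close> throughout.\<close>

definition plane_rot :: "4 \<Rightarrow> real \<Rightarrow> real^4 \<Rightarrow> real^4" where
  "plane_rot j \<theta> t = (\<chi> i. if i = 1 then cos \<theta> * t $ 1 - sin \<theta> * t $ j
     else if i = j then sin \<theta> * t $ 1 + cos \<theta> * t $ j else t $ i)"

lemma S3_sum_squares: "x \<in> S3 \<longleftrightarrow> (x $ 1)\<^sup>2 + (x $ 2)\<^sup>2 + (x $ 3)\<^sup>2 + (x $ 4)\<^sup>2 = 1"
  by (simp add: S3_def norm_vec_def L2_set_def sum_4)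

lemma orthogonal_plane_rot:
  assumes "j \<noteq> 1"
  shows "orthogonal_transformation (plane_rot j \<theta>)"
proof -
  have l: "linear (plane_rot j \<theta>)"
    by (rule linearI) (simp_all add: plane_rot_def vec_eq_iff algebra_simps)
  have "norm (plane_rot j \<theta> v) = norm v" for v
  proof -
    have sc: "(sin \<theta>)\<^sup>2 = 1 - (cos \<theta>)\<^sup>2" using sin_cos_squared_add[of \<theta>] by linarith
    have "(cos \<theta> * v $ 1 - sin \<theta> * v $ j)\<^sup>2 + (sin \<theta> * v $ 1 + cos \<theta> * v $ j)\<^sup>2 = (v $ 1)\<^sup>2 + (v $ j)\<^sup>2"
      by (simp add: power2_sum power2_diff power_mult_distrib sc algebra_simps)
    moreover have "j = 2 \<or> j = 3 \<or> j = 4" using assms exhaust_4[of j] by auto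
    ultimately have "(\<Sum>i\<in>UNIV. (plane_rot j \<theta> v $ i)\<^sup>2) = (\<Sum>i\<in>UNIV. (v $ i)\<^sup>2)"
      by (auto simp: sum_4 plane_rot_def)
    then show ?thesis by (simp add: norm_vec_def L2_set_def)
  qed
  then show ?thesis using l by (simp add: orthogonal_transformation)
qed

lemma plane_rot_add:
  assumes "j \<noteq> 1"
  shows "plane_rot j \<theta> (plane_rot j \<eta> t) = plane_rot j (\<theta> + \<eta>) t"
  using assms by (simp add: plane_rot_def vec_eq_iff cos_add sin_add algebra_simps)

text \<open>No determinant is expanded: the rotation by \<theta> is the square of the one by
  \<theta> / 2, whose determinant is 1 or -1.\<close>

lemma rotation_matrix_plane_rot:
  assumes "j \<noteq> 1"
  shows "rotation_matrix (matrix (plane_rot j \<theta>))"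
proof -
  note ot = orthogonal_plane_rot[OF assms]
  have lin: "linear (plane_rot j (\<theta> / 2))" using ot orthogonal_transformation_linear by blast
  have "plane_rot j \<theta> = plane_rot j (\<theta> / 2) \<circ> plane_rot j (\<theta> / 2)"
    by (simp add: fun_eq_iff plane_rot_add[OF assms])
  then have "matrix (plane_rot j \<theta>) = matrix (plane_rot j (\<theta> / 2)) ** matrix (plane_rot j (\<theta> / 2))"
    by (simp add: matrix_compose[OF lin lin])
  then have "det (matrix (plane_rot j \<theta>)) = (det (matrix (plane_rot j (\<theta> / 2))))\<^sup>2"
    by (simp add: det_mul power2_eq_square)
  moreover have "orthogonal_matrix (matrix (plane_rot j (\<theta> / 2)))"
    using ot orthogonal_transformation_matrix by blast
  then have "det (matrix (plane_rot j (\<theta> / 2))) \<in> {1, -1}" using det_orthogonal_matrix by blast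
  ultimately show ?thesis
    using ot[of \<theta>] by (auto simp: rotation_matrix_def orthogonal_transformation_matrix)
qed

lemma integral_plane_rot:
  fixes f :: "real^4 \<Rightarrow> real"
  assumes j: "j \<noteq> 1" and f: "f \<in> borel_measurable borel"
  shows "(\<integral>t. f (plane_rot j \<theta> t) \<partial>m_S3) = (\<integral>t. f t \<partial>m_S3)"
proof -
  have "matrix (plane_rot j \<theta>) *v z = plane_rot j \<theta> z" for z
    using orthogonal_plane_rot[OF j] by (simp add: orthogonal_transformation_linear matrix_works)
  then show ?thesis using integral_rotation[OF rotation_matrix_plane_rot[OF j] f, of \<theta>] by simp
qed

lemma borel_m_S3:
  fixes f :: "real^4 \<Rightarrow> 'b::topological_space"
  shows "f \<in> borel_measurable borel \<Longrightarrow> f \<in> borel_measurable m_S3"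
  by (rule measurable_compose[OF rotation_invariant_prob_S3_D(4)[OF rotation_invariant_m_S3]])

lemma integrable_bounded_S3:
  fixes f :: "real^4 \<Rightarrow> real"
  assumes "f \<in> borel_measurable borel" "\<And>t. t \<in> S3 \<Longrightarrow> \<bar>f t\<bar> \<le> C"
  shows "integrable m_S3 f"
  by (rule m_S3.integrable_const_bound[where B=C])
    (use assms borel_m_S3 in \<open>auto intro!: AE_I2 simp: space_m_S3\<close>)

lemma coord_square_le_1: "t \<in> S3 \<Longrightarrow> (t $ i)\<^sup>2 \<le> 1"
  using component_le_norm_cart[of t i] by (simp add: S3_def abs_square_le_1)

text \<open>
  The rotation invariance in infinitesimal form: the derivative of the rotation in the plane of the
  coordinates 1 and \<open>j\<close> maps \<open>t\<^sub>j h(t\<^sub>1)\<close> to \<open>t\<^sub>1 h(t\<^sub>1) - t\<^sub>j\<^sup>2 h'(t\<^sub>1)\<close>, which therefore has integral 0.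
\<close>

lemma integral_infinitesimal_rotation:
  assumes \<delta>: "1 < \<delta>" and j: "j \<noteq> 1"
  defines "h \<equiv> \<lambda>s::real. s / (\<delta> - s\<^sup>2)" and "h' \<equiv> \<lambda>s::real. (\<delta> + s\<^sup>2) / (\<delta> - s\<^sup>2)\<^sup>2"
  shows "(\<integral>t. t $ 1 * h (t $ 1) - (t $ j)\<^sup>2 * h' (t $ 1) \<partial>m_S3) = 0"
proof -
  define f where "f t = t $ j * h (t $ 1)" for t :: "real^4"
  define D where "D t = t $ 1 * h (t $ 1) - (t $ j)\<^sup>2 * h' (t $ 1)" for t :: "real^4"
  \<comment> \<open>A bound for D on the sphere, from |h| \<le> 1 / (\<delta> - 1), |h'| \<le>
    (\<delta> + 1) / (\<delta> - 1)^2 and coordinates of modulus at most 1.\<close>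
  define C where "C = 1 / (\<delta> - 1) + (\<delta> + 1) / (\<delta> - 1)\<^sup>2"
  have den: "\<delta> - 1 \<le> \<delta> - s\<^sup>2" "0 < \<delta> - s\<^sup>2" if "s\<^sup>2 \<le> 1" for s :: real
    using that \<delta> by auto
  have h_le: "\<bar>h s\<bar> \<le> 1 / (\<delta> - 1)" if "s\<^sup>2 \<le> 1" for s
  proof -
    have "\<bar>s\<bar> \<le> 1" using that by (simp add: abs_square_le_1)
    then show ?thesis using den[OF that] \<delta> unfolding h_def abs_divide
      by (intro frac_le) auto
  qed
  have h'_le: "\<bar>h' s\<bar> \<le> (\<delta> + 1) / (\<delta> - 1)\<^sup>2" if "s\<^sup>2 \<le> 1" for s
    using den[OF that] \<delta> that unfolding h'_def
    by (auto intro!: frac_le power_mono)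
  have h_deriv: "(h has_real_derivative h' s) (at s)" if "s\<^sup>2 \<le> 1" for s
    unfolding h_def h'_def using den[OF that]
    by (auto intro!: derivative_eq_intros simp: field_simps power2_eq_square)
  have D_le: "\<bar>D t\<bar> \<le> C" if "t \<in> S3" for t
  proof -
    have c1: "(t $ 1)\<^sup>2 \<le> 1" "(t $ j)\<^sup>2 \<le> 1" "\<bar>t $ 1\<bar> \<le> 1"
      using coord_square_le_1[OF that] by (auto simp: abs_square_le_1[symmetric])
    have "\<bar>t $ 1 * h (t $ 1)\<bar> \<le> 1 * (1 / (\<delta> - 1))"
      unfolding abs_mult using c1 h_le by (intro mult_mono) auto
    moreover have "\<bar>(t $ j)\<^sup>2 * h' (t $ 1)\<bar> \<le> 1 * ((\<delta> + 1) / (\<delta> - 1)\<^sup>2)"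
      unfolding abs_mult using c1 h'_le by (intro mult_mono) auto
    ultimately show ?thesis unfolding D_def C_def by linarith
  qed
  have f_meas: "f \<in> borel_measurable borel" unfolding f_def h_def by measurable
  have rot_S3: "plane_rot j \<theta> t \<in> S3" if "t \<in> S3" for \<theta> t
    using that orthogonal_transformation_norm[OF orthogonal_plane_rot[OF j]] by (simp add: S3_def)
  have deriv: "((\<lambda>\<theta>. f (plane_rot j \<theta> t)) has_real_derivative D (plane_rot j \<theta> t)) (at \<theta>)"
    if "t \<in> S3" for t \<theta>
  proof -
    have "(cos \<theta> * t $ 1 - sin \<theta> * t $ j)\<^sup>2 \<le> 1"
      using coord_square_le_1[OF rot_S3[OF that], of \<theta> 1] by (simp add: plane_rot_def)
    note h1 = h_deriv[OF this]
    have "((\<lambda>\<theta>. cos \<theta> * t $ 1 - sin \<theta> * t $ j) has_real_derivative (- sin \<theta> * t $ 1 - cos \<theta> * t $ j)) (at \<theta>)"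
      by (auto intro!: derivative_eq_intros)
    from DERIV_chain2[where f=h and g="\<lambda>\<theta>. cos \<theta> * t $ 1 - sin \<theta> * t $ j", OF h1 this]
    have 1: "((\<lambda>\<theta>. h (cos \<theta> * t $ 1 - sin \<theta> * t $ j)) has_real_derivative
        h' (cos \<theta> * t $ 1 - sin \<theta> * t $ j) * (- sin \<theta> * t $ 1 - cos \<theta> * t $ j)) (at \<theta>)" .
    have 2: "((\<lambda>\<theta>. sin \<theta> * t $ 1 + cos \<theta> * t $ j) has_real_derivative (cos \<theta> * t $ 1 - sin \<theta> * t $ j)) (at \<theta>)"
      by (auto intro!: derivative_eq_intros)
    show ?thesis unfolding f_def D_def plane_rot_def using DERIV_mult[OF 2 1] j
      by (simp add: algebra_simps power2_eq_square)
  qed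
  have f_le: "\<bar>f (plane_rot j \<theta> t)\<bar> \<le> 1 / (\<delta> - 1)" if "t \<in> S3" for t \<theta>
  proof -
    have c1: "\<bar>plane_rot j \<theta> t $ j\<bar> \<le> 1" "(plane_rot j \<theta> t $ 1)\<^sup>2 \<le> 1"
      using coord_square_le_1[OF rot_S3[OF that]] by (auto simp: abs_square_le_1[symmetric])
    have "\<bar>f (plane_rot j \<theta> t)\<bar> \<le> 1 * (1 / (\<delta> - 1))"
      unfolding f_def abs_mult using c1 h_le by (intro mult_mono) auto
    then show ?thesis by simp
  qed
  have rot_meas: "(\<lambda>t. f (plane_rot j \<theta> t)) \<in> borel_measurable borel" for \<theta>
  proof (rule measurable_compose[OF _ f_meas])
    show "plane_rot j \<theta> \<in> borel_measurable borel"
      using orthogonal_plane_rot[OF j]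
      by (intro borel_measurable_continuous_onI linear_continuous_on)
         (simp add: orthogonal_transformation_linear linear_linear)
  qed
  have rot0: "plane_rot j 0 t = t" for t using j by (simp add: plane_rot_def vec_eq_iff)
  \<comment> \<open>The difference quotients in the angle have integral 0 by invariance, are bounded
    by C by the mean value theorem, and tend to D; dominated convergence then gives the
    claim.\<close>
  define r where "r n = 1 / real (Suc n)" for n
  define q where "q n t = (f (plane_rot j (r n) t) - f t) / r n" for n t
  have r: "r n > 0" for n by (simp add: r_def)
  have r_lim: "r \<longlonglongrightarrow> 0" unfolding r_def by (rule LIMSEQ_Suc[OF lim_inverse_n'])
  have q_meas: "q n \<in> borel_measurable borel" for n
    unfolding q_def using rot_meas f_meas by measurable
  have D_meas: "D \<in> borel_measurable borel" unfolding D_def h_def h'_def by measurable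
  have q_le: "\<bar>q n t\<bar> \<le> C" if t: "t \<in> S3" for n t
  proof -
    have "\<exists>z>0. z < r n \<and> f (plane_rot j (r n) t) - f (plane_rot j 0 t) = (r n - 0) * D (plane_rot j z t)"
      by (rule MVT2[OF r]) (use deriv[OF t] in auto)
    then obtain z where "f (plane_rot j (r n) t) - f t = r n * D (plane_rot j z t)"
      by (auto simp: rot0)
    then have "q n t = D (plane_rot j z t)" using r[of n] by (simp add: q_def)
    then show ?thesis using D_le[OF rot_S3[OF t]] by simp
  qed
  have q_lim: "(\<lambda>n. q n t) \<longlonglongrightarrow> D t" if t: "t \<in> S3" for t
  proof -
    have "((\<lambda>\<theta>. (f (plane_rot j \<theta> t) - f t) / \<theta>) \<longlongrightarrow> D t) (at 0)"
      using deriv[OF t, of 0] unfolding has_field_derivative_iff by (simp add: rot0)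
    moreover have "filterlim r (at 0) sequentially"
      using r_lim r by (auto simp: filterlim_at intro!: always_eventually less_imp_neq[symmetric])
    ultimately show ?thesis unfolding q_def by (rule filterlim_compose)
  qed
  have "(\<lambda>n. \<integral>t. q n t \<partial>m_S3) \<longlonglongrightarrow> (\<integral>t. D t \<partial>m_S3)"
  proof (rule integral_dominated_convergence[where w="\<lambda>_. C"])
    show "D \<in> borel_measurable m_S3" "\<And>n. q n \<in> borel_measurable m_S3"
      using D_meas q_meas by (auto intro: borel_m_S3)
    show "AE t in m_S3. (\<lambda>n. q n t) \<longlonglongrightarrow> D t"
      by (rule AE_I2) (simp add: space_m_S3 q_lim)
    show "AE t in m_S3. norm (q n t) \<le> C" for n
      by (rule AE_I2) (simp add: space_m_S3 q_le)
  qed simp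
  moreover have "(\<integral>t. q n t \<partial>m_S3) = 0" for n
  proof -
    have "integrable m_S3 (\<lambda>t. f (plane_rot j (r n) t))" "integrable m_S3 f"
      using integrable_bounded_S3[OF rot_meas f_le] integrable_bounded_S3[OF f_meas f_le[of _ 0, unfolded rot0]] by auto
    then show ?thesis unfolding q_def using integral_plane_rot[OF j f_meas] by simp
  qed
  ultimately show ?thesis unfolding D_def using LIMSEQ_unique[OF _ tendsto_const] by auto
qed

section \<open>The integral of 1 / (1 - <x,t>)\<close>

lemma integral_affine_S3:
  fixes q :: "real^4 \<Rightarrow> real"
  assumes "integrable m_S3 q"
  shows "(\<integral>t. a + b * q t \<partial>m_S3) = a + b * (\<integral>t. q t \<partial>m_S3)"
  using assms by (simp add: m_S3.prob_space)

text \<open>Adding the infinitesimal identities for j = 2, 3, 4 gives 3 J \<le> 1 + 2 J, so J \<le>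
  1. The 3 is the dimension of the sphere: with n in its place the inequality bounds J only if n >
  2. The claim follows from 1 / (\<delta> - s^2) = (1 + s^2 / (\<delta> - s^2)) / \<delta>.\<close>

lemma integral_coord_kernel_le:
  assumes \<delta>: "1 < \<delta>"
  shows "(\<integral>t. 1 / (\<delta> - (t $ 1)\<^sup>2) \<partial>m_S3) \<le> 2 / \<delta>"
proof -
  define J where "J = (\<integral>t. (t $ 1)\<^sup>2 / (\<delta> - (t $ 1)\<^sup>2) \<partial>m_S3)"
  define h' where "h' s = (\<delta> + s\<^sup>2) / (\<delta> - s\<^sup>2)\<^sup>2" for s :: real
  have den: "\<delta> - 1 \<le> \<delta> - s\<^sup>2" "0 < \<delta> - s\<^sup>2" if "s\<^sup>2 \<le> 1" for s :: real
    using that \<delta> by auto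
  have i1: "integrable m_S3 (\<lambda>t. (t $ 1)\<^sup>2 / (\<delta> - (t $ 1)\<^sup>2))"
  proof (rule integrable_bounded_S3[where C="1 / (\<delta> - 1)"])
    fix t :: "real^4" assume t: "t \<in> S3"
    note c = coord_square_le_1[OF t, of 1]
    show "\<bar>(t $ 1)\<^sup>2 / (\<delta> - (t $ 1)\<^sup>2)\<bar> \<le> 1 / (\<delta> - 1)"
      using den[OF c] c \<delta> by (auto intro!: frac_le)
  qed measurable
  have i2: "integrable m_S3 (\<lambda>t. (t $ j)\<^sup>2 * h' (t $ 1))" for j
  proof (rule integrable_bounded_S3[where C="1 * ((\<delta> + 1) / (\<delta> - 1)\<^sup>2)"])
    fix t :: "real^4" assume t: "t \<in> S3"
    note c = coord_square_le_1[OF t]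
    show "\<bar>(t $ j)\<^sup>2 * h' (t $ 1)\<bar> \<le> 1 * ((\<delta> + 1) / (\<delta> - 1)\<^sup>2)"
      unfolding abs_mult using den[OF c[of 1]] c \<delta>
      by (intro mult_mono) (auto simp: h'_def intro!: frac_le power_mono)
  qed (unfold h'_def, measurable)
  have eq: "J = (\<integral>t. (t $ j)\<^sup>2 * h' (t $ 1) \<partial>m_S3)" if "j \<noteq> 1" for j
  proof -
    have "(\<integral>t. (t $ 1)\<^sup>2 / (\<delta> - (t $ 1)\<^sup>2) - (t $ j)\<^sup>2 * h' (t $ 1) \<partial>m_S3) = 0"
      using integral_infinitesimal_rotation[OF \<delta> that] by (simp add: h'_def power2_eq_square)
    then show ?thesis using i1 i2 by (simp add: J_def)
  qed
  have "3 * J = (\<integral>t. (t $ 2)\<^sup>2 * h' (t $ 1) \<partial>m_S3) + (\<integral>t. (t $ 3)\<^sup>2 * h' (t $ 1) \<partial>m_S3)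
      + (\<integral>t. (t $ 4)\<^sup>2 * h' (t $ 1) \<partial>m_S3)"
    using eq[of 2] eq[of 3] eq[of 4] by simp
  also have "\<dots> = (\<integral>t. (t $ 2)\<^sup>2 * h' (t $ 1) + (t $ 3)\<^sup>2 * h' (t $ 1) + (t $ 4)\<^sup>2 * h' (t $ 1) \<partial>m_S3)"
    using i2 by simp
  also have "\<dots> \<le> (\<integral>t. 1 + 2 * ((t $ 1)\<^sup>2 / (\<delta> - (t $ 1)\<^sup>2)) \<partial>m_S3)"
  proof (rule integral_mono)
    fix t assume "t \<in> space m_S3"
    then have t: "t \<in> S3" by (simp add: space_m_S3)
    note c = coord_square_le_1[OF t, of 1]
    have "(t $ 2)\<^sup>2 * h' (t $ 1) + (t $ 3)\<^sup>2 * h' (t $ 1) + (t $ 4)\<^sup>2 * h' (t $ 1) = (1 - (t $ 1)\<^sup>2) * h' (t $ 1)"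
    proof -
      have "1 - (t $ 1)\<^sup>2 = (t $ 2)\<^sup>2 + (t $ 3)\<^sup>2 + (t $ 4)\<^sup>2"
        using t unfolding S3_sum_squares by linarith
      then show ?thesis by (simp only: distrib_right)
    qed
    \<comment> \<open>Enlarging 1 to \<delta> cancels one factor of the squared denominator and
      leaves (\<delta> + s^2) / (\<delta> - s^2).\<close>
    also have "\<dots> \<le> (\<delta> - (t $ 1)\<^sup>2) * h' (t $ 1)"
      using \<delta> den[OF c] by (intro mult_right_mono) (auto simp: h'_def)
    also have "\<dots> = 1 + 2 * ((t $ 1)\<^sup>2 / (\<delta> - (t $ 1)\<^sup>2))"
    proof -
      have "w * ((w + 2 * u) / w\<^sup>2) = 1 + 2 * (u / w)" if "w > 0" for w u :: real
        using that by (simp add: power2_eq_square field_simps)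
      from this[OF den(2)[OF c], of "(t $ 1)\<^sup>2"] show ?thesis unfolding h'_def by (simp add: add.commute)
    qed
    finally show "(t $ 2)\<^sup>2 * h' (t $ 1) + (t $ 3)\<^sup>2 * h' (t $ 1) + (t $ 4)\<^sup>2 * h' (t $ 1)
      \<le> 1 + 2 * ((t $ 1)\<^sup>2 / (\<delta> - (t $ 1)\<^sup>2))" .
  next
    show "integrable m_S3 (\<lambda>t. 1 + 2 * ((t $ 1)\<^sup>2 / (\<delta> - (t $ 1)\<^sup>2)))"
      by (intro Bochner_Integration.integrable_add integrable_mult_right i1) simp
  qed (use i2 in auto)
  also have "\<dots> = 1 + 2 * J" unfolding J_def by (rule integral_affine_S3[OF i1])
  finally have J: "J \<le> 1" by simp
  have "(\<integral>t. 1 / (\<delta> - (t $ 1)\<^sup>2) \<partial>m_S3) = (\<integral>t. 1 / \<delta> + (1 / \<delta>) * ((t $ 1)\<^sup>2 / (\<delta> - (t $ 1)\<^sup>2)) \<partial>m_S3)"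
  proof (rule Bochner_Integration.integral_cong[OF refl])
    fix t assume "t \<in> space m_S3"
    then have "\<delta> - (t $ 1)\<^sup>2 > 0" using den(2)[OF coord_square_le_1] by (simp add: space_m_S3)
    then show "1 / (\<delta> - (t $ 1)\<^sup>2) = 1 / \<delta> + (1 / \<delta>) * ((t $ 1)\<^sup>2 / (\<delta> - (t $ 1)\<^sup>2))"
      using \<delta> by (simp add: field_simps)
  qed
  also have "\<dots> = 1 / \<delta> + (1 / \<delta>) * J" unfolding J_def by (rule integral_affine_S3[OF i1])
  also have "\<dots> \<le> 1 / \<delta> + (1 / \<delta>) * 1" using J \<delta> by (intro add_left_mono mult_left_mono) auto
  finally show ?thesis by simp
qed

text \<open>Averaging over t and -t turns the kernel into (1 + e) / ((1 + e)^2 - s^2), so the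
  previous lemma applies with \<delta> = (1 + e)^2. The bound is uniform in e; the limiting kernel 2
  / |x - t|^2 is twice the Newtonian kernel of R^4.\<close>

lemma integral_poisson_kernel_le:
  assumes x: "x \<in> S3" and e: "0 < e"
  shows "(\<integral>t. 1 / (1 + e - x \<bullet> t) \<partial>m_S3) \<le> 2"
proof -
  define k where "k s = 1 / (1 + e - s)" for s :: real
  have km: "k \<in> borel_measurable borel" unfolding k_def by measurable
  have mx: "- axis 1 1 \<in> S3" by (simp add: S3_def)
  have bd: "\<bar>s\<bar> \<le> 1" if "s\<^sup>2 \<le> 1" for s :: real using that by (simp add: abs_square_le_1)
  have i: "integrable m_S3 (\<lambda>t. k (t $ 1))" "integrable m_S3 (\<lambda>t. k (- (t $ 1)))"
  proof -
    have b: "\<bar>k s\<bar> \<le> 1 / e" if "s\<^sup>2 \<le> 1" for s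
      using bd[OF that] e by (auto simp: k_def intro!: frac_le)
    show "integrable m_S3 (\<lambda>t. k (t $ 1))"
      by (rule integrable_bounded_S3[where C="1/e"]) (use km b coord_square_le_1 in auto)
    show "integrable m_S3 (\<lambda>t. k (- (t $ 1)))"
      by (rule integrable_bounded_S3[where C="1/e"]) (use km b coord_square_le_1 in auto)
  qed
  have "(\<integral>t. k (- (t $ 1)) \<partial>m_S3) = (\<integral>t. k (t $ 1) \<partial>m_S3)"
    using integral_zonal[OF mx km] by (simp add: inner_axis inner_commute)
  then have "2 * (\<integral>t. k (t $ 1) \<partial>m_S3) = (\<integral>t. k (t $ 1) + k (- (t $ 1)) \<partial>m_S3)"
    using i by simp
  also have "\<dots> = (\<integral>t. 2 * (1 + e) * (1 / ((1 + e)\<^sup>2 - (t $ 1)\<^sup>2)) \<partial>m_S3)"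
  proof (rule Bochner_Integration.integral_cong[OF refl])
    fix t assume "t \<in> space m_S3"
    then have "\<bar>t $ 1\<bar> \<le> 1" using bd coord_square_le_1 space_m_S3 by blast
    then have p: "1 + e - t $ 1 > 0" "1 + e + t $ 1 > 0" using e by auto
    have "(1 + e)\<^sup>2 - (t $ 1)\<^sup>2 = (1 + e - t $ 1) * (1 + e + t $ 1)"
      by (simp add: power2_eq_square algebra_simps)
    then show "k (t $ 1) + k (- (t $ 1)) = 2 * (1 + e) * (1 / ((1 + e)\<^sup>2 - (t $ 1)\<^sup>2))"
      using p by (simp add: k_def add_divide_eq_if_simps field_simps)
  qed
  also have "\<dots> = 2 * (1 + e) * (\<integral>t. 1 / ((1 + e)\<^sup>2 - (t $ 1)\<^sup>2) \<partial>m_S3)"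
    by (rule integral_mult_right_zero)
  also have "\<dots> \<le> 2 * (1 + e) * (2 / (1 + e)\<^sup>2)"
    using e by (intro mult_left_mono integral_coord_kernel_le) auto
  also have "\<dots> = 4 / (1 + e)"
  proof -
    have *: "2 * a * (2 / a\<^sup>2) = 4 / a" if "a > 0" for a :: real
      using that by (simp add: power2_eq_square)
    show ?thesis by (rule *) (use e in simp)
  qed
  also have "\<dots> \<le> 4" using e by (simp add: field_simps)
  finally have "(\<integral>t. k (t $ 1) \<partial>m_S3) \<le> 2" by simp
  then show ?thesis using integral_zonal[OF x km] by (simp add: k_def)
qed

section \<open>Multiplication operators\<close>

definition bounded_fun_S3 :: "(real^4 \<Rightarrow> complex) \<Rightarrow> bool" where
  "bounded_fun_S3 f \<longleftrightarrow> f \<in> borel_measurable m_S3 \<and> (\<exists>C. \<forall>t\<in>S3. cmod (f t) \<le> C)"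

abbreviation bounded_real_S3 :: "(real^4 \<Rightarrow> real) \<Rightarrow> bool" where
  "bounded_real_S3 f \<equiv> bounded_fun_S3 (\<lambda>t. complex_of_real (f t))"

abbreviation coord :: "4 \<Rightarrow> real^4 \<Rightarrow> complex" where
  "coord i \<equiv> \<lambda>t. complex_of_real (t $ i)"

lemma bounded_fun_S3I: "f \<in> borel_measurable m_S3 \<Longrightarrow> (\<And>t. t \<in> S3 \<Longrightarrow> cmod (f t) \<le> C) \<Longrightarrow> bounded_fun_S3 f"
  by (auto simp: bounded_fun_S3_def)

lemma bounded_fun_continuous:
  assumes "continuous_on S3 f"
  shows "bounded_fun_S3 f"
proof -
  have "compact S3" by (simp add: S3_def)
  then have "bounded (f ` S3)" using assms compact_continuous_image compact_imp_bounded by blast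
  moreover have "f \<in> borel_measurable m_S3"
    using borel_measurable_continuous_on_restrict[OF assms]
      rotation_invariant_prob_S3_D(1)[OF rotation_invariant_m_S3] measurable_cong_sets by blast
  ultimately show ?thesis by (auto simp: bounded_fun_S3_def bounded_iff)
qed

lemma bounded_fun_const: "bounded_fun_S3 (\<lambda>t. a)"
  by (intro bounded_fun_continuous continuous_intros)

lemma bounded_fun_mult:
  assumes "bounded_fun_S3 f" "bounded_fun_S3 g"
  shows "bounded_fun_S3 (\<lambda>t. f t * g t)"
proof -
  obtain C where C: "\<And>t. t \<in> S3 \<Longrightarrow> cmod (f t) \<le> C" using assms by (auto simp: bounded_fun_S3_def)
  obtain D where D: "\<And>t. t \<in> S3 \<Longrightarrow> cmod (g t) \<le> D" using assms by (auto simp: bounded_fun_S3_def)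
  show ?thesis
  proof (rule bounded_fun_S3I)
    have "f \<in> borel_measurable m_S3" "g \<in> borel_measurable m_S3"
      using assms by (auto simp: bounded_fun_S3_def)
    then show "(\<lambda>t. f t * g t) \<in> borel_measurable m_S3" by measurable
    fix t assume "t \<in> S3"
    then show "cmod (f t * g t) \<le> C * D"
      unfolding norm_mult using C D by (intro mult_mono) (auto intro: order_trans[OF norm_ge_zero])
  qed
qed

lemma bounded_fun_add:
  assumes "bounded_fun_S3 f" "bounded_fun_S3 g"
  shows "bounded_fun_S3 (\<lambda>t. f t + g t)"
proof -
  obtain C where C: "\<And>t. t \<in> S3 \<Longrightarrow> cmod (f t) \<le> C" using assms by (auto simp: bounded_fun_S3_def)
  obtain D where D: "\<And>t. t \<in> S3 \<Longrightarrow> cmod (g t) \<le> D" using assms by (auto simp: bounded_fun_S3_def)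
  show ?thesis
  proof (rule bounded_fun_S3I)
    have "f \<in> borel_measurable m_S3" "g \<in> borel_measurable m_S3"
      using assms by (auto simp: bounded_fun_S3_def)
    then show "(\<lambda>t. f t + g t) \<in> borel_measurable m_S3" by measurable
    fix t assume "t \<in> S3"
    then show "cmod (f t + g t) \<le> C + D"
      using C D by (intro norm_triangle_mono)
  qed
qed

lemma bounded_fun_cnj:
  assumes "bounded_fun_S3 f"
  shows "bounded_fun_S3 (\<lambda>t. cnj (f t))"
proof -
  have "(\<lambda>t. cnj (f t)) \<in> borel_measurable m_S3"
    using assms unfolding bounded_fun_S3_def
    by (intro measurable_compose[of f m_S3 borel cnj] borel_measurable_continuous_onI continuous_intros) auto
  then show ?thesis using assms by (auto simp: bounded_fun_S3_def)
qed

lemma bounded_fun_diff: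
  assumes "bounded_fun_S3 f" "bounded_fun_S3 g"
  shows "bounded_fun_S3 (\<lambda>t. f t - g t)"
  using bounded_fun_add[OF assms(1) bounded_fun_mult[OF bounded_fun_const[of "-1"] assms(2)]] by simp

lemmas bounded_fun_intros = bounded_fun_const bounded_fun_mult bounded_fun_add bounded_fun_diff bounded_fun_cnj

lemma bounded_fun_coord: "bounded_fun_S3 (coord i)"
  by (intro bounded_fun_continuous continuous_intros)

lemma sqi_bounded_fun: "bounded_fun_S3 f \<Longrightarrow> square_integrable_S3 g \<Longrightarrow> square_integrable_S3 (\<lambda>t. f t * g t)"
  unfolding bounded_fun_S3_def by (auto intro: sqi_mult)

lemma bounded_fun_if: "bounded_fun_S3 (\<lambda>t. if bounded_fun_S3 f then f t else 0)"
  by (cases "bounded_fun_S3 f") (simp_all add: bounded_fun_const)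

text \<open>Multiplication by a function that is not bounded and measurable is 0 by convention.\<close>

lift_definition mult_fun :: "(real^4 \<Rightarrow> complex) \<Rightarrow> L2_S3 \<Rightarrow> L2_S3"
  is "\<lambda>f g t. (if bounded_fun_S3 f then f t else 0) * g t"
proof (elim conjE, intro conjI)
  fix f g g' :: "real^4 \<Rightarrow> complex"
  assume "AE x in m_S3. g x = g' x"
  then show "AE x in m_S3. (if bounded_fun_S3 f then f x else 0) * g x = (if bounded_fun_S3 f then f x else 0) * g' x"
    by eventually_elim simp
next
  fix f g :: "real^4 \<Rightarrow> complex"
  assume "square_integrable_S3 g"
  then show "square_integrable_S3 (\<lambda>x. (if bounded_fun_S3 f then f x else 0) * g x)"
    by (cases "bounded_fun_S3 f") (simp_all add: sqi_bounded_fun sqi_0)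
  then show "square_integrable_S3 (\<lambda>x. (if bounded_fun_S3 f then f x else 0) * g x)" .
qed

lemma mult_fun_abs:
  "bounded_fun_S3 f \<Longrightarrow> square_integrable_S3 g \<Longrightarrow> mult_fun f (abs_L2_S3 g) = abs_L2_S3 (\<lambda>t. f t * g t)"
  by (simp add: mult_fun.abs_eq)

lemma mult_fun_unbounded: "\<not> bounded_fun_S3 f \<Longrightarrow> mult_fun f = mult_fun (\<lambda>t. 0)"
  by (rule ext, transfer) (simp add: sqi_0)

lemma mult_fun_add: "mult_fun f (x + y) = mult_fun f x + mult_fun f y"
  by transfer (simp add: distrib_left sqi_add sqi_bounded_fun bounded_fun_if)

lemma mult_fun_scaleC: "mult_fun f (a *\<^sub>C x) = a *\<^sub>C mult_fun f x"
  by transfer (simp add: mult.left_commute sqi_cmult sqi_bounded_fun bounded_fun_if)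

lemma norm_mult_fun_le:
  assumes f: "bounded_fun_S3 f" and C: "\<And>t. t \<in> S3 \<Longrightarrow> cmod (f t) \<le> C" "0 \<le> C"
  shows "norm (mult_fun f x) \<le> norm x * C"
proof -
  obtain g where g: "x = abs_L2_S3 g" "square_integrable_S3 g" by (rule obtain_rep_L2)
  have i: "integrable m_S3 (\<lambda>t. (cmod (g t))\<^sup>2)" using g(2) by (simp only: square_integrable_S3_def)
  have "(norm (mult_fun f x))\<^sup>2 = (\<integral>t. (cmod (f t * g t))\<^sup>2 \<partial>m_S3)"
    using f g by (simp add: mult_fun_abs norm_abs_L2 sqi_bounded_fun)
  also have "\<dots> \<le> (\<integral>t. C\<^sup>2 * (cmod (g t))\<^sup>2 \<partial>m_S3)"
  proof (rule integral_mono)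
    show "integrable m_S3 (\<lambda>t. (cmod (f t * g t))\<^sup>2)"
      using sqi_bounded_fun[OF f g(2)] by (simp only: square_integrable_S3_def)
    show "integrable m_S3 (\<lambda>t. C\<^sup>2 * (cmod (g t))\<^sup>2)" using i by simp
    show "(cmod (f t * g t))\<^sup>2 \<le> C\<^sup>2 * (cmod (g t))\<^sup>2" if "t \<in> space m_S3" for t
      using that C unfolding norm_mult power_mult_distrib
      by (intro mult_right_mono power_mono) (auto simp: space_m_S3)
  qed
  also have "\<dots> = (norm x * C)\<^sup>2" by (simp add: g norm_abs_L2 power_mult_distrib mult.commute)
  finally show ?thesis by (rule power2_le_imp_le) (use C in simp)
qed

lemma bounded_linear_mult_fun: "bounded_linear (mult_fun f)"
proof -
  have "bounded_linear (mult_fun f)" if f: "bounded_fun_S3 f" for f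
  proof -
    obtain C where C: "\<And>t. t \<in> S3 \<Longrightarrow> cmod (f t) \<le> C" using f by (auto simp: bounded_fun_S3_def)
    have "0 \<le> C" using C[OF S3_nonempty] norm_ge_zero order_trans by blast
    with C show ?thesis
      by (intro bounded_linear_intro[where K=C] mult_fun_add norm_mult_fun_le f)
         (simp_all add: scaleR_scaleC mult_fun_scaleC)
  qed
  then show ?thesis
    using mult_fun_unbounded[of f] bounded_fun_const[of 0] by (cases "bounded_fun_S3 f") auto
qed

lift_definition mult_op :: "(real^4 \<Rightarrow> complex) \<Rightarrow> L2_S3 \<Rightarrow>\<^sub>L L2_S3" is mult_fun
  by (rule bounded_linear_mult_fun)

abbreviation mult_real :: "(real^4 \<Rightarrow> real) \<Rightarrow> L2_S3 \<Rightarrow>\<^sub>L L2_S3" where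
  "mult_real f \<equiv> mult_op (\<lambda>t. complex_of_real (f t))"

lemma mult_op_scaleC: "mult_op f (a *\<^sub>C x) = a *\<^sub>C mult_op f x"
  by (simp add: mult_op.rep_eq mult_fun_scaleC)

lemma mult_op_abs:
  "bounded_fun_S3 f \<Longrightarrow> square_integrable_S3 g \<Longrightarrow> mult_op f (abs_L2_S3 g) = abs_L2_S3 (\<lambda>t. f t * g t)"
  by (simp add: mult_op.rep_eq mult_fun_abs)

lemma mult_op_mult:
  assumes "bounded_fun_S3 f" "bounded_fun_S3 g"
  shows "mult_op (\<lambda>t. f t * g t) x = mult_op f (mult_op g x)"
proof -
  obtain h where h: "x = abs_L2_S3 h" "square_integrable_S3 h" by (rule obtain_rep_L2)
  show ?thesis using assms h by (simp add: mult_op_abs bounded_fun_mult sqi_bounded_fun mult.assoc)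
qed

lemma mult_op_add:
  assumes "bounded_fun_S3 f" "bounded_fun_S3 g"
  shows "mult_op (\<lambda>t. f t + g t) x = mult_op f x + mult_op g x"
proof -
  obtain h where h: "x = abs_L2_S3 h" "square_integrable_S3 h" by (rule obtain_rep_L2)
  show ?thesis using assms h
    by (simp add: mult_op_abs bounded_fun_add sqi_bounded_fun plus_L2_S3.abs_eq distrib_right)
qed

lemma mult_op_const: "mult_op (\<lambda>t. a) x = a *\<^sub>C x"
proof -
  obtain h where h: "x = abs_L2_S3 h" "square_integrable_S3 h" by (rule obtain_rep_L2)
  show ?thesis using h by (simp add: mult_op_abs bounded_fun_const scaleC_L2_S3.abs_eq)
qed

lemma mult_op_cmult:
  assumes "bounded_fun_S3 f"
  shows "mult_op (\<lambda>t. a * f t) x = a *\<^sub>C mult_op f x"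
  using mult_op_mult[OF bounded_fun_const assms, of a x] by (simp add: mult_op_const)

lemma mult_op_diff:
  assumes "bounded_fun_S3 f" "bounded_fun_S3 g"
  shows "mult_op (\<lambda>t. f t - g t) x = mult_op f x - mult_op g x"
  using mult_op_add[OF assms(1) bounded_fun_mult[OF bounded_fun_const assms(2)], of "-1" x]
    mult_op_cmult[OF assms(2), of "-1" x] by (simp add: scaleC_minus_one)

lemma mult_op_cong:
  assumes "bounded_fun_S3 f" "bounded_fun_S3 g" "\<And>t. t \<in> S3 \<Longrightarrow> f t = g t"
  shows "mult_op f = mult_op g"
proof (rule blinfun_eqI)
  fix x
  obtain h where h: "x = abs_L2_S3 h" "square_integrable_S3 h" by (rule obtain_rep_L2)
  have "AE t in m_S3. f t * h t = g t * h t"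
    by (rule AE_I2) (simp add: space_m_S3 assms(3))
  then have "abs_L2_S3 (\<lambda>t. f t * h t) = abs_L2_S3 (\<lambda>t. g t * h t)"
    using Quotient3_rel[OF Quotient3_L2_S3, of "\<lambda>t. f t * h t" "\<lambda>t. g t * h t"] assms h
    by (simp add: sqi_bounded_fun)
  then show "mult_op f x = mult_op g x" using assms h by (simp add: mult_op_abs)
qed

lemma cinner_mult_op:
  assumes "bounded_fun_S3 f"
  shows "cinner (mult_op f x) y = cinner x (mult_op (\<lambda>t. cnj (f t)) y)"
proof -
  obtain g where g: "x = abs_L2_S3 g" "square_integrable_S3 g" by (rule obtain_rep_L2)
  obtain h where h: "y = abs_L2_S3 h" "square_integrable_S3 h" by (rule obtain_rep_L2)
  show ?thesis using assms g h
    by (simp add: mult_op_abs bounded_fun_cnj sqi_bounded_fun cinner_L2_S3.abs_eq) (simp add: mult_ac)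
qed

lemma M_t_mult_op: "M_t i x = mult_op (coord i) x"
proof -
  obtain g where g: "x = abs_L2_S3 g" "square_integrable_S3 g" by (rule obtain_rep_L2)
  show ?thesis using g
    by (simp add: mult_op_abs bounded_fun_coord M_t.rep_eq mult_coord_S3.abs_eq)
qed

section \<open>Quadratic forms of multiplication operators\<close>

lemma cinner_mult_op_real:
  assumes "bounded_real_S3 f"
  shows "cinner (mult_real f x) y = cinner x (mult_real f y)"
  using cinner_mult_op[OF assms] by simp

lemma norm_mult_op_square:
  assumes "bounded_real_S3 f"
  shows "complex_of_real ((norm (mult_real f x))\<^sup>2)
    = cinner (mult_real (\<lambda>t. (f t)\<^sup>2) x) x"
  unfolding cinner_self[symmetric] cinner_mult_op_real[OF assms]
  using mult_op_mult[OF assms assms, of x] cinner_mult_op_real[OF assms, of "mult_real f x" x]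
  by (simp add: power2_eq_square cinner_mult_op_real[OF assms])

text \<open>The square root of a continuous nonnegative f is again continuous, hence a bounded
  multiplier, and f is its square on the sphere.\<close>

lemma mult_op_nonneg:
  assumes f: "continuous_on S3 f" and pos: "\<And>t. t \<in> S3 \<Longrightarrow> 0 \<le> f t"
  shows "cinner (mult_real f x) x
    = complex_of_real ((norm (mult_real (\<lambda>t. sqrt (f t)) x))\<^sup>2)"
proof -
  have b: "bounded_real_S3 (\<lambda>t. sqrt (f t))" "bounded_real_S3 f"
    "bounded_real_S3 (\<lambda>t. (sqrt (f t))\<^sup>2)"
    by (intro bounded_fun_continuous continuous_intros f)+
  have "mult_real f = mult_real (\<lambda>t. (sqrt (f t))\<^sup>2)"
    using pos by (intro mult_op_cong b) (simp del: of_real_power)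
  then show ?thesis using norm_mult_op_square[OF b(1), of x] by simp
qed

lemma mult_op_mono:
  assumes f: "continuous_on S3 f" and g: "continuous_on S3 g" and le: "\<And>t. t \<in> S3 \<Longrightarrow> f t \<le> g t"
  shows "Re (cinner (mult_real f x) x) \<le> Re (cinner (mult_real g x) x)"
proof -
  have c: "continuous_on S3 (\<lambda>t. g t - f t)" by (intro continuous_intros f g)
  have b: "bounded_real_S3 f" "bounded_real_S3 g"
    by (intro bounded_fun_continuous continuous_intros f g)+
  have "0 \<le> Re (cinner (mult_real (\<lambda>t. g t - f t) x) x)"
    using mult_op_nonneg[OF c, of x] le by (simp del: of_real_diff)
  moreover have "mult_real (\<lambda>t. g t - f t) x
      = mult_real g x - mult_real f x"
    using mult_op_diff[OF b(2,1)] by simp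
  ultimately show ?thesis by (simp add: cinner_simps)
qed

lemma P_S3_const: "P_S3 (const_S3 a) = a"
  using P_S3_integral[OF sqi_const, of a] by (simp add: const_S3.abs_eq sqi_const m_S3.prob_space)

lemma cinner_mult_op_const:
  assumes "bounded_fun_S3 f"
  shows "cinner (mult_op f (const_S3 1)) (const_S3 1) = (\<integral>t. f t \<partial>m_S3)"
  using assms by (simp add: const_S3.abs_eq sqi_const mult_op_abs cinner_L2_S3.abs_eq sqi_bounded_fun[OF assms sqi_const[of 1], simplified])

lemma norm_const_S3: "norm (const_S3 1) = 1"
proof -
  have "cinner (const_S3 1) (const_S3 1) = 1"
    using cinner_mult_op_const[OF bounded_fun_const, of 1] by (simp add: mult_op_const scaleC_one m_S3.prob_space)
  then have "complex_of_real ((norm (const_S3 1))\<^sup>2) = complex_of_real 1" by (simp only: cinner_self of_real_1)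
  then have "(norm (const_S3 1))\<^sup>2 = 1" by (simp only: of_real_eq_iff)
  then show ?thesis using norm_ge_zero[of "const_S3 1"] by (simp add: power2_eq_1_iff)
qed

text \<open>
  A Hardy inequality: the constants are controlled by the form of \<open>1 - \<langle>x, t\<rangle>\<close> because
  \<open>1 / (1 - \<langle>x, t\<rangle>)\<close> is integrable on the three-dimensional sphere.
\<close>

lemma hardy_S3:
  assumes x: "x \<in> S3"
  shows "(cmod (P_S3 g))\<^sup>2 \<le> 2 * Re (cinner (mult_real (\<lambda>t. 1 - x \<bullet> t) g) g)"
proof -
  let ?m = "\<lambda>f. mult_real f"
  define W where "W = Re (cinner (?m (\<lambda>t. 1 - x \<bullet> t) g) g)"
  have eps: "(cmod (P_S3 g))\<^sup>2 \<le> 2 * (W + e * (norm g)\<^sup>2)" if e: "0 < e" for e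
  proof -
    \<comment> \<open>The shift by e makes 1 / u bounded. Writing 1 = u^(-1/2) u^(1/2),
      Cauchy-Schwarz bounds |<g,1>|^2 by the form of u at g times the integral of 1 / u, which is at
      most 2 for every e.\<close>
    define u where "u t = 1 + e - x \<bullet> t" for t
    have pos: "0 < u t" if "t \<in> S3" for t
      using norm_cauchy_schwarz[of x t] x that e by (simp add: S3_def u_def)
    have uc: "continuous_on S3 u" unfolding u_def by (intro continuous_intros)
    have ne: "\<forall>t\<in>S3. u t \<noteq> 0" "\<forall>t\<in>S3. sqrt (u t) \<noteq> 0" using pos by force+
    have c: "continuous_on S3 (\<lambda>t. 1 / sqrt (u t))" "continuous_on S3 (\<lambda>t. sqrt (u t))" "continuous_on S3 (\<lambda>t. 1 / u t)"
      by (intro continuous_intros uc ne)+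
    have b: "bounded_real_S3 (\<lambda>t. 1 / sqrt (u t))" "bounded_real_S3 (\<lambda>t. sqrt (u t))"
      "bounded_real_S3 (\<lambda>t. 1 / u t)"
      by (intro bounded_fun_continuous continuous_on_of_real c)+
    have "?m (\<lambda>t. 1 / sqrt (u t)) (?m (\<lambda>t. sqrt (u t)) g) = mult_op (\<lambda>t. complex_of_real (1 / sqrt (u t)) * complex_of_real (sqrt (u t))) g"
      by (rule mult_op_mult[OF b(1,2), symmetric])
    also have "mult_op (\<lambda>t. complex_of_real (1 / sqrt (u t)) * complex_of_real (sqrt (u t))) = mult_op (\<lambda>t. 1)"
    proof (rule mult_op_cong)
      show "complex_of_real (1 / sqrt (u t)) * complex_of_real (sqrt (u t)) = 1" if "t \<in> S3" for t
        using pos[OF that] by simp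
    qed (intro bounded_fun_mult b bounded_fun_const)+
    finally have "?m (\<lambda>t. 1 / sqrt (u t)) (?m (\<lambda>t. sqrt (u t)) g) = g" by (simp add: mult_op_const scaleC_one)
    then have "P_S3 g = cinner (?m (\<lambda>t. sqrt (u t)) g) (?m (\<lambda>t. 1 / sqrt (u t)) (const_S3 1))"
      using cinner_mult_op_real[OF b(1), of "?m (\<lambda>t. sqrt (u t)) g" "const_S3 1"] by (simp add: P_S3.rep_eq)
    then have "cmod (P_S3 g) \<le> norm (?m (\<lambda>t. sqrt (u t)) g) * norm (?m (\<lambda>t. 1 / sqrt (u t)) (const_S3 1))"
      by (simp only: cmod_cinner_le)
    then have le: "(cmod (P_S3 g))\<^sup>2 \<le> (norm (?m (\<lambda>t. sqrt (u t)) g))\<^sup>2 * (norm (?m (\<lambda>t. 1 / sqrt (u t)) (const_S3 1)))\<^sup>2"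
      unfolding power_mult_distrib[symmetric] by (rule power_mono) simp
    have "complex_of_real ((norm (?m (\<lambda>t. sqrt (u t)) g))\<^sup>2) = cinner (?m u g) g"
      by (rule mult_op_nonneg[OF uc less_imp_le[OF pos], symmetric])
    also have "?m u g = ?m (\<lambda>t. 1 - x \<bullet> t) g + complex_of_real e *\<^sub>C g"
    proof -
      have "?m u g = mult_op (\<lambda>t. complex_of_real (1 - x \<bullet> t) + complex_of_real e) g"
        unfolding of_real_add[symmetric] by (simp add: u_def diff_add_eq)
      also have "\<dots> = ?m (\<lambda>t. 1 - x \<bullet> t) g + mult_op (\<lambda>t. complex_of_real e) g"
        by (intro mult_op_add bounded_fun_const bounded_fun_continuous continuous_intros)
      finally show ?thesis by (simp add: mult_op_const)
    qed
    finally have "Re (complex_of_real ((norm (?m (\<lambda>t. sqrt (u t)) g))\<^sup>2))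
        = Re (cinner (?m (\<lambda>t. 1 - x \<bullet> t) g + complex_of_real e *\<^sub>C g) g)"
      by (rule arg_cong)
    then have 1: "(norm (?m (\<lambda>t. sqrt (u t)) g))\<^sup>2 = W + e * (norm g)\<^sup>2"
      by (simp add: W_def cinner_simps cinner_self del: of_real_power of_real_diff)
    have "mult_real (\<lambda>t. (1 / sqrt (u t))\<^sup>2) = ?m (\<lambda>t. 1 / u t)"
    proof (rule mult_op_cong)
      show "bounded_real_S3 (\<lambda>t. (1 / sqrt (u t))\<^sup>2)"
        by (intro bounded_fun_continuous continuous_intros uc ne)
      have "(1 / sqrt (u t))\<^sup>2 = 1 / u t" if "t \<in> S3" for t
        using pos[OF that] by (simp add: power_divide)
      then show "complex_of_real ((1 / sqrt (u t))\<^sup>2) = complex_of_real (1 / u t)" if "t \<in> S3" for t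
        using that by simp
    qed (rule b)
    then have "complex_of_real ((norm (?m (\<lambda>t. 1 / sqrt (u t)) (const_S3 1)))\<^sup>2) = (\<integral>t. complex_of_real (1 / u t) \<partial>m_S3)"
      by (simp only: norm_mult_op_square[OF b(1)] cinner_mult_op_const[OF b(3)])
    also have "\<dots> = complex_of_real (\<integral>t. 1 / u t \<partial>m_S3)" by (rule integral_complex_of_real)
    finally have "(norm (?m (\<lambda>t. 1 / sqrt (u t)) (const_S3 1)))\<^sup>2 = (\<integral>t. 1 / u t \<partial>m_S3)"
      by (simp only: of_real_eq_iff)
    also have "\<dots> \<le> 2" unfolding u_def by (rule integral_poisson_kernel_le[OF x e])
    finally have 2: "(norm (?m (\<lambda>t. 1 / sqrt (u t)) (const_S3 1)))\<^sup>2 \<le> 2" .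
    show ?thesis
      using order_trans[OF le mult_left_mono[OF 2 zero_le_power2]] unfolding 1 by (simp only: mult.commute)
  qed
  have "(cmod (P_S3 g))\<^sup>2 \<le> 2 * W"
  proof (rule field_le_epsilon)
    fix d :: real assume d: "0 < d"
    \<comment> \<open>Chosen so that 2 e (|g|^2 + 1) = d; the summand 1 covers g = 0.\<close>
    define e where "e = d / (2 * ((norm g)\<^sup>2 + 1))"
    have n: "0 < (norm g)\<^sup>2 + 1" by (simp add: add_nonneg_pos)
    have "e > 0" using d n by (simp add: e_def)
    then have "(cmod (P_S3 g))\<^sup>2 \<le> 2 * W + 2 * e * (norm g)\<^sup>2" using eps[of e] by (simp add: algebra_simps)
    also have "2 * e * (norm g)\<^sup>2 \<le> 2 * e * ((norm g)\<^sup>2 + 1)" using \<open>e > 0\<close> by simp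
    also have "\<dots> = d"
    proof -
      have *: "2 * (d / (2 * s)) * s = d" if "0 < s" for s :: real using that by simp
      show ?thesis unfolding e_def by (rule *[OF n])
    qed
    finally show "(cmod (P_S3 g))\<^sup>2 \<le> 2 * W + d" by simp
  qed
  then show ?thesis by (simp add: W_def)
qed

section \<open>The generators\<close>

type_synonym L2C = "L2_S3 \<times> complex"

lift_definition mult_diag :: "(real^4 \<Rightarrow> complex) \<Rightarrow> L2C \<Rightarrow>\<^sub>L L2C" is "\<lambda>f v. (mult_op f (fst v), 0)"
  by (intro bounded_linear_Pair bounded_linear_zero
      bounded_linear_compose[OF blinfun.bounded_linear_right bounded_linear_fst])

abbreviation diag_real :: "(real^4 \<Rightarrow> real) \<Rightarrow> L2C \<Rightarrow>\<^sub>L L2C" where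
  "diag_real f \<equiv> mult_diag (\<lambda>t. complex_of_real (f t))"

abbreviation proj_L2 :: "L2C \<Rightarrow>\<^sub>L L2C" where
  "proj_L2 \<equiv> mult_diag (\<lambda>t. 1)"

lemma mult_diag_apply: "mult_diag f v = (mult_op f (fst v), 0)"
  by (simp add: mult_diag.rep_eq)

lemma clinear_mult_diag: "clinear_op (mult_diag f)"
  by (simp add: clinear_op_def mult_diag_apply scaleC_prod_def mult_op_scaleC scaleC_zero_right)

lemma mult_diag_mult: "bounded_fun_S3 f \<Longrightarrow> bounded_fun_S3 g \<Longrightarrow> mult_diag (\<lambda>t. f t * g t) = mult_diag f o\<^sub>L mult_diag g"
  by (rule blinfun_eqI) (simp add: mult_diag_apply mult_op_mult)

lemma mult_diag_add: "bounded_fun_S3 f \<Longrightarrow> bounded_fun_S3 g \<Longrightarrow> mult_diag (\<lambda>t. f t + g t) = mult_diag f + mult_diag g"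
  by (rule blinfun_eqI) (simp add: mult_diag_apply mult_op_add blinfun.add_left)

lemma mult_diag_diff: "bounded_fun_S3 f \<Longrightarrow> bounded_fun_S3 g \<Longrightarrow> mult_diag (\<lambda>t. f t - g t) = mult_diag f - mult_diag g"
  by (rule blinfun_eqI) (simp add: mult_diag_apply mult_op_diff blinfun.diff_left)

lemma mult_diag_cmult: "bounded_fun_S3 f \<Longrightarrow> mult_diag (\<lambda>t. a * f t) = a *\<^sub>C mult_diag f"
  by (rule blinfun_eqI)
    (simp add: mult_diag_apply mult_op_cmult scaleC_blinfun.rep_eq scaleC_prod_def scaleC_zero_right)

lemma cadjoint_mult_diag: "bounded_fun_S3 f \<Longrightarrow> cadjoint (mult_diag f) = mult_diag (\<lambda>t. cnj (f t))"
  by (rule cadjoint_eqI) (simp add: mult_diag_apply cinner_prod_def cinner_mult_op)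

lemma mult_diag_cong:
  "bounded_fun_S3 f \<Longrightarrow> bounded_fun_S3 g \<Longrightarrow> (\<And>t. t \<in> S3 \<Longrightarrow> f t = g t) \<Longrightarrow> mult_diag f = mult_diag g"
  by (rule blinfun_eqI) (simp add: mult_diag_apply mult_op_cong[of f g])

lemma norm_Mop_le:
  assumes "bounded_fun_S3 f" "\<And>t. t \<in> S3 \<Longrightarrow> cmod (f t) \<le> C" "0 \<le> C"
  shows "norm (mult_diag f) \<le> C"
proof (rule norm_blinfun_bound[OF assms(3)])
  fix v :: L2C
  have "norm (mult_diag f v) = norm (mult_op f (fst v))" by (simp add: mult_diag_apply norm_Pair)
  also have "\<dots> \<le> norm (fst v) * C"
    unfolding mult_op.rep_eq by (rule norm_mult_fun_le[OF assms])
  also have "\<dots> \<le> norm v * C"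
    using assms(3) norm_fst_le[of "fst v" "snd v"] by (intro mult_right_mono) auto
  finally show "norm (mult_diag f v) \<le> C * norm v" by (simp add: mult.commute)
qed

lemma const_S3_eq: "const_S3 a = a *\<^sub>C const_S3 1"
proof -
  have "const_S3 (a * b) = a *\<^sub>C const_S3 b" for b
    by transfer (simp add: sqi_const)
  from this[of 1] show ?thesis by simp
qed

lemma cinner_const_S3: "cinner (const_S3 a) g = a * cnj (P_S3 g)" "cinner g (const_S3 a) = cnj a * P_S3 g"
proof -
  show *: "cinner g (const_S3 a) = cnj a * P_S3 g" for a
    by (subst const_S3_eq) (simp add: cinner_scaleC_right P_S3.rep_eq)
  show "cinner (const_S3 a) g = a * cnj (P_S3 g)"
    by (subst cinner_commute) (simp add: *)
qed

lemma P_S3_scaleC: "P_S3 (a *\<^sub>C g) = a * P_S3 g"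
  by (simp add: P_S3.rep_eq cinner_scaleC_left)

lemma T_op_eq: "T_op i = mult_diag (coord i)"
  by (rule blinfun_eqI) (simp add: T_op.rep_eq mult_diag_apply M_t_mult_op)

lemma T1_tilde_apply:
  "T1_tilde c v = (mult_op (coord 1) (fst v) + (complex_of_real c * snd v) *\<^sub>C const_S3 1, 0)"
  using const_S3_eq[of "snd v"]
  by (simp add: T1_tilde.rep_eq M_t_mult_op cadjoint_P_S3 scaleR_scaleC scaleC_scaleC)

lift_definition T1_adj :: "real \<Rightarrow> L2C \<Rightarrow>\<^sub>L L2C"
  is "\<lambda>c v. (mult_op (coord 1) (fst v), complex_of_real c * P_S3 (fst v))"
  by (intro bounded_linear_Pair bounded_linear_mult_right[THEN bounded_linear_compose]
      bounded_linear_compose[OF blinfun.bounded_linear_right bounded_linear_fst])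

lemma cadjoint_T1: "cadjoint (T1_tilde c) = T1_adj c"
  by (rule cadjoint_eqI)
    (simp add: T1_tilde_apply T1_adj.rep_eq cinner_prod_def cinner_simps cinner_mult_op_real
      bounded_fun_coord cinner_const_S3 cinner_complex_def)

lemma T1_adj_apply:
  "cadjoint (T1_tilde c) v = (mult_op (coord 1) (fst v), complex_of_real c * P_S3 (fst v))"
  by (simp add: cadjoint_T1 T1_adj.rep_eq)

lemma clinear_T1: "clinear_op (T1_tilde c)"
  by (simp add: clinear_op_def T1_tilde_apply scaleC_prod_def mult_op_scaleC scaleC_zero_right
      scaleC_add_right scaleC_scaleC scaleC_complex_def mult_ac)

definition gens :: "real \<Rightarrow> (L2C \<Rightarrow>\<^sub>L L2C) set" where
  "gens c = {id_blinfun, T1_tilde c, cadjoint (T1_tilde c), T_op 2, T_op 3, T_op 4}"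

lemma S_sys_gens: "S_sys c = cspan (gens c)"
  by (simp add: S_sys_def gens_def)

lemma clinear_gens: "g \<in> gens c \<Longrightarrow> clinear_op g"
  by (auto simp: gens_def clinear_T1 clinear_op_id clinear_op_cadjoint T_op_eq clinear_mult_diag)

lemma cadjoint_T_op: "cadjoint (T_op i) = T_op i"
  by (simp add: T_op_eq cadjoint_mult_diag bounded_fun_coord)

lemma cadjoint_gens: "g \<in> gens c \<Longrightarrow> cadjoint g \<in> gens c"
  by (auto simp: gens_def cadjoint_id cadjoint_cadjoint clinear_T1 cadjoint_T_op)

lemma gens_Cstar: "gens c \<subseteq> Cstar (cspan (gens c))"
  using Cstar_superset cspan_superset by blast

abbreviation "CS c \<equiv> Cstar (cspan (gens c))"

interpretation sphere: unital_cstar "CS c" for c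
proof
  have "cspan (gens c) \<subseteq> {T. clinear_op T}"
    using cstar_subalgebra_clinear clinear_gens by (intro cspan_least) (auto simp: cstar_subalgebra_def)
  then show "cstar_subalgebra (CS c)" by (intro Cstar_cstar_subalgebra) auto
  show "id_blinfun \<in> CS c" using gens_Cstar by (auto simp: gens_def)
qed

section \<open>Point evaluations\<close>

text \<open>The vector is the normalised indicator of a ball around x, nonzero because balls have
  positive measure. It does not depend on f, so one sequence can serve all operators.\<close>

lemma localized_unit_vector:
  assumes x: "x \<in> S3" and r: "0 < r"
  shows "\<exists>e. norm e = 1 \<and> (\<forall>f C. bounded_fun_S3 f \<longrightarrow> 0 \<le> C \<longrightarrow>
    (\<forall>t\<in>S3. dist x t < r \<longrightarrow> cmod (f t) \<le> C) \<longrightarrow> norm (mult_op f e) \<le> C)"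
proof -
  define b where "b t = (indicator (ball x r) t :: complex)" for t
  have bm: "b \<in> borel_measurable m_S3" unfolding b_def by (intro borel_m_S3 borel_measurable_indicator) simp
  have bb: "bounded_fun_S3 b"
    by (rule bounded_fun_S3I[OF bm, where C=1]) (simp add: b_def indicator_def)
  define g where "g = mult_op b (const_S3 1)"
  have bg: "mult_op b g = g"
  proof -
    have "(\<lambda>t. b t * b t) = b" by (auto simp: b_def indicator_def)
    then show ?thesis using mult_op_mult[OF bb bb, of "const_S3 1"] by (simp add: g_def)
  qed
  have "g \<noteq> 0"
  proof
    assume "g = 0"
    then have "0 = cinner g (const_S3 1)" by simp
    also have "\<dots> = (\<integral>t. b t \<partial>m_S3)" unfolding g_def by (rule cinner_mult_op_const[OF bb])
    also have "\<dots> = (\<integral>t. complex_of_real (indicator (ball x r \<inter> S3) t) \<partial>m_S3)"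
      by (rule Bochner_Integration.integral_cong[OF refl]) (auto simp: b_def indicator_def space_m_S3)
    also have "\<dots> = complex_of_real (measure m_S3 (ball x r \<inter> S3))"
    proof -
      have "ball x r \<inter> S3 \<in> sets m_S3"
        unfolding rotation_invariant_prob_S3_D(1)[OF rotation_invariant_m_S3] by (auto simp: sets_restrict_space)
      then have "(\<integral>t. indicator (ball x r \<inter> S3) t \<partial>m_S3) = measure m_S3 (ball x r \<inter> S3)"
        by (simp add: space_m_S3 Int_absorb2 Int_assoc)
      then show ?thesis by (simp only: integral_complex_of_real)
    qed
    finally have "measure m_S3 (ball x r \<inter> S3) = 0" by simp
    then show False
      using rotation_invariant_ball_pos[OF rotation_invariant_m_S3 x r] by (simp add: m_S3.emeasure_eq_measure)
  qed
  define e where "e = (1 / norm g) *\<^sub>R g"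
  have e1: "norm e = 1" using \<open>g \<noteq> 0\<close> by (simp add: e_def)
  have be: "mult_op b e = e" by (simp add: e_def blinfun.scaleR_right bg)
  have "norm (mult_op f e) \<le> C"
    if f: "bounded_fun_S3 f" and C: "0 \<le> C" "\<forall>t\<in>S3. dist x t < r \<longrightarrow> cmod (f t) \<le> C" for f C
  proof -
    \<comment> \<open>The vector reproduces itself under b, so f may be cut off outside the ball;
      after that its bound by C holds on the whole sphere.\<close>
    have "mult_op f e = mult_op (\<lambda>t. f t * b t) e" using mult_op_mult[OF f bb, of e] be by simp
    also have "norm \<dots> \<le> norm e * C"
      unfolding mult_op.rep_eq by (rule norm_mult_fun_le[OF bounded_fun_mult[OF f bb] _ C(1)])
        (use C in \<open>auto simp: b_def indicator_def norm_mult\<close>)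
    finally show ?thesis by (simp add: e1)
  qed
  then show ?thesis using e1 by blast
qed

text \<open>One fixed choice for each point and each radius 1 / (n + 1). No regularity in x comes
  with the choice, which is why measurability of symbols is proved separately.\<close>

definition peak :: "real^4 \<Rightarrow> nat \<Rightarrow> L2_S3" where
  "peak x n = (SOME e. norm e = 1 \<and> (\<forall>f C. bounded_fun_S3 f \<longrightarrow> 0 \<le> C \<longrightarrow>
    (\<forall>t\<in>S3. dist x t < 1 / real (Suc n) \<longrightarrow> cmod (f t) \<le> C) \<longrightarrow> norm (mult_op f e) \<le> C))"

lemma peak:
  assumes "x \<in> S3"
  shows norm_peak: "norm (peak x n) = 1"
    and mult_peak: "bounded_fun_S3 f \<Longrightarrow> 0 \<le> C \<Longrightarrow>
      (\<And>t. t \<in> S3 \<Longrightarrow> dist x t < 1 / real (Suc n) \<Longrightarrow> cmod (f t) \<le> C) \<Longrightarrow> norm (mult_op f (peak x n)) \<le> C"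
  using someI_ex[OF localized_unit_vector[OF assms, of "1 / real (Suc n)"]]
  unfolding peak_def by auto

lemma lim_inverse_Suc: "(\<lambda>n. 1 / real (Suc n)) \<longlonglongrightarrow> 0"
  by (rule LIMSEQ_Suc[OF lim_inverse_n'])

text \<open>The form of 1 - <x,t> at the n-th vector is at most 1 / (n + 1), and
  \<open>hardy_S3\<close> bounds the mean by it. The coupling to the constants thus disappears in
  the limit.\<close>

lemma P_peak:
  assumes x: "x \<in> S3"
  shows "(\<lambda>n. P_S3 (peak x n)) \<longlonglongrightarrow> 0"
proof -
  have b: "bounded_real_S3 (\<lambda>t. 1 - x \<bullet> t)"
    by (intro bounded_fun_continuous continuous_intros)
  have "(cmod (P_S3 (peak x n)))\<^sup>2 \<le> 2 * (1 / real (Suc n))" for n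
  proof -
    have "norm (mult_real (\<lambda>t. 1 - x \<bullet> t) (peak x n)) \<le> 1 / real (Suc n)"
    proof (rule mult_peak[OF x b])
      fix t assume t: "dist x t < 1 / real (Suc n)"
      have "1 - x \<bullet> t = x \<bullet> (x - t)" using x by (simp add: inner_diff_right S3_def norm_eq_1)
      also have "\<bar>\<dots>\<bar> \<le> norm x * norm (x - t)" by (rule Cauchy_Schwarz_ineq2)
      finally show "cmod (complex_of_real (1 - x \<bullet> t)) \<le> 1 / real (Suc n)"
        using x t by (simp add: S3_def dist_norm del: of_real_diff)
    qed simp
    then have "cmod (cinner (mult_real (\<lambda>t. 1 - x \<bullet> t) (peak x n)) (peak x n)) \<le> 1 / real (Suc n)"
      using cmod_cinner_le[of "mult_real (\<lambda>t. 1 - x \<bullet> t) (peak x n)" "peak x n"]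
      by (simp add: norm_peak[OF x])
    then have "Re (cinner (mult_real (\<lambda>t. 1 - x \<bullet> t) (peak x n)) (peak x n)) \<le> 1 / real (Suc n)"
      using complex_Re_le_cmod order_trans by blast
    then show ?thesis using hardy_S3[OF x, of "peak x n"] by linarith
  qed
  note le = this
  have lim: "(\<lambda>n. 2 * (1 / real (Suc n))) \<longlonglongrightarrow> 0"
    by (rule tendsto_mult_right_zero[OF lim_inverse_Suc])
  have "(\<lambda>n. (cmod (P_S3 (peak x n)))\<^sup>2) \<longlonglongrightarrow> 0"
    by (rule Lim_null_comparison[OF always_eventually lim]) (use le in simp)
  then have "(\<lambda>n. sqrt ((cmod (P_S3 (peak x n)))\<^sup>2)) \<longlonglongrightarrow> sqrt 0" by (rule tendsto_real_sqrt)
  then show ?thesis by (simp add: tendsto_norm_zero_iff)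
qed

text \<open>The peaks are approximate eigenvectors with eigenvalue z. Convergence of the
  expectations alone would not be compatible with products.\<close>

definition symbol_at :: "real^4 \<Rightarrow> (L2C \<Rightarrow>\<^sub>L L2C) \<Rightarrow> complex \<Rightarrow> bool" where
  "symbol_at x a z \<longleftrightarrow> (\<lambda>n. a (peak x n, 0) - z *\<^sub>C (peak x n, 0)) \<longlonglongrightarrow> 0"

text \<open>A total function, meaningful where \<open>symbol_at\<close> holds for some value, which
  it then returns.\<close>

definition symbol :: "(L2C \<Rightarrow>\<^sub>L L2C) \<Rightarrow> real^4 \<Rightarrow> complex" where
  "symbol a x = lim (\<lambda>n. cinner (a (peak x n, 0)) (peak x n, 0))"

lemma cinner_peak_pair: "x \<in> S3 \<Longrightarrow> cinner (peak x n, 0::complex) (peak x n, 0) = 1"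
  by (simp add: cinner_self norm_peak)

lemma symbol_at_cinner:
  assumes x: "x \<in> S3" and a: "symbol_at x a z"
  shows "(\<lambda>n. cinner (a (peak x n, 0)) (peak x n, 0)) \<longlonglongrightarrow> z"
proof -
  let ?v = "\<lambda>n. (peak x n, 0::complex)"
  have lim: "(\<lambda>n. norm (a (?v n) - z *\<^sub>C ?v n)) \<longlonglongrightarrow> 0"
    using a unfolding symbol_at_def by (rule tendsto_norm_zero)
  have le: "norm (cinner (a (?v n)) (?v n) - z) \<le> norm (a (?v n) - z *\<^sub>C ?v n)" for n
    using cmod_cinner_le[of "a (?v n) - z *\<^sub>C ?v n" "?v n"]
    by (simp add: cinner_diff_left cinner_scaleC_left cinner_peak_pair[OF x] norm_peak[OF x])
  have "(\<lambda>n. cinner (a (?v n)) (?v n) - z) \<longlonglongrightarrow> 0"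
    by (rule Lim_null_comparison[OF always_eventually lim]) (simp add: le)
  then show ?thesis by (simp add: LIM_zero_iff)
qed

lemma symbol_eqI: "x \<in> S3 \<Longrightarrow> symbol_at x a z \<Longrightarrow> symbol a x = z"
  unfolding symbol_def by (rule limI) (rule symbol_at_cinner)

lemma symbol_at_add: "symbol_at x a z \<Longrightarrow> symbol_at x b w \<Longrightarrow> symbol_at x (a + b) (z + w)"
  unfolding symbol_at_def by (drule (1) tendsto_add) (simp add: blinfun.add_left scaleC_add_left algebra_simps)

lemma symbol_at_scaleC: "symbol_at x a z \<Longrightarrow> symbol_at x (w *\<^sub>C a) (w * z)"
  unfolding symbol_at_def
  by (drule tendsto_scaleC[where a=w]) (simp add: scaleC_blinfun.rep_eq scaleC_diff_right scaleC_scaleC scaleC_zero_right)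

lemma symbol_at_compose:
  assumes "clinear_op a" "symbol_at x a z" "symbol_at x b w"
  shows "symbol_at x (a o\<^sub>L b) (z * w)"
proof -
  let ?v = "\<lambda>n. (peak x n, 0::complex)"
  have "(\<lambda>n. a (b (?v n) - w *\<^sub>C ?v n) + w *\<^sub>C (a (?v n) - z *\<^sub>C ?v n)) \<longlonglongrightarrow> a 0 + w *\<^sub>C 0"
    using assms(2,3) unfolding symbol_at_def by (intro tendsto_add tendsto_scaleC tendsto_intros)
  moreover have "a (b (?v n) - w *\<^sub>C ?v n) + w *\<^sub>C (a (?v n) - z *\<^sub>C ?v n) = (a o\<^sub>L b) (?v n) - (z * w) *\<^sub>C ?v n" for n
    by (simp add: blinfun.diff_right clinear_opD[OF assms(1)] scaleC_diff_right scaleC_scaleC mult.commute)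
  ultimately show ?thesis unfolding symbol_at_def by (simp add: scaleC_zero_right)
qed

lemma symbol_at_norm_le:
  assumes x: "x \<in> S3" and a: "symbol_at x a z"
  shows "cmod z \<le> norm a"
proof (rule LIMSEQ_le_const2[OF tendsto_norm[OF symbol_at_cinner[OF x a]]])
  have "norm (cinner (a (peak x n, 0)) (peak x n, 0)) \<le> norm a" for n
    using order_trans[OF cmod_cinner_le[of "a (peak x n, 0)" "(peak x n, 0)"] mult_right_mono[OF norm_blinfun norm_ge_zero]]
    by (simp add: norm_peak[OF x])
  then show "\<exists>N. \<forall>n\<ge>N. norm (cinner (a (peak x n, 0)) (peak x n, 0)) \<le> norm a" by blast
qed

lemma symbol_at_diff: "symbol_at x a z \<Longrightarrow> symbol_at x b w \<Longrightarrow> symbol_at x (a - b) (z - w)"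
  using symbol_at_add[OF _ symbol_at_scaleC[of x b w "-1"], of a z] by (simp add: scaleC_minus_one)

text \<open>Symbols are bounded by the operator norm, so those of a convergent sequence are Cauchy;
  an epsilon/3 argument passes the eigenvector property to the limit.\<close>

lemma symbol_at_limit:
  assumes x: "x \<in> S3" and f: "\<And>k. symbol_at x (f k) (z k)" and l: "f \<longlonglongrightarrow> a"
  shows "\<exists>w. z \<longlonglongrightarrow> w \<and> symbol_at x a w"
proof -
  let ?v = "\<lambda>n. (peak x n, 0::complex)"
  have "Cauchy z"
  proof (rule metric_CauchyI)
    fix e :: real assume "e > 0"
    then obtain M where M: "\<And>m n. m \<ge> M \<Longrightarrow> n \<ge> M \<Longrightarrow> dist (f m) (f n) < e"
      using metric_CauchyD[OF LIMSEQ_imp_Cauchy[OF l]] by blast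
    have "dist (z m) (z n) \<le> dist (f m) (f n)" for m n
      unfolding dist_norm by (rule symbol_at_norm_le[OF x symbol_at_diff[OF f f]])
    then show "\<exists>M. \<forall>m\<ge>M. \<forall>n\<ge>M. dist (z m) (z n) < e" using M le_less_trans by blast
  qed
  then obtain w where w: "z \<longlonglongrightarrow> w" using Cauchy_convergent convergent_def by blast
  have "symbol_at x a w"
    unfolding symbol_at_def
  proof (rule LIMSEQ_I)
    fix e :: real assume e: "0 < e"
    have "\<forall>\<^sub>F k in sequentially. dist (f k) a < e / 3 \<and> dist (z k) w < e / 3"
      using tendstoD[OF l, of "e/3"] tendstoD[OF w, of "e/3"] e by (simp add: eventually_conj)
    then obtain k where k: "norm (a - f k) < e / 3" "cmod (z k - w) < e / 3"
      by (auto simp: eventually_sequentially dist_norm norm_minus_commute)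
    obtain N where N: "\<And>n. n \<ge> N \<Longrightarrow> norm (f k (?v n) - z k *\<^sub>C ?v n) < e / 3"
      using LIMSEQ_D[OF f[of k, unfolded symbol_at_def], of "e/3"] e by auto
    have "norm (a (?v n) - w *\<^sub>C ?v n - 0) < e" if "n \<ge> N" for n
    proof -
      have eq: "a (?v n) - w *\<^sub>C ?v n = (a - f k) (?v n) + (f k (?v n) - z k *\<^sub>C ?v n) + (z k - w) *\<^sub>C ?v n"
        unfolding blinfun.diff_left scaleC_diff_left by (simp add: algebra_simps)
      have "norm ((a - f k) (?v n)) \<le> norm (a - f k)"
        using norm_blinfun[of "a - f k" "?v n"] by (simp add: norm_peak[OF x])
      moreover have "norm ((z k - w) *\<^sub>C ?v n) = cmod (z k - w)"
        unfolding norm_scaleC by (simp add: norm_peak[OF x])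
      ultimately show ?thesis
        unfolding diff_0_right eq
        using norm_triangle_ineq[of "(a - f k) (?v n) + (f k (?v n) - z k *\<^sub>C ?v n)" "(z k - w) *\<^sub>C ?v n"]
          norm_triangle_ineq[of "(a - f k) (?v n)" "f k (?v n) - z k *\<^sub>C ?v n"] k N[OF that] by linarith
    qed
    then show "\<exists>N. \<forall>n\<ge>N. norm (a (?v n) - w *\<^sub>C ?v n - 0) < e" by blast
  qed
  then show ?thesis using w by blast
qed

lemma mult_coord_peak:
  assumes x: "x \<in> S3"
  shows "(\<lambda>n. mult_op (coord i) (peak x n) - complex_of_real (x $ i) *\<^sub>C peak x n) \<longlonglongrightarrow> 0"
proof -
  let ?f = "\<lambda>t::real^4. complex_of_real (t $ i) - complex_of_real (x $ i)"
  have b: "bounded_fun_S3 ?f" by (intro bounded_fun_diff bounded_fun_coord bounded_fun_const)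
  have "norm (mult_op ?f (peak x n)) \<le> 1 / real (Suc n)" for n
  proof (rule mult_peak[OF x b])
    fix t assume t: "dist x t < 1 / real (Suc n)"
    have "cmod (?f t) = \<bar>(x - t) $ i\<bar>" by (simp flip: of_real_diff add: abs_minus_commute)
    also have "\<dots> \<le> norm (x - t)" by (rule component_le_norm_cart)
    finally show "cmod (?f t) \<le> 1 / real (Suc n)" using t by (simp add: dist_norm)
  qed simp
  then have "(\<lambda>n. mult_op ?f (peak x n)) \<longlonglongrightarrow> 0"
    by (rule Lim_null_comparison[OF always_eventually[OF allI] lim_inverse_Suc])
  then show ?thesis
    by (simp add: mult_op_diff bounded_fun_coord bounded_fun_const mult_op_const)
qed

lemma symbol_at_T_op:
  assumes x: "x \<in> S3"
  shows "symbol_at x (T_op i) (complex_of_real (x $ i))"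
  using tendsto_Pair[OF mult_coord_peak[OF x, of i] tendsto_const[of 0]]
  by (simp add: symbol_at_def T_op_eq mult_diag_apply scaleC_prod_def scaleC_zero_right zero_prod_def)

lemma symbol_at_T1:
  assumes x: "x \<in> S3"
  shows "symbol_at x (T1_tilde c) (complex_of_real (x $ 1))"
  using tendsto_Pair[OF mult_coord_peak[OF x, of 1] tendsto_const[of 0]]
  by (simp add: symbol_at_def T1_tilde_apply scaleC_prod_def scaleC_zero_right scaleC_zero_left zero_prod_def)

text \<open>The adjoint sends a peak into the second summand with entry c times its mean, and
  \<open>P_peak\<close> makes this vanish. For \<open>T1_tilde\<close> itself there is nothing to
  estimate, as peaks have second entry 0.\<close>

lemma symbol_at_T1_adj:
  assumes x: "x \<in> S3"
  shows "symbol_at x (cadjoint (T1_tilde c)) (complex_of_real (x $ 1))"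
  using tendsto_Pair[OF mult_coord_peak[OF x, of 1] tendsto_mult_right_zero[OF P_peak[OF x], of "complex_of_real c"]]
  by (simp add: symbol_at_def T1_adj_apply scaleC_prod_def scaleC_zero_right zero_prod_def)

lemma symbol_at_id: "symbol_at x id_blinfun 1"
  by (simp add: symbol_at_def scaleC_one)

lemma symbol_at_gens:
  assumes "x \<in> S3" "g \<in> gens c"
  shows "\<exists>z. symbol_at x g z"
  using assms symbol_at_T_op symbol_at_T1 symbol_at_T1_adj symbol_at_id unfolding gens_def by blast

lemma symbol_at_Cstar:
  assumes a: "a \<in> CS c" and x: "x \<in> S3"
  shows "symbol_at x a (symbol a x)"
proof -
  have "\<exists>z. symbol_at x a z"
    using a
  proof (rule Cstar_cspan_induct[OF _ clinear_gens cadjoint_gens])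
    show "\<exists>z. symbol_at x g z" if "g \<in> gens c" for g using symbol_at_gens[OF x that] .
    show "\<exists>z. symbol_at x 0 z" using symbol_at_scaleC[OF symbol_at_id, of x 0] by (auto simp: scaleC_zero_left)
  qed (auto intro: symbol_at_add symbol_at_scaleC symbol_at_compose sphere.clinear, metis symbol_at_limit[OF x])
  then show ?thesis using symbol_eqI[OF x] by blast
qed

text \<open>Symbols of generators are coordinates or the constant 1; sums, multiples, products and
  pointwise limits stay measurable. The vectors \<open>peak x n\<close> themselves are never
  considered as functions of x.\<close>

lemma symbol_measurable:
  assumes a: "a \<in> CS c"
  shows "symbol a \<in> borel_measurable m_S3"
  using a
proof (rule Cstar_cspan_induct[OF _ clinear_gens cadjoint_gens])
  note cong = measurable_cong[of m_S3, THEN iffD2]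
  show "symbol g \<in> borel_measurable m_S3" if g: "g \<in> gens c" for g
  proof -
    have *: "symbol g \<in> borel_measurable m_S3"
      if "h \<in> borel_measurable m_S3" "\<And>x. x \<in> S3 \<Longrightarrow> symbol_at x g (h x)" for g h
      using that by (intro cong[OF _ that(1)]) (auto simp: space_m_S3 intro: symbol_eqI)
    from g consider i where "g = T_op i" | "g = T1_tilde c" | "g = cadjoint (T1_tilde c)" | "g = id_blinfun"
      by (auto simp: gens_def)
    then show ?thesis
      by cases (auto intro: *[OF coord_measurable symbol_at_T_op] *[OF coord_measurable symbol_at_T1]
          *[OF coord_measurable symbol_at_T1_adj] *[OF borel_measurable_const symbol_at_id])
  qed
  show "symbol 0 \<in> borel_measurable m_S3"
    by (rule cong[OF _ borel_measurable_const[of 0]])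
      (auto simp: space_m_S3 symbol_at_def scaleC_zero_left intro!: symbol_eqI)
  fix a assume a: "a \<in> CS c" "symbol a \<in> borel_measurable m_S3"
  note sa = symbol_at_Cstar[OF a(1)]
  show "symbol (z *\<^sub>C a) \<in> borel_measurable m_S3" for z
  proof (rule cong)
    show "symbol (z *\<^sub>C a) x = z * symbol a x" if "x \<in> space m_S3" for x
      using that by (simp add: space_m_S3 symbol_eqI symbol_at_scaleC sa)
    show "(\<lambda>x. z * symbol a x) \<in> borel_measurable m_S3" using a(2) by measurable
  qed
  fix b assume b: "b \<in> CS c" "symbol b \<in> borel_measurable m_S3"
  note sb = symbol_at_Cstar[OF b(1)]
  show "symbol (a + b) \<in> borel_measurable m_S3"
  proof (rule cong)
    show "symbol (a + b) x = symbol a x + symbol b x" if "x \<in> space m_S3" for x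
      using that by (simp add: space_m_S3 symbol_eqI symbol_at_add sa sb)
    show "(\<lambda>x. symbol a x + symbol b x) \<in> borel_measurable m_S3" using a(2) b(2) by measurable
  qed
  show "symbol (a o\<^sub>L b) \<in> borel_measurable m_S3"
  proof (rule cong)
    show "symbol (a o\<^sub>L b) x = symbol a x * symbol b x" if "x \<in> space m_S3" for x
      using that by (simp add: space_m_S3 symbol_eqI symbol_at_compose sa sb sphere.clinear[OF a(1)])
    show "(\<lambda>x. symbol a x * symbol b x) \<in> borel_measurable m_S3" using a(2) b(2) by measurable
  qed
next
  fix f :: "nat \<Rightarrow> _" and a
  assume f: "\<And>n. f n \<in> CS c" "\<And>n. symbol (f n) \<in> borel_measurable m_S3" "f \<longlonglongrightarrow> a"
  show "symbol a \<in> borel_measurable m_S3"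
  proof (rule borel_measurable_LIMSEQ_metric[OF f(2)])
    fix x assume "x \<in> space m_S3"
    then have x: "x \<in> S3" by (simp add: space_m_S3)
    show "(\<lambda>n. symbol (f n) x) \<longlonglongrightarrow> symbol a x"
      using symbol_at_limit[OF x symbol_at_Cstar[OF f(1) x] f(3)] symbol_eqI[OF x] by auto
  qed
qed

lemma bounded_symbol:
  assumes a: "a \<in> CS c"
  shows "bounded_fun_S3 (symbol a)"
  using symbol_at_norm_le[OF _ symbol_at_Cstar[OF a]] symbol_measurable[OF a] by (intro bounded_fun_S3I[where C="norm a"])

lemma symbol_cadjoint:
  assumes a: "a \<in> CS c" and x: "x \<in> S3"
  shows "symbol (cadjoint a) x = cnj (symbol a x)"
proof -
  let ?v = "\<lambda>n. (peak x n, 0::complex)"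
  have "(\<lambda>n. cnj (cinner (a (?v n)) (?v n))) \<longlonglongrightarrow> cnj (symbol a x)"
    by (intro tendsto_cnj symbol_at_cinner[OF x] symbol_at_Cstar[OF a x])
  moreover have "cnj (cinner (a (?v n)) (?v n)) = cinner (cadjoint a (?v n)) (?v n)" for n
    by (simp add: cinner_cadjoint'[OF sphere.clinear[OF a]] flip: cinner_commute)
  ultimately have "(\<lambda>n. cinner (cadjoint a (?v n)) (?v n)) \<longlonglongrightarrow> cnj (symbol a x)" by simp
  then show ?thesis unfolding symbol_def by (rule limI)
qed

section \<open>Failure of hyperrigidity\<close>

lemma mult_diag_id_apply: "proj_L2 v = (fst v, 0)"
  by (simp add: mult_diag_apply mult_op_const scaleC_one)

definition L2_summand :: "L2C set" where
  "L2_summand = {v. snd v = 0}"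

lemma mult_diag_bops: "mult_diag f \<in> bops_on L2_summand"
proof -
  have "fst v = 0" if "\<forall>y\<in>L2_summand. cinner v y = 0" for v :: L2C
    using that[unfolded L2_summand_def, THEN bspec, of "(fst v, 0)"] by (simp add: cinner_prod_def cinner_self)
  then have "mult_diag f v = 0" if "\<forall>y\<in>L2_summand. cinner v y = 0" for v
    using that by (simp add: mult_diag_apply blinfun.zero_right zero_prod_def)
  then show ?thesis
    unfolding bops_on_def by (simp add: clinear_mult_diag L2_summand_def mult_diag_apply del: split_paired_All)
qed

lemma closed_L2_summand: "closed_csubspace L2_summand"
proof -
  have "closed {v :: L2C. snd v = 0}" by (intro closed_Collect_eq continuous_intros)
  then show ?thesis
    by (auto simp: closed_csubspace_def csubspace_def L2_summand_def scaleC_prod_def scaleC_zero_right)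
qed

lemma representation_symbol: "representation (CS c) L2_summand (\<lambda>a. mult_diag (symbol a))"
proof -
  let ?A = "CS c"
  note b = bounded_symbol
  note s = symbol_at_Cstar
  have 1: "mult_diag (symbol (a + b)) = mult_diag (symbol a) + mult_diag (symbol b)" if "a \<in> ?A" "b \<in> ?A" for a b
    unfolding mult_diag_add[OF b[OF that(1)] b[OF that(2)], symmetric]
    by (rule mult_diag_cong) (auto intro!: symbol_eqI symbol_at_add s b bounded_fun_add sphere.add that)
  have 2: "mult_diag (symbol (z *\<^sub>C a)) = z *\<^sub>C mult_diag (symbol a)" if "a \<in> ?A" for a z
    unfolding mult_diag_cmult[OF b[OF that(1)], symmetric]
    by (rule mult_diag_cong) (auto intro!: symbol_eqI symbol_at_scaleC s b bounded_fun_intros sphere.scaleC that)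
  have 3: "mult_diag (symbol (a o\<^sub>L b)) = mult_diag (symbol a) o\<^sub>L mult_diag (symbol b)" if "a \<in> ?A" "b \<in> ?A" for a b
    unfolding mult_diag_mult[OF b[OF that(1)] b[OF that(2)], symmetric]
    by (rule mult_diag_cong) (auto intro!: symbol_eqI symbol_at_compose s b bounded_fun_mult sphere.compose sphere.clinear that)
  have 4: "mult_diag (symbol (cadjoint a)) = cadjoint (mult_diag (symbol a))" if "a \<in> ?A" for a
    unfolding cadjoint_mult_diag[OF b[OF that(1)]]
    by (rule mult_diag_cong) (auto intro!: symbol_cadjoint b bounded_fun_cnj sphere.adj that)
  have 5: "mult_diag (symbol id_blinfun) v = v" if "v \<in> L2_summand" for v
  proof -
    have "mult_diag (symbol id_blinfun) = proj_L2"
      by (rule mult_diag_cong) (auto intro!: symbol_eqI symbol_at_id b[OF sphere.one] bounded_fun_const)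
    then show ?thesis using that by (simp add: mult_diag_id_apply L2_summand_def prod_eq_iff)
  qed
  show ?thesis
    unfolding representation_def unital_clinear_map_def
    using 1 2 3 4 5 mult_diag_bops closed_L2_summand by blast
qed

text \<open>The projection is self-adjoint, so positivity is tested on the projected vectors; it is
  the identity on \<open>L2_summand\<close>, so the map is unital there.\<close>

lemma ucp_compression:
  "ucp (CS c) L2_summand (\<lambda>a. proj_L2 o\<^sub>L a o\<^sub>L proj_L2)"
  (is "ucp ?A _ ?\<phi>")
proof -
  let ?E = "proj_L2"
  have E: "cinner (?E u) v = cinner u (?E v)" for u v :: L2C
    by (simp add: mult_diag_id_apply cinner_prod_def)
  have bops: "?\<phi> a \<in> bops_on L2_summand" if "a \<in> ?A" for a
  proof -
    have "clinear_op (?\<phi> a)" by (intro clinear_op_compose clinear_mult_diag sphere.clinear[OF that])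
    then show ?thesis
      using mult_diag_bops[of "\<lambda>t. 1"] by (simp add: bops_on_def blinfun.zero_right del: split_paired_All)
  qed
  have "completely_positive ?A ?\<phi>"
    unfolding completely_positive_def positive_op_matrix_def
  proof (intro allI impI, elim conjE)
    fix n :: nat and m :: "nat \<Rightarrow> nat \<Rightarrow> L2C \<Rightarrow>\<^sub>L L2C" and x :: "nat \<Rightarrow> L2C"
    assume "\<forall>x. (\<Sum>i<n. \<Sum>j<n. cinner (m i j (x j)) (x i)) \<in> \<real>\<^sub>\<ge>\<^sub>0"
    from this[rule_format, of "\<lambda>i. ?E (x i)"]
    show "(\<Sum>i<n. \<Sum>j<n. cinner (?\<phi> (m i j) (x j)) (x i)) \<in> \<real>\<^sub>\<ge>\<^sub>0" by (simp add: E)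
  qed
  then show ?thesis
    unfolding ucp_def unital_clinear_map_def
    using bops clinear_mult_diag[of "\<lambda>t. 1"]
    by (auto intro!: blinfun_eqI simp: blinfun.add_left blinfun.add_right scaleC_blinfun.rep_eq clinear_op_def
        mult_diag_id_apply L2_summand_def prod_eq_iff scaleC_prod_def scaleC_zero_right)
qed

lemma not_hyperrigid_S_sys:
  assumes c: "c \<noteq> 0"
  shows "\<not> hyperrigid TYPE(L2C) (S_sys c)"
proof
  let ?A = "CS c" and ?E = "proj_L2"
  let ?\<phi> = "\<lambda>a. ?E o\<^sub>L a o\<^sub>L ?E" and ?\<pi> = "\<lambda>a. mult_diag (symbol a)"
  let ?t = "\<lambda>i t. complex_of_real ((t::real^4) $ i)"
  assume "hyperrigid TYPE(L2C) (S_sys c)"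
  then have uep: "unique_extension_property (cspan (gens c)) L2_summand ?\<pi>"
    using representation_symbol by (auto simp: hyperrigid_def S_sys_gens)
  have pi_gen: "?\<pi> g = mult_diag f" if "g \<in> ?A" "bounded_fun_S3 f" "\<And>x. x \<in> S3 \<Longrightarrow> symbol_at x g (f x)" for g f
    using that by (intro mult_diag_cong bounded_symbol[OF that(1)]) (auto intro: symbol_eqI)
  have mem: "g \<in> ?A" if "g \<in> gens c" for g using gens_Cstar that by blast
  have pi_T1: "?\<pi> (T1_tilde c) = mult_diag (?t 1)" "?\<pi> (cadjoint (T1_tilde c)) = mult_diag (?t 1)"
    by (rule pi_gen[OF mem]; simp add: gens_def bounded_fun_coord symbol_at_T1 symbol_at_T1_adj)+
  have pi_T: "?\<pi> (T_op i) = mult_diag (?t i)" if "i = 2 \<or> i = 3 \<or> i = 4" for i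
    by (rule pi_gen[OF mem]; use that in \<open>auto simp: gens_def bounded_fun_coord symbol_at_T_op\<close>)
  have pi_id: "?\<pi> id_blinfun = ?E"
    by (rule pi_gen[OF mem]; simp add: gens_def bounded_fun_const symbol_at_id)
  have eq_gens: "?\<phi> g = ?\<pi> g" if "g \<in> gens c" for g
  proof -
    from that consider i where "i = 2 \<or> i = 3 \<or> i = 4" "g = T_op i" | "g = T1_tilde c"
      | "g = cadjoint (T1_tilde c)" | "g = id_blinfun"
      by (auto simp: gens_def)
    then show ?thesis
      by cases (simp add: pi_T, simp_all add: pi_T1 pi_id,
        auto intro!: blinfun_eqI simp: mult_diag_id_apply T1_tilde_apply T1_adj_apply T_op_eq mult_diag_apply scaleC_zero_left)
  qed
  have rep: "representation ?A L2_summand ?\<pi>" by (rule representation_symbol)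
  have lin: "?\<pi> (a + b) = ?\<pi> a + ?\<pi> b" "?\<pi> (a o\<^sub>L b) = ?\<pi> a o\<^sub>L ?\<pi> b"
    "?\<phi> (a + b) = ?\<phi> a + ?\<phi> b" if "a \<in> ?A" "b \<in> ?A" for a b
    using rep ucp_compression[of c] that unfolding representation_def ucp_def unital_clinear_map_def by blast+
  have scale: "?\<pi> (z *\<^sub>C a) = z *\<^sub>C ?\<pi> a" "?\<phi> (z *\<^sub>C a) = z *\<^sub>C ?\<phi> a" if "a \<in> ?A" for a z
    using rep ucp_compression[of c] that unfolding representation_def ucp_def unital_clinear_map_def by blast+
  \<comment> \<open>Agreement on generators extends by linearity to the operator system, and the
    assumed uniqueness would extend it to all of the algebra, products included.\<close>
  have "cspan (gens c) \<subseteq> {a \<in> ?A. ?\<phi> a = ?\<pi> a}"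
  proof (rule cspan_least)
    have "?\<phi> (0 *\<^sub>C id_blinfun) = ?\<pi> (0 *\<^sub>C id_blinfun)"
      using scale[OF sphere.one, of 0]
      by (simp add: scaleC_zero_left)
    then have "?\<phi> 0 = ?\<pi> 0" by (simp only: scaleC_zero_left)
    then show "csubspace {a \<in> ?A. ?\<phi> a = ?\<pi> a}"
      unfolding csubspace_def
    proof (intro conjI ballI allI)
      fix a assume "a \<in> {a \<in> ?A. ?\<phi> a = ?\<pi> a}"
      then have a: "a \<in> ?A" "?\<phi> a = ?\<pi> a" by auto
      show "z *\<^sub>C a \<in> {a \<in> ?A. ?\<phi> a = ?\<pi> a}" for z
        using sphere.scaleC[OF a(1), of z] scale[OF a(1), of z] a(2) by simp
      fix b assume "b \<in> {a \<in> ?A. ?\<phi> a = ?\<pi> a}"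
      then have b: "b \<in> ?A" "?\<phi> b = ?\<pi> b" by auto
      show "a + b \<in> {a \<in> ?A. ?\<phi> a = ?\<pi> a}"
        using sphere.add[OF a(1) b(1)] lin(1,3)[OF a(1) b(1)] a(2) b(2) by simp
    qed (use sphere.zero in simp)
    show "gens c \<subseteq> {a \<in> ?A. ?\<phi> a = ?\<pi> a}" using mem eq_gens by blast
  qed
  then have "\<forall>a\<in>?A. ?\<phi> a = ?\<pi> a"
    using uep ucp_compression[of c] unfolding unique_extension_property_def by blast
  moreover have T: "T1_tilde c \<in> ?A" "cadjoint (T1_tilde c) \<in> ?A" using mem by (auto simp: gens_def)
  \<comment> \<open>At the constant 1, the compressed product gives t_1^2 + c^2, where c^2 comes
    from the path through the summand C; the product of the symbols gives t_1^2 only.\<close>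
  ultimately have "?\<phi> (T1_tilde c o\<^sub>L cadjoint (T1_tilde c)) (const_S3 1, 0) = (mult_diag (?t 1) o\<^sub>L mult_diag (?t 1)) (const_S3 1, 0)"
    using sphere.compose[OF T] lin(2)[OF T] pi_T1 by metis
  then have "(complex_of_real c * complex_of_real c) *\<^sub>C const_S3 1 = 0"
    by (simp add: mult_diag_id_apply T1_tilde_apply T1_adj_apply mult_diag_apply P_S3_const)
  then have "norm ((complex_of_real c * complex_of_real c) *\<^sub>C const_S3 1) = 0" by simp
  then show False using c by (simp add: norm_scaleC norm_const_S3 norm_mult)
qed

section \<open>The C*-algebra contains a rank one projection and the continuous functions\<close>

lift_definition const_proj :: "L2C \<Rightarrow>\<^sub>L L2C" is "\<lambda>v. (cadjoint P_S3 (P_S3 (fst v)), 0)"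
  by (intro bounded_linear_Pair bounded_linear_zero
      bounded_linear_compose[OF blinfun.bounded_linear_right]
      bounded_linear_compose[OF blinfun.bounded_linear_right bounded_linear_fst])

lemma const_proj_apply: "const_proj v = (P_S3 (fst v) *\<^sub>C const_S3 1, 0)"
  using const_S3_eq[of "P_S3 (fst v)"] by (simp add: const_proj.rep_eq cadjoint_P_S3)

lemma P_S3_const_1: "P_S3 (z *\<^sub>C const_S3 1) = z"
  by (simp add: P_S3_scaleC P_S3_const)

lemma const_proj_const_proj: "const_proj o\<^sub>L const_proj = const_proj"
  by (rule blinfun_eqI) (simp add: const_proj_apply P_S3_const_1)

lemma cadjoint_const_proj: "cadjoint const_proj = const_proj"
  by (rule cadjoint_eqI)
    (simp add: const_proj_apply cinner_prod_def cinner_scaleC_left cinner_scaleC_right cinner_const_S3)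

lemma clinear_const_proj: "clinear_op const_proj"
  by (simp add: clinear_op_def const_proj_apply scaleC_prod_def P_S3_scaleC scaleC_scaleC scaleC_zero_right)

definition squares :: "real \<Rightarrow> L2C \<Rightarrow>\<^sub>L L2C" where
  "squares c = (T1_tilde c o\<^sub>L cadjoint (T1_tilde c)) + (T_op 2 o\<^sub>L T_op 2) + (T_op 3 o\<^sub>L T_op 3) + (T_op 4 o\<^sub>L T_op 4)"

lemma sum_coord_squares:
  "mult_op (coord 1) (mult_op (coord 1) g)
   + mult_op (coord 2) (mult_op (coord 2) g)
   + mult_op (coord 3) (mult_op (coord 3) g)
   + mult_op (coord 4) (mult_op (coord 4) g) = g"
proof -
  let ?q = "\<lambda>i t. complex_of_real ((t::real^4) $ i) * complex_of_real (t $ i)"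
  note b = bounded_fun_mult[OF bounded_fun_coord bounded_fun_coord]
  have "mult_op (\<lambda>t. ?q 1 t + ?q 2 t + ?q 3 t + ?q 4 t) = mult_op (\<lambda>t. 1)"
  proof (rule mult_op_cong)
    fix t :: "real^4" assume "t \<in> S3"
    then have "complex_of_real ((t $ 1)\<^sup>2 + (t $ 2)\<^sup>2 + (t $ 3)\<^sup>2 + (t $ 4)\<^sup>2) = complex_of_real 1"
      unfolding S3_sum_squares by (rule arg_cong)
    then show "?q 1 t + ?q 2 t + ?q 3 t + ?q 4 t = 1" by (simp add: power2_eq_square)
  qed (intro bounded_fun_add b bounded_fun_const)+
  then have "mult_op (\<lambda>t. ?q 1 t + ?q 2 t + ?q 3 t + ?q 4 t) g = g" by (simp add: mult_op_const scaleC_one)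
  then show ?thesis
    by (simp only: mult_op_add bounded_fun_add b mult_op_mult bounded_fun_coord)
qed

lemma squares_apply:
  "squares c v = (fst v + (complex_of_real c * complex_of_real c * P_S3 (fst v)) *\<^sub>C const_S3 1, 0)"
proof -
  have eq: "squares c v = (mult_op (coord 1) (mult_op (coord 1) (fst v))
   + mult_op (coord 2) (mult_op (coord 2) (fst v))
   + mult_op (coord 3) (mult_op (coord 3) (fst v))
   + mult_op (coord 4) (mult_op (coord 4) (fst v))
   + (complex_of_real c * complex_of_real c * P_S3 (fst v)) *\<^sub>C const_S3 1, 0)"
    by (simp add: squares_def blinfun.add_left T_op_eq mult_diag_apply T1_tilde_apply T1_adj_apply mult.assoc add_ac)
  show ?thesis unfolding eq sum_coord_squares by simp
qed

text \<open>With \<open>B = squares c = E + c\<^sup>2 Q\<close> one has \<open>B\<^sup>2 - B = (c\<^sup>2 + c\<^sup>4) Q\<close>.\<close>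

lemma Cstar_mem:
  assumes c: "0 < c"
  shows squares_mem: "squares c \<in> CS c"
    and const_proj_mem: "const_proj \<in> CS c"
    and mult_diag_1_mem: "proj_L2 \<in> CS c"
    and mult_diag_coord_mem: "mult_diag (coord i) \<in> CS c"
proof -
  let ?A = "CS c"
  have g: "T1_tilde c \<in> ?A" "cadjoint (T1_tilde c) \<in> ?A" "T_op 2 \<in> ?A" "T_op 3 \<in> ?A" "T_op 4 \<in> ?A"
    using gens_Cstar[of c] by (auto simp: gens_def)
  show B: "squares c \<in> ?A" unfolding squares_def by (intro sphere.add sphere.compose g)
  define k where "k = complex_of_real (c * c + c * c * c * c)"
  have "c * c + c * c * c * c \<noteq> 0" using c by (simp add: add_pos_pos less_imp_neq[symmetric])
  then have k: "k \<noteq> 0" unfolding k_def by (simp only: of_real_eq_0_iff) simp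
  have "(squares c o\<^sub>L squares c) - squares c = k *\<^sub>C const_proj"
    by (rule blinfun_eqI) (simp add: blinfun.diff_left squares_apply const_proj_apply scaleC_blinfun.rep_eq scaleC_prod_def
        blinfun.add_right P_S3_const_1 scaleC_scaleC scaleC_zero_right k_def flip: scaleC_add_left scaleC_diff_left,
        simp add: algebra_simps flip: scaleC_add_left scaleC_diff_left)
  then have "(1 / k) *\<^sub>C ((squares c o\<^sub>L squares c) - squares c) = const_proj"
    using k by (simp add: scaleC_scaleC scaleC_one)
  then show Q: "const_proj \<in> ?A" using B by (metis sphere.compose sphere.diff sphere.scaleC)
  have "squares c - complex_of_real (c * c) *\<^sub>C const_proj = proj_L2"
    by (rule blinfun_eqI) (simp add: blinfun.diff_left squares_apply const_proj_apply scaleC_blinfun.rep_eq scaleC_prod_def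
        scaleC_scaleC scaleC_zero_right mult_diag_id_apply)
  then show E: "proj_L2 \<in> ?A" using B Q by (metis sphere.diff sphere.scaleC)
  \<comment> \<open>Multiplying by the projection on the right deletes the entry that feeds the
    summand C into the constants.\<close>
  have "T1_tilde c o\<^sub>L proj_L2 = mult_diag (coord 1)"
    by (rule blinfun_eqI) (simp add: T1_tilde_apply mult_diag_apply mult_op_const scaleC_one scaleC_zero_left)
  then have 1: "mult_diag (coord 1) \<in> ?A" using g(1) E by (metis sphere.compose)
  show "mult_diag (coord i) \<in> ?A"
    using 1 g exhaust_4[of i] unfolding T_op_eq by auto
qed

lemma continuous_poly: "real_polynomial_function p \<Longrightarrow> continuous_on S3 (p :: real^4 \<Rightarrow> real)"
  using continuous_at_imp_continuous_on continuous_real_polymonial_function by blast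

lemma mult_diag_poly_mem:
  fixes p :: "real^4 \<Rightarrow> real"
  assumes c: "0 < c" and p: "real_polynomial_function p"
  shows "diag_real p \<in> CS c" (is "_ \<in> ?A")
  using p
proof induction
  case (linear f)
  interpret f: bounded_linear f by fact
  have lin: "f t = (\<Sum>i\<in>UNIV. f (axis i 1) * t $ i)" for t
  proof -
    have "f t = f (\<Sum>i\<in>UNIV. (t $ i) *\<^sub>R axis i 1)" using basis_expansion[of t] by (simp add: scalar_mult_eq_scaleR)
    then show ?thesis by (simp add: f.sum f.scaleR mult.commute)
  qed
  have f: "complex_of_real (f t) = complex_of_real (f (axis 1 1)) * complex_of_real (t $ 1)
      + complex_of_real (f (axis 2 1)) * complex_of_real (t $ 2)
      + complex_of_real (f (axis 3 1)) * complex_of_real (t $ 3)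
      + complex_of_real (f (axis 4 1)) * complex_of_real (t $ 4)" for t
    by (simp only: lin[of t] sum_4 of_real_add of_real_mult)
  have b: "bounded_fun_S3 (\<lambda>t. complex_of_real a * complex_of_real (t $ i))" for a i
    by (intro bounded_fun_mult bounded_fun_const bounded_fun_coord)
  have m: "mult_diag (\<lambda>t. complex_of_real a * complex_of_real (t $ i)) \<in> ?A" for a i
    unfolding mult_diag_cmult[OF bounded_fun_coord] by (intro sphere.scaleC mult_diag_coord_mem[OF c])
  show ?case unfolding ext[OF f]
    by (simp only: mult_diag_add bounded_fun_add b) (intro sphere.add m)
next
  \<comment> \<open>Constant functions act as multiples of \<open>proj_L2\<close> rather than of the
    identity, so membership of the projection is needed here.\<close>
  case (const a)
  have "mult_diag (\<lambda>t. complex_of_real a) = complex_of_real a *\<^sub>C proj_L2"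
    using mult_diag_cmult[OF bounded_fun_const[of 1], of "complex_of_real a"] by simp
  then show ?case using mult_diag_1_mem[OF c] by (simp add: sphere.scaleC)
next
  case (add p q)
  have "bounded_real_S3 p" "bounded_real_S3 q"
    by (intro bounded_fun_continuous continuous_on_of_real continuous_poly add)+
  then show ?case using mult_diag_add add.IH by (simp add: sphere.add)
next
  case (mult p q)
  have "bounded_real_S3 p" "bounded_real_S3 q"
    by (intro bounded_fun_continuous continuous_on_of_real continuous_poly mult)+
  then show ?case using mult_diag_mult mult.IH by (simp add: sphere.compose)
qed

text \<open>Uniform approximation by polynomials on the compact sphere is approximation in operator
  norm, and the algebra is closed.\<close>

lemma mult_diag_continuous_mem:
  fixes f :: "real^4 \<Rightarrow> real"
  assumes c: "0 < c" and f: "continuous_on S3 f"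
  shows "diag_real f \<in> CS c" (is "_ \<in> ?A")
proof -
  have "compact S3" by (simp add: S3_def)
  have "\<exists>p. real_polynomial_function p \<and> (\<forall>t\<in>S3. \<bar>f t - p t\<bar> < 1 / real (Suc n))" for n
    by (rule Stone_Weierstrass_real_polynomial_function[OF \<open>compact S3\<close> f, of "1 / real (Suc n)"]) auto
  then obtain p where p: "\<And>n. real_polynomial_function (p n)" "\<And>n t. t \<in> S3 \<Longrightarrow> \<bar>f t - p n t\<bar> < 1 / real (Suc n)"
    by metis
  have b: "bounded_real_S3 f" "bounded_real_S3 (\<lambda>t. p n t)" for n
    by (intro bounded_fun_continuous continuous_on_of_real f continuous_poly p)+
  have le: "norm (diag_real (\<lambda>t. p n t) - diag_real f) \<le> 1 / real (Suc n)" for n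
    unfolding mult_diag_diff[OF b(2) b(1), symmetric]
  proof (rule norm_Mop_le[OF bounded_fun_diff[OF b(2) b(1)]])
    fix t :: "real^4" assume "t \<in> S3"
    then show "cmod (complex_of_real (p n t) - complex_of_real (f t)) \<le> 1 / real (Suc n)"
      using p(2)[of t n] unfolding of_real_diff[symmetric] norm_of_real by (simp add: abs_minus_commute)
  qed simp
  have "(\<lambda>n. diag_real (\<lambda>t. p n t) - diag_real f) \<longlonglongrightarrow> 0"
    by (rule Lim_null_comparison[OF always_eventually[OF allI] lim_inverse_Suc]) (rule le)
  then have "(\<lambda>n. diag_real (\<lambda>t. p n t)) \<longlonglongrightarrow> diag_real f"
    by (simp add: LIM_zero_iff)
  then show ?thesis by (rule sphere.lim[OF mult_diag_poly_mem[OF c p(1)]])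
qed

section \<open>The defect of a point evaluation\<close>

text \<open>Half the sum of \<open>T1_tilde c\<close> and its adjoint is the real part. The symbol
  of this operator at t is 1 - <x,t>, which vanishes on the sphere only at t = x.\<close>

definition defect :: "real \<Rightarrow> real^4 \<Rightarrow> L2C \<Rightarrow>\<^sub>L L2C" where
  "defect c x = id_blinfun - complex_of_real (x $ 1 / 2) *\<^sub>C (T1_tilde c + cadjoint (T1_tilde c))
     - complex_of_real (x $ 2) *\<^sub>C T_op 2 - complex_of_real (x $ 3) *\<^sub>C T_op 3 - complex_of_real (x $ 4) *\<^sub>C T_op 4"

definition point_form :: "real^4 \<Rightarrow> L2_S3 \<Rightarrow> real" where
  "point_form x g = Re (cinner (mult_real (\<lambda>t. 1 - x \<bullet> t) g) g)"

lemma point_form_eq: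
  "complex_of_real (point_form x g) = cinner (mult_real (\<lambda>t. 1 - x \<bullet> t) g) g"
proof -
  have "bounded_real_S3 (\<lambda>t. 1 - x \<bullet> t)"
    by (intro bounded_fun_continuous continuous_intros)
  then have "cinner (mult_real (\<lambda>t. 1 - x \<bullet> t) g) g
      = cnj (cinner (mult_real (\<lambda>t. 1 - x \<bullet> t) g) g)"
    using cinner_mult_op_real cinner_commute by metis
  then show ?thesis unfolding point_form_def by (metis Reals_cnj_iff of_real_Re)
qed

lemma point_form_nonneg:
  assumes x: "x \<in> S3"
  shows "0 \<le> point_form x g"
proof -
  have c: "continuous_on S3 (\<lambda>t. 1 - x \<bullet> t)" by (intro continuous_intros)
  have p: "0 \<le> 1 - x \<bullet> t" if "t \<in> S3" for t
    using norm_cauchy_schwarz[of x t] x that by (simp add: S3_def)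
  have eq: "cinner (mult_real (\<lambda>t. 1 - x \<bullet> t) g) g
      = complex_of_real ((norm (mult_real (\<lambda>t. sqrt (1 - x \<bullet> t)) g))\<^sup>2)"
    by (rule mult_op_nonneg[OF c p])
  show ?thesis unfolding point_form_def eq by (simp only: Re_complex_of_real zero_le_power2)
qed

text \<open>On the unit sphere (t_i - x_i)^2 \<le> |t - x|^2 = 2 (1 - <x,t>), and multiplication
  operators preserve this order.\<close>

lemma norm_coord_diff_le:
  assumes x: "x \<in> S3"
  shows "(norm (mult_op (coord i) g - complex_of_real (x $ i) *\<^sub>C g))\<^sup>2 \<le> 2 * point_form x g"
proof -
  let ?d = "\<lambda>t::real^4. t $ i - x $ i"
  have b: "bounded_real_S3 (\<lambda>t. ?d t)" by (intro bounded_fun_continuous continuous_intros)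
  have eq: "mult_op (coord i) g - complex_of_real (x $ i) *\<^sub>C g = mult_real (\<lambda>t. ?d t) g"
    using mult_op_diff[OF bounded_fun_coord bounded_fun_const, of i "complex_of_real (x $ i)" g] by (simp add: mult_op_const)
  have "(norm (mult_real (\<lambda>t. ?d t) g))\<^sup>2 = Re (cinner (mult_real (\<lambda>t. (?d t)\<^sup>2) g) g)"
    using arg_cong[OF norm_mult_op_square[OF b, of g], of Re] by (simp only: Re_complex_of_real)
  also have "\<dots> \<le> Re (cinner (mult_real (\<lambda>t. 2 * (1 - x \<bullet> t)) g) g)"
  proof (rule mult_op_mono)
    fix t :: "real^4" assume t: "t \<in> S3"
    have "(?d t)\<^sup>2 = \<bar>(t - x) $ i\<bar>\<^sup>2" by simp
    also have "\<dots> \<le> (norm (t - x))\<^sup>2" by (intro power_mono component_le_norm_cart) simp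
    also have "\<dots> = 2 * (1 - x \<bullet> t)"
      using x t by (simp add: power2_norm_eq_inner inner_diff_left inner_diff_right S3_def norm_eq_1 inner_commute)
    finally show "(?d t)\<^sup>2 \<le> 2 * (1 - x \<bullet> t)" .
  qed (intro continuous_intros)+
  also have "\<dots> = 2 * point_form x g"
  proof -
    have "bounded_real_S3 (\<lambda>t. 1 - x \<bullet> t)" by (intro bounded_fun_continuous continuous_intros)
    from mult_op_cmult[OF this, of 2 g] show ?thesis
      by (simp add: point_form_def cinner_scaleC_left)
  qed
  finally show ?thesis unfolding eq .
qed

text \<open>The off-diagonal entries of \<open>T1_tilde\<close> and its adjoint together contribute
  2 c times the real part of z times the conjugate mean of g; the factor x_1 / 2 removes the
  2.\<close>

lemma cinner_defect:
  "cinner (defect c x (g, z)) (g, z) = complex_of_real (point_form x g + (cmod z)\<^sup>2 - c * x $ 1 * Re (z * cnj (P_S3 g)))"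
proof -
  let ?M = "\<lambda>i. mult_op (coord i) g"
  let ?x = "\<lambda>i. complex_of_real (x $ i)"
  have b: "bounded_fun_S3 (\<lambda>t. ?x i * complex_of_real (t $ i))" for i
    by (intro bounded_fun_mult bounded_fun_const bounded_fun_coord)
  have "(\<lambda>t. complex_of_real (1 - x \<bullet> t)) = (\<lambda>t. 1 - (?x 1 * complex_of_real (t $ 1) + ?x 2 * complex_of_real (t $ 2)
      + ?x 3 * complex_of_real (t $ 3) + ?x 4 * complex_of_real (t $ 4)))"
    by (simp add: inner_vec_def sum_4)
  then have W: "mult_real (\<lambda>t. 1 - x \<bullet> t) g = g - (?x 1 *\<^sub>C ?M 1 + ?x 2 *\<^sub>C ?M 2 + ?x 3 *\<^sub>C ?M 3 + ?x 4 *\<^sub>C ?M 4)"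
    by (simp only: mult_op_diff mult_op_add bounded_fun_add bounded_fun_const b mult_op_cmult bounded_fun_coord mult_op_const scaleC_one)
  have z: "z * cnj (P_S3 g) + P_S3 g * cnj z = complex_of_real (2 * Re (z * cnj (P_S3 g)))"
    by (simp add: complex_eq_iff)
  have 1: "cinner ((T1_tilde c + cadjoint (T1_tilde c)) (g, z)) (g, z)
      = 2 * cinner (?M 1) g + complex_of_real c * (z * cnj (P_S3 g) + P_S3 g * cnj z)"
    by (simp add: blinfun.add_left T1_tilde_apply T1_adj_apply cinner_prod_def cinner_simps cinner_const_S3
        cinner_complex_def algebra_simps)
  have 2: "cinner (T_op i (g, z)) (g, z) = cinner (?M i) g" for i
    by (simp add: T_op_eq mult_diag_apply cinner_prod_def)
  have "cinner (defect c x (g, z)) (g, z) = cinner g g + cinner z z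
      - ?x 1 / 2 * (2 * cinner (?M 1) g + complex_of_real c * (z * cnj (P_S3 g) + P_S3 g * cnj z))
      - ?x 2 * cinner (?M 2) g - ?x 3 * cinner (?M 3) g - ?x 4 * cinner (?M 4) g"
    unfolding defect_def by (simp add: blinfun.diff_left scaleC_blinfun.rep_eq cinner_diff_left cinner_scaleC_left 1 2)
      (simp add: cinner_prod_def)
  also have "\<dots> = complex_of_real (point_form x g) + cinner z z - complex_of_real (c * x $ 1 * Re (z * cnj (P_S3 g)))"
    unfolding z point_form_eq W by (simp add: cinner_simps algebra_simps)
  finally show ?thesis by (simp add: cinner_self)
qed

text \<open>By |z| |p| \<le> |z|^2 + |p|^2 / 4 and |p|^2 \<le> 2 W, with p the mean and W the point
  form of g, the cross term is at most c (|z|^2 + W). Since c < 1, a positive fraction of the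
  diagonal part survives.\<close>

lemma defect_ge:
  assumes x: "x \<in> S3" and c: "0 < c" "c < 1"
  shows "(1 - c) * (point_form x g + (cmod z)\<^sup>2) \<le> Re (cinner (defect c x (g, z)) (g, z))"
proof -
  have h: "(cmod (P_S3 g))\<^sup>2 \<le> 2 * point_form x g" using hardy_S3[OF x] by (simp add: point_form_def)
  have x1: "\<bar>x $ 1\<bar> \<le> 1" using coord_square_le_1[OF x, of 1] by (simp add: abs_square_le_1)
  have "x $ 1 * Re (z * cnj (P_S3 g)) \<le> \<bar>x $ 1\<bar> * \<bar>Re (z * cnj (P_S3 g))\<bar>"
    unfolding abs_mult[symmetric] by simp
  also have "\<dots> \<le> 1 * cmod (z * cnj (P_S3 g))"
    by (rule mult_mono[OF x1 abs_Re_le_cmod]) simp_all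
  also have "\<dots> = cmod z * cmod (P_S3 g)" by (simp add: norm_mult)
  also have "\<dots> \<le> (cmod z)\<^sup>2 + (cmod (P_S3 g))\<^sup>2 / 4"
    using zero_le_power2[of "cmod z - cmod (P_S3 g) / 2"] by (simp add: power2_diff power_divide)
  also have "\<dots> \<le> (cmod z)\<^sup>2 + point_form x g" using h point_form_nonneg[OF x, of g] by linarith
  finally have "c * (x $ 1 * Re (z * cnj (P_S3 g))) \<le> c * ((cmod z)\<^sup>2 + point_form x g)"
    using c by (intro mult_left_mono) auto
  then show ?thesis unfolding cinner_defect by (simp add: algebra_simps)
qed

text \<open>One constant serves all generators. The adjoint of \<open>T1_tilde\<close> dictates it:
  2 W from the coordinate and 2 * 2 W from c P g, which \<open>hardy_S3\<close> controls, where W is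
  the point form of g.\<close>

lemma gens_diff_le:
  assumes x: "x \<in> S3" and c: "0 < c" "c < 1"
  shows "(norm (T_op i (g, z) - complex_of_real (x $ i) *\<^sub>C (g, z)))\<^sup>2 \<le> 6 * (point_form x g + (cmod z)\<^sup>2)"
    and "(norm (T1_tilde c (g, z) - complex_of_real (x $ 1) *\<^sub>C (g, z)))\<^sup>2 \<le> 6 * (point_form x g + (cmod z)\<^sup>2)"
    and "(norm (cadjoint (T1_tilde c) (g, z) - complex_of_real (x $ 1) *\<^sub>C (g, z)))\<^sup>2 \<le> 6 * (point_form x g + (cmod z)\<^sup>2)"
proof -
  define W where "W = point_form x g"
  define d where "d i = mult_op (coord i) g - complex_of_real (x $ i) *\<^sub>C g" for i
  have W: "0 \<le> W" using point_form_nonneg[OF x] by (simp add: W_def)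
  have d: "(norm (d i))\<^sup>2 \<le> 2 * W" for i using norm_coord_diff_le[OF x] by (simp add: d_def W_def)
  have h: "(cmod (P_S3 g))\<^sup>2 \<le> 2 * W" using hardy_S3[OF x] by (simp add: point_form_def W_def)
  have sq: "(norm (u + v))\<^sup>2 \<le> 2 * (norm u)\<^sup>2 + 2 * (norm v)\<^sup>2" for u v :: "'b::real_normed_vector"
  proof -
    have "(norm (u + v))\<^sup>2 \<le> (norm u + norm v)\<^sup>2" by (intro power_mono norm_triangle_ineq) simp
    also have "\<dots> \<le> 2 * (norm u)\<^sup>2 + 2 * (norm v)\<^sup>2"
      using sum_squares_bound[of "norm u" "norm v"] by (simp add: power2_sum)
    finally show ?thesis .
  qed
  have xz: "(cmod (complex_of_real (x $ i) * z))\<^sup>2 \<le> (cmod z)\<^sup>2" for i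
    using coord_square_le_1[OF x, of i] by (simp add: norm_mult power_mult_distrib mult_left_le_one_le)
  have c2: "c\<^sup>2 \<le> 1" using c by (simp add: power_le_one)
  have est: "a + b \<le> 6 * (w + y)" if "a \<le> 2 * w" "b \<le> y" "0 \<le> w" "0 \<le> y" for a b w y :: real
    using that by argo
  have est1: "n + b \<le> 6 * (w + y)"
    if "n \<le> 2 * a + 2 * e" "a \<le> 2 * w" "e \<le> y" "b \<le> y" "0 \<le> w" "0 \<le> y" for n a b e w y :: real
    using that by argo
  have est2: "a + n \<le> 6 * (w + y)"
    if "n \<le> 2 * p + 2 * q" "a \<le> 2 * w" "p \<le> e" "e \<le> 2 * w" "q \<le> y" "0 \<le> w" "0 \<le> y" for n a e p q w y :: real
    using that by argo
  have pair: "(norm (u, w))\<^sup>2 = (norm u)\<^sup>2 + (norm w)\<^sup>2" for u :: L2_S3 and w :: complex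
    by (simp add: norm_Pair)
  show "(norm (T_op i (g, z) - complex_of_real (x $ i) *\<^sub>C (g, z)))\<^sup>2 \<le> 6 * (point_form x g + (cmod z)\<^sup>2)"
  proof -
    have "T_op i (g, z) - complex_of_real (x $ i) *\<^sub>C (g, z) = (d i, - (complex_of_real (x $ i) * z))"
      by (simp add: T_op_eq mult_diag_apply scaleC_prod_def scaleC_complex_def d_def)
    then have "(norm (T_op i (g, z) - complex_of_real (x $ i) *\<^sub>C (g, z)))\<^sup>2 = (norm (d i))\<^sup>2 + (cmod (complex_of_real (x $ i) * z))\<^sup>2"
      by (simp add: pair)
    then show ?thesis using est[OF d[of i] xz[of i] W zero_le_power2] unfolding W_def[symmetric] by simp
  qed
  show "(norm (T1_tilde c (g, z) - complex_of_real (x $ 1) *\<^sub>C (g, z)))\<^sup>2 \<le> 6 * (point_form x g + (cmod z)\<^sup>2)"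
  proof -
    have "T1_tilde c (g, z) - complex_of_real (x $ 1) *\<^sub>C (g, z)
        = (d 1 + (complex_of_real c * z) *\<^sub>C const_S3 1, - (complex_of_real (x $ 1) * z))"
      by (simp add: T1_tilde_apply scaleC_prod_def scaleC_complex_def d_def)
    then have "(norm (T1_tilde c (g, z) - complex_of_real (x $ 1) *\<^sub>C (g, z)))\<^sup>2
        = (norm (d 1 + (complex_of_real c * z) *\<^sub>C const_S3 1))\<^sup>2 + (cmod (complex_of_real (x $ 1) * z))\<^sup>2"
      by (simp add: pair)
    moreover have "(norm ((complex_of_real c * z) *\<^sub>C const_S3 1))\<^sup>2 \<le> (cmod z)\<^sup>2"
      using c2 by (simp add: norm_scaleC norm_const_S3 norm_mult power_mult_distrib mult_left_le_one_le)
    ultimately show ?thesis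
      using est1[OF sq[of "d 1" "(complex_of_real c * z) *\<^sub>C const_S3 1"] d[of 1] _ xz[of 1] W zero_le_power2]
      unfolding W_def[symmetric] by simp
  qed
  show "(norm (cadjoint (T1_tilde c) (g, z) - complex_of_real (x $ 1) *\<^sub>C (g, z)))\<^sup>2 \<le> 6 * (point_form x g + (cmod z)\<^sup>2)"
  proof -
    have "cadjoint (T1_tilde c) (g, z) - complex_of_real (x $ 1) *\<^sub>C (g, z)
        = (d 1, complex_of_real c * P_S3 g + - (complex_of_real (x $ 1) * z))"
      by (simp add: T1_adj_apply scaleC_prod_def scaleC_complex_def d_def)
    then have "(norm (cadjoint (T1_tilde c) (g, z) - complex_of_real (x $ 1) *\<^sub>C (g, z)))\<^sup>2
        = (norm (d 1))\<^sup>2 + (cmod (complex_of_real c * P_S3 g + - (complex_of_real (x $ 1) * z)))\<^sup>2"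
      by (simp only: pair)
    moreover have "(cmod (complex_of_real c * P_S3 g))\<^sup>2 \<le> (cmod (P_S3 g))\<^sup>2"
      using c2 by (simp add: norm_mult power_mult_distrib mult_left_le_one_le)
    moreover have "(cmod (- (complex_of_real (x $ 1) * z)))\<^sup>2 \<le> (cmod z)\<^sup>2" using xz[of 1] by simp
    ultimately show ?thesis
      using est2[OF sq[of "complex_of_real c * P_S3 g" "- (complex_of_real (x $ 1) * z)"] d[of 1] _ h _ W zero_le_power2]
      unfolding W_def[symmetric] by simp
  qed
qed

section \<open>Unique extension for irreducible representations\<close>

lemma divide_plus_1_mult_le: "0 \<le> n \<Longrightarrow> 0 < e \<Longrightarrow> e / (n + 1) * n \<le> (e::real)"
  by (simp add: pos_divide_le_eq add_nonneg_pos algebra_simps)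

locale sphere_extension = ucp_extension_gen "gens c" H \<pi> \<phi>
  for c :: real and H :: "'h::chilbert_space set" and \<pi> \<phi> +
  assumes c_pos: "0 < c" and c_less: "c < 1"
    and irr: "irreducible_representation (CS c) H \<pi>"
begin

abbreviation "X \<equiv> T1_tilde c"

lemma X_mem: "X \<in> A" and X_adj_mem: "cadjoint X \<in> A"
  and T_mem: "T_op 2 \<in> A" "T_op 3 \<in> A" "T_op 4 \<in> A"
  using gens_Cstar[of c] by (auto simp: gens_def)

lemma phi_gens: "\<phi> id_blinfun = \<pi> id_blinfun" "\<phi> X = \<pi> X" "\<phi> (cadjoint X) = \<pi> (cadjoint X)"
  "\<phi> (T_op 2) = \<pi> (T_op 2)" "\<phi> (T_op 3) = \<pi> (T_op 3)" "\<phi> (T_op 4) = \<pi> (T_op 4)"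
  by (rule ext; simp add: gens_def)+

text \<open>Where the maps coincide at s, the Schwarz inequality gives one direction for s^* s. In
  \<open>agree_range_Q\<close> it is summed over the four products in
  \<open>squares c\<close>.\<close>

lemma phi_ge_pi:
  assumes s: "s \<in> A" "\<phi> s = \<pi> s" and h: "h \<in> H"
  shows "Re (cinner (\<pi> (cadjoint s o\<^sub>L s) h) h) \<le> Re (cinner (\<phi> (cadjoint s o\<^sub>L s) h) h)"
proof -
  have "cinner (\<pi> (cadjoint s o\<^sub>L s) h) h = cinner (\<pi> s h) (\<pi> s h)"
    using s adj by (simp add: pi_compose cinner_pi_adj)
  then show ?thesis using phi_schwarz[OF s(1) h] s(2) by (simp add: cinner_self)
qed

text \<open>
  On the range of \<open>\<pi>(Q)\<close> the operator \<open>squares c\<close> attains its norm \<open>1 + c\<^sup>2\<close>, which leaves no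
  room in the Schwarz inequality.
\<close>

lemma agree_range_Q:
  assumes h: "h \<in> H" and Qh: "\<pi> const_proj h = h"
  shows "agree h"
proof -
  note Q = const_proj_mem[OF c_pos]
  note B = squares_mem[OF c_pos]
  define C where "C = complex_of_real (1 + c * c)"
  define R where "R = id_blinfun - const_proj"
  have R: "R \<in> A" unfolding R_def by (intro diff one Q)
  have RR: "cadjoint R o\<^sub>L R = R"
    by (rule blinfun_eqI) (simp add: R_def cadjoint_diff clinear_op_id clinear_const_proj cadjoint_id cadjoint_const_proj
        blinfun.diff_left blinfun.diff_right const_proj_const_proj[THEN arg_cong[where f="\<lambda>T. blinfun_apply T v" for v], simplified])
  have BQ: "squares c o\<^sub>L const_proj = C *\<^sub>C const_proj"
    by (rule blinfun_eqI) (simp add: squares_apply const_proj_apply scaleC_blinfun.rep_eq scaleC_prod_def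
        P_S3_const_1 scaleC_zero_right, simp add: C_def scaleC_scaleC distrib_right scaleC_add_left)
  have "\<pi> (squares c) h = \<pi> (squares c o\<^sub>L const_proj) h" using B Q Qh by (simp add: pi_compose)
  also have "\<dots> = C *\<^sub>C h" using Q Qh by (simp add: BQ pi_scaleC scaleC_blinfun.rep_eq)
  finally have piB: "Re (cinner (\<pi> (squares c) h) h) = (1 + c * c) * (norm h)\<^sup>2"
    by (simp add: C_def cinner_simps cinner_self)
  have mem: "X o\<^sub>L cadjoint X \<in> A" "T_op 2 o\<^sub>L T_op 2 \<in> A" "T_op 3 o\<^sub>L T_op 3 \<in> A" "T_op 4 o\<^sub>L T_op 4 \<in> A"
    using X_mem X_adj_mem T_mem by (auto intro: compose)
  have "Re (cinner (\<pi> (squares c) h) h) \<le> Re (cinner (\<phi> (squares c) h) h)"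
    using phi_ge_pi[OF X_adj_mem phi_gens(3) h] phi_ge_pi[OF T_mem(1) phi_gens(4) h]
      phi_ge_pi[OF T_mem(2) phi_gens(5) h] phi_ge_pi[OF T_mem(3) phi_gens(6) h] mem
    by (simp add: squares_def pi_add phi_add add cadjoint_cadjoint clinear_T1 cadjoint_T_op
        blinfun.add_left cinner_add_left)
  then have phiB: "(1 + c * c) * (norm h)\<^sup>2 \<le> Re (cinner (\<phi> (squares c) h) h)" by (simp add: piB)
  \<comment> \<open>This operator is 1 - E, hence positive. So \<phi>(squares) is at most 1 + c^2 -
    c^2 \<phi>(R) at h, while the Schwarz inequality has shown that it is at least 1 + c^2 there;
    both together make R null at h.\<close>
  define D where "D = (C *\<^sub>C id_blinfun - squares c) - complex_of_real (c * c) *\<^sub>C R"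
  have D: "D \<in> A" unfolding D_def by (intro diff scaleC one B R)
  have "cinner (D v) v \<in> \<real>\<^sub>\<ge>\<^sub>0" for v :: L2C
  proof -
    have "D v = (0, snd v)"
      by (simp add: D_def R_def blinfun.diff_left scaleC_blinfun.rep_eq squares_apply const_proj_apply
          scaleC_prod_def prod_eq_iff scaleC_zero_right)
        (simp add: C_def scaleC_diff_right scaleC_add_left scaleC_one scaleC_scaleC scaleC_complex_def algebra_simps)
    then show ?thesis by (simp add: cinner_prod_def cinner_self nonneg_of_real del: of_real_power)
  qed
  then have "0 \<le> Re (cinner (\<phi> D h) h)" using phi_pos[OF D] nonneg_RealsD by blast
  also have "\<phi> D h = (C *\<^sub>C h - \<phi> (squares c) h) - complex_of_real (c * c) *\<^sub>C \<phi> R h"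
    unfolding D_def using B R h
    by (simp only: phi_diff phi_scaleC diff scaleC one blinfun.diff_left scaleC_blinfun.rep_eq phi_id)
  finally have "0 \<le> (1 + c * c) * (norm h)\<^sup>2 - Re (cinner (\<phi> (squares c) h) h) - c * c * Re (cinner (\<phi> R h) h)"
    by (simp add: C_def cinner_simps cinner_self)
  then have "c * c * Re (cinner (\<phi> R h) h) \<le> 0" using phiB by linarith
  then have "Re (cinner (\<phi> R h) h) \<le> 0" using c_pos by (simp add: mult_le_0_iff)
  moreover have "cinner (\<phi> R h) h \<in> \<real>\<^sub>\<ge>\<^sub>0" using phi_square_pos[OF R, of h] by (simp add: RR)
  ultimately have "cinner (\<phi> R h) h = 0" by (auto dest!: nonneg_RealsD simp: complex_eq_iff)
  then have "cinner (\<phi> (cadjoint R o\<^sub>L R) h) h = 0" unfolding RR .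
  note null = phi_null_square(1)[OF R R h this] phi_null_square(2)[OF _ R h this]
  have phiQ: "\<phi> (a o\<^sub>L const_proj) h = \<phi> a h" if a: "a \<in> A" for a
  proof -
    have "a o\<^sub>L R = a - (a o\<^sub>L const_proj)"
      by (rule blinfun_eqI) (simp add: R_def blinfun.diff_left blinfun.diff_right)
    then show ?thesis using null(2)[OF a] a Q by (simp add: phi_diff compose blinfun.diff_left)
  qed
  have phiQh: "\<phi> const_proj h = h" using phiQ[OF one] h by (simp add: blinfun_compose_id phi_id)
  have "cinner (\<phi> a h) h = cinner (\<pi> a h) h" if a: "a \<in> A" for a
  proof -
    \<comment> \<open>Q has rank one, so Q a Q is the multiple w of Q. Under both maps the state of
      h therefore takes the value w |h|^2 at a.\<close>
    define w where "w = cinner (a (const_S3 1, 0)) (const_S3 1, 0)"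
    have QaQ: "const_proj o\<^sub>L (a o\<^sub>L const_proj) = w *\<^sub>C const_proj"
    proof (rule blinfun_eqI)
      fix v :: L2C
      have "a (P_S3 (fst v) *\<^sub>C const_S3 1, 0) = P_S3 (fst v) *\<^sub>C a (const_S3 1, 0)"
        using clinear_opD[OF clinear[OF a], of "P_S3 (fst v)" "(const_S3 1, 0)"]
        by (simp add: scaleC_prod_def scaleC_zero_right)
      moreover have "w = P_S3 (fst (a (const_S3 1, 0)))" by (simp add: w_def cinner_prod_def P_S3.rep_eq)
      ultimately show "(const_proj o\<^sub>L (a o\<^sub>L const_proj)) v = (w *\<^sub>C const_proj) v"
        by (simp add: const_proj_apply scaleC_blinfun.rep_eq scaleC_prod_def P_S3_scaleC scaleC_scaleC
            scaleC_zero_right mult.commute)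
    qed
    have 1: "\<phi> (const_proj o\<^sub>L (a o\<^sub>L const_proj)) h = w *\<^sub>C h" "\<pi> (const_proj o\<^sub>L (a o\<^sub>L const_proj)) h = w *\<^sub>C h"
      unfolding QaQ using Q by (simp_all add: phi_scaleC pi_scaleC scaleC_blinfun.rep_eq phiQh Qh)
    \<comment> \<open>\<open>phiQ\<close> absorbs Q only on the right; the second Q, on the left, is
      reached by taking adjoints.\<close>
    define b where "b = const_proj o\<^sub>L cadjoint a"
    have b: "b \<in> A" unfolding b_def by (intro compose Q adj a)
    have badj: "cadjoint b = a o\<^sub>L const_proj"
      using clinear[OF a] by (simp add: b_def cadjoint_compose clinear_const_proj clinear_op_cadjoint cadjoint_cadjoint cadjoint_const_proj)
    have bQ: "cadjoint (b o\<^sub>L const_proj) = const_proj o\<^sub>L (a o\<^sub>L const_proj)"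
      using clinear[OF b] by (simp add: cadjoint_compose clinear_const_proj badj cadjoint_const_proj)
    have "cinner (\<phi> a h) h = cinner (\<phi> (cadjoint b) h) h" using phiQ[OF a] by (simp add: badj)
    also have "\<dots> = cinner h (\<phi> (b o\<^sub>L const_proj) h)" using phi_adj[OF b] phiQ[OF b] by simp
    also have "\<dots> = cinner (\<phi> (cadjoint (b o\<^sub>L const_proj)) h) h" using phi_adj[OF compose[OF b Q]] by simp
    also have "\<dots> = w * cinner h h" unfolding bQ 1 by (rule cinner_scaleC_left)
    finally have 2: "cinner (\<phi> a h) h = w * cinner h h" .
    have "cinner (\<pi> a h) h = cinner (\<pi> const_proj (\<pi> a (\<pi> const_proj h))) h"
      using cinner_pi_adj[OF Q, of "\<pi> a (\<pi> const_proj h)" h] by (simp add: cadjoint_const_proj Qh)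
    also have "\<dots> = cinner (\<pi> (const_proj o\<^sub>L (a o\<^sub>L const_proj)) h) h" using a Q by (simp add: pi_compose compose)
    also have "\<dots> = w * cinner h h" unfolding 1 by (rule cinner_scaleC_left)
    finally show ?thesis using 2 by simp
  qed
  then show ?thesis using h by (simp add: agree_def)
qed

text \<open>The remaining case: the representation kills the rank one projection, hence the compacts.\<close>

context
  assumes Q0: "\<pi> const_proj = 0"
begin

text \<open>The complement of E lies in the ideal generated by Q: with E' = 1 - E one has E' X^* Q X
  E' = c^2 E', as X carries the summand C into the constants and X^* brings it back.\<close>

lemma pi_compl_E: "\<pi> (id_blinfun - proj_L2) = 0"
proof -
  define E' where "E' = id_blinfun - proj_L2"
  have E': "E' \<in> A" unfolding E'_def by (intro diff one mult_diag_1_mem c_pos)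
  have E'v: "E' v = (0, snd v)" for v by (simp add: E'_def blinfun.diff_left mult_diag_id_apply prod_eq_iff)
  define Z where "Z = (E' o\<^sub>L cadjoint X) o\<^sub>L (const_proj o\<^sub>L (X o\<^sub>L E'))"
  have "Z = complex_of_real (c * c) *\<^sub>C E'"
    by (rule blinfun_eqI) (simp add: Z_def E'v T1_tilde_apply T1_adj_apply const_proj_apply blinfun.zero_right
        P_S3_const_1 scaleC_blinfun.rep_eq scaleC_prod_def scaleC_zero_right scaleC_complex_def)
  then have "\<pi> Z = complex_of_real (c * c) *\<^sub>C \<pi> E'" by (simp only: pi_scaleC[OF E'])
  moreover have "\<pi> Z = 0"
    unfolding Z_def using E' X_mem X_adj_mem const_proj_mem[OF c_pos] by (simp add: pi_compose compose Q0)
  ultimately have "complex_of_real (1 / (c * c)) *\<^sub>C complex_of_real (c * c) *\<^sub>C \<pi> E' = 0"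
    by (simp add: scaleC_zero_right)
  then show ?thesis using c_pos unfolding E'_def
    by (simp only: scaleC_scaleC of_real_mult[symmetric]) (simp add: scaleC_one)
qed

lemma pi_E: "h \<in> H \<Longrightarrow> \<pi> proj_L2 h = h"
  using arg_cong[OF pi_compl_E, of "\<lambda>T. T h"] mult_diag_1_mem[OF c_pos]
  by (simp add: pi_diff one blinfun.diff_left pi_id)

lemma pi_X: "\<pi> X = \<pi> (mult_diag (coord 1))"
proof -
  have "X = mult_diag (coord 1) + (X o\<^sub>L (id_blinfun - proj_L2))"
    by (rule blinfun_eqI) (simp add: blinfun.add_left blinfun.diff_left blinfun.diff_right mult_diag_apply T1_tilde_apply
        mult_op_const scaleC_one scaleC_zero_left prod_eq_iff scaleC_diff_right)
  then have "\<pi> X = \<pi> (mult_diag (coord 1) + (X o\<^sub>L (id_blinfun - proj_L2)))" by simp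
  also have "\<dots> = \<pi> (mult_diag (coord 1)) + (\<pi> X o\<^sub>L \<pi> (id_blinfun - proj_L2))"
    using X_mem one mult_diag_1_mem[OF c_pos] mult_diag_coord_mem[OF c_pos]
    by (simp only: pi_add pi_compose compose diff)
  finally show ?thesis by (simp add: pi_compl_E)
qed

lemma pi_X_adj: "\<pi> (cadjoint X) = \<pi> (mult_diag (coord 1))"
proof -
  have "\<pi> (cadjoint X) = cadjoint (\<pi> (mult_diag (coord 1)))"
    by (simp add: pi_adj X_mem pi_X)
  also have "\<dots> = \<pi> (cadjoint (mult_diag (coord 1)))"
    by (simp add: pi_adj mult_diag_coord_mem[OF c_pos])
  finally show ?thesis by (simp add: cadjoint_mult_diag bounded_fun_coord)
qed

section \<open>Representations that annihilate Q: the commutative case\<close>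

abbreviation "\<mu> f \<equiv> \<pi> (diag_real f)"

lemma mu_mult:
  assumes "continuous_on S3 f" "continuous_on S3 g"
  shows "\<mu> f (\<mu> g h) = \<mu> (\<lambda>t. f t * g t) h"
proof -
  have b: "bounded_real_S3 f" "bounded_real_S3 g"
    by (intro bounded_fun_continuous continuous_on_of_real assms)+
  show ?thesis
    using mult_diag_mult[OF b] mult_diag_continuous_mem[OF c_pos assms(1)] mult_diag_continuous_mem[OF c_pos assms(2)]
    by (simp add: pi_compose)
qed

lemma mu_diff:
  assumes "continuous_on S3 f" "continuous_on S3 g"
  shows "\<mu> f h - \<mu> g h = \<mu> (\<lambda>t. f t - g t) h"
proof -
  have b: "bounded_real_S3 f" "bounded_real_S3 g"
    by (intro bounded_fun_continuous continuous_on_of_real assms)+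
  show ?thesis
    using mult_diag_diff[OF b] mult_diag_continuous_mem[OF c_pos assms(1)] mult_diag_continuous_mem[OF c_pos assms(2)]
    by (simp add: pi_diff blinfun.diff_left)
qed

lemma mu_cong:
  assumes "continuous_on S3 f" "continuous_on S3 g" "\<And>t. t \<in> S3 \<Longrightarrow> f t = g t"
  shows "\<mu> f = \<mu> g"
proof -
  have "diag_real f = diag_real g"
    by (intro mult_diag_cong bounded_fun_continuous continuous_on_of_real assms) (simp add: assms)
  then show ?thesis by simp
qed

lemma mu_const:
  assumes "h \<in> H"
  shows "\<mu> (\<lambda>t. r) h = complex_of_real r *\<^sub>C h"
proof -
  have "mult_diag (\<lambda>t. complex_of_real r) = complex_of_real r *\<^sub>C proj_L2"
    using mult_diag_cmult[OF bounded_fun_const[of 1], of "complex_of_real r"] by simp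
  then show ?thesis using assms mult_diag_1_mem[OF c_pos] by (simp add: pi_scaleC scaleC_blinfun.rep_eq pi_E)
qed

lemma norm_mu_le:
  assumes f: "continuous_on S3 f" "\<And>t. t \<in> S3 \<Longrightarrow> \<bar>f t\<bar> \<le> C" "0 \<le> C" and h: "h \<in> H"
  shows "norm (\<mu> f h) \<le> C * norm h"
proof -
  have "norm (\<mu> f h) \<le> norm (diag_real f) * norm h"
    by (rule norm_pi_le[OF mult_diag_continuous_mem[OF c_pos f(1)] h])
  also have "\<dots> \<le> C * norm h"
    by (intro mult_right_mono norm_Mop_le bounded_fun_continuous continuous_on_of_real f) (use f in auto)
  finally show ?thesis .
qed

text \<open>With 1 - E annihilated, X and its adjoint both act as multiplication by t_1, so the
  images of all generators commute with \<mu> f.\<close>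

lemma mu_commute:
  assumes f: "continuous_on S3 f" and b: "b \<in> A"
  shows "\<forall>h\<in>H. \<pi> b (\<mu> f h) = \<mu> f (\<pi> b h)"
  using b
proof (rule Cstar_cspan_induct)
  note F = mult_diag_continuous_mem[OF c_pos f]
  have FH: "\<mu> f h \<in> H" for h by (rule pi_H[OF F])
  show "clinear_op g" "cadjoint g \<in> gens c" if "g \<in> gens c" for g using that clinear_gens cadjoint_gens by blast+
  have coord: "\<pi> (mult_diag (coord i)) (\<mu> f h) = \<mu> f (\<pi> (mult_diag (coord i)) h)" for i h
  proof -
    have "continuous_on S3 (\<lambda>t::real^4. t $ i)" by (intro continuous_intros)
    then show ?thesis using mu_mult[OF f, of "\<lambda>t. t $ i" h] mu_mult[OF _ f, of "\<lambda>t. t $ i" h] by (simp add: mult.commute)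
  qed
  show "\<forall>h\<in>H. \<pi> g (\<mu> f h) = \<mu> f (\<pi> g h)" if "g \<in> gens c" for g
    using that by (auto simp: gens_def pi_id FH pi_X pi_X_adj T_op_eq coord)
  show "\<forall>h\<in>H. \<pi> 0 (\<mu> f h) = \<mu> f (\<pi> 0 h)" by (simp add: pi_zero blinfun.zero_right)
  fix a assume a: "a \<in> A" "\<forall>h\<in>H. \<pi> a (\<mu> f h) = \<mu> f (\<pi> a h)"
  show "\<forall>h\<in>H. \<pi> (z *\<^sub>C a) (\<mu> f h) = \<mu> f (\<pi> (z *\<^sub>C a) h)" for z
    using a by (simp add: pi_scaleC scaleC_blinfun.rep_eq clinear_opD[OF pi_clinear[OF F]])
  fix b assume b: "b \<in> A" "\<forall>h\<in>H. \<pi> b (\<mu> f h) = \<mu> f (\<pi> b h)"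
  show "\<forall>h\<in>H. \<pi> (a + b) (\<mu> f h) = \<mu> f (\<pi> (a + b) h)"
    using a b by (simp add: pi_add blinfun.add_left blinfun.add_right)
  show "\<forall>h\<in>H. \<pi> (a o\<^sub>L b) (\<mu> f h) = \<mu> f (\<pi> (a o\<^sub>L b) h)"
    using a b by (simp add: pi_compose pi_H)
next
  fix g :: "nat \<Rightarrow> _" and a
  assume g: "\<And>n. g n \<in> A" "a \<in> A" "\<And>n. \<forall>h\<in>H. \<pi> (g n) (\<mu> f h) = \<mu> f (\<pi> (g n) h)" "g \<longlonglongrightarrow> a"
  show "\<forall>h\<in>H. \<pi> a (\<mu> f h) = \<mu> f (\<pi> a h)"
  proof
    fix h assume h: "h \<in> H"
    have "(\<lambda>n. \<pi> (g n) (\<mu> f h)) \<longlonglongrightarrow> \<pi> a (\<mu> f h)"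
      by (intro tendsto_pi[OF g(1,2,4)] pi_H mult_diag_continuous_mem[OF c_pos f])
    moreover have "(\<lambda>n. \<mu> f (\<pi> (g n) h)) \<longlonglongrightarrow> \<mu> f (\<pi> a h)"
      by (intro tendsto_intros tendsto_pi[OF g(1,2,4) h])
    ultimately show "\<pi> a (\<mu> f h) = \<mu> f (\<pi> a h)" using g(3) h LIMSEQ_unique by auto
  qed
qed

text \<open>The kernel of \<mu> f in H is invariant by \<open>mu_commute\<close>, so irreducibility
  leaves only 0 and H; in the first case \<mu> f \<mu> g = 0 forces \<mu> g = 0. This takes the
  place of a spectral theorem.\<close>

lemma mu_zero_divisor:
  assumes f: "continuous_on S3 f" and g: "continuous_on S3 g" and fg: "\<And>t. t \<in> S3 \<Longrightarrow> f t * g t = 0"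
  shows "(\<forall>h\<in>H. \<mu> f h = 0) \<or> (\<forall>h\<in>H. \<mu> g h = 0)"
proof -
  define N where "N = {h\<in>H. \<mu> f h = 0}"
  have "closed_csubspace N"
    unfolding closed_csubspace_def
  proof
    show "csubspace N"
      using clinear_opD[OF pi_clinear[OF mult_diag_continuous_mem[OF c_pos f]]]
      by (auto simp: csubspace_def N_def H_simps blinfun.add_right blinfun.zero_right scaleC_zero_right)
    have "N = H \<inter> {h. \<mu> f h = 0}" by (auto simp: N_def)
    moreover have "closed {h. \<mu> f h = 0}" by (intro closed_Collect_eq continuous_intros)
    ultimately show "closed N" using H(2) by (simp add: closed_Int)
  qed
  moreover have "\<forall>a\<in>A. \<forall>x\<in>N. \<pi> a x \<in> N"
    using mu_commute[OF f] pi_H by (auto simp: N_def blinfun.zero_right) (metis blinfun.zero_right)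
  moreover have "N \<subseteq> H" by (auto simp: N_def)
  ultimately have "N = {0} \<or> N = H" using irr by (simp add: irreducible_representation_def)
  then show ?thesis
  proof
    assume N: "N = {0}"
    have "\<mu> g h = 0" if "h \<in> H" for h
    proof -
      have "\<mu> f (\<mu> g h) = \<mu> (\<lambda>t. 0) h"
        using mu_mult[OF f g] mu_cong[of "\<lambda>t. f t * g t" "\<lambda>t. 0"] f g fg by (simp add: continuous_on_mult)
      also have "\<dots> = 0" using mu_const[OF that, of 0] by (simp add: scaleC_zero_left)
      finally have "\<mu> g h \<in> N" using pi_H[OF mult_diag_continuous_mem[OF c_pos g]] by (simp add: N_def)
      then show ?thesis using N by simp
    qed
    then show ?thesis by blast
  next
    assume "N = H"
    then show ?thesis by (auto simp: N_def)
  qed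
qed

lemma H_nontrivial: "\<exists>h\<in>H. h \<noteq> 0"
  using irr H_simps(1) unfolding irreducible_representation_def by blast

text \<open>The scalar r is the infimum of all s for which the positive part of t_i - s is
  annihilated, the top of the spectrum. Below r that part survives, so
  \<open>mu_zero_divisor\<close> annihilates the positive part of s - t_i. Letting s tend to r from
  both sides annihilates t_i - r.\<close>

lemma coord_scalar: "\<exists>r. \<forall>h\<in>H. \<mu> (\<lambda>t. t $ i) h = complex_of_real r *\<^sub>C h"
proof -
  define u where "u s t = max ((t::real^4) $ i - s) 0" for s t
  have uc: "continuous_on S3 (u s)" for s unfolding u_def by (intro continuous_intros)
  define U where "U = {s. \<forall>h\<in>H. \<mu> (u s) h = 0}"
  have c1: "\<bar>t $ i\<bar> \<le> 1" if "t \<in> S3" for t :: "real^4"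
    using coord_square_le_1[OF that, of i] by (simp add: abs_square_le_1)
  have "1 \<in> U"
  proof -
    have "\<mu> (u 1) = \<mu> (\<lambda>t. 0)" using c1 by (intro mu_cong uc continuous_intros) (auto simp: u_def abs_le_iff)
    then show ?thesis using mu_const[of _ 0] by (simp add: U_def scaleC_zero_left)
  qed
  \<comment> \<open>For s < -1 the function is strictly positive on the sphere, so its inverse is
    continuous and it cannot act as 0 on a nonzero space.\<close>
  have lower: "-1 \<le> s" if "s \<in> U" for s
  proof (rule ccontr)
    assume "\<not> -1 \<le> s"
    then have pos: "0 < u s t" if "t \<in> S3" for t using c1[OF that] by (auto simp: u_def abs_le_iff)
    then have ne: "\<forall>t\<in>S3. u s t \<noteq> 0" by force
    have ic: "continuous_on S3 (\<lambda>t. 1 / u s t)" by (intro continuous_intros uc ne)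
    obtain h where h: "h \<in> H" "h \<noteq> 0" using H_nontrivial by blast
    have "\<mu> (\<lambda>t. 1 / u s t) (\<mu> (u s) h) = \<mu> (\<lambda>t. 1 / u s t * u s t) h" by (rule mu_mult[OF ic uc])
    also have "\<mu> (\<lambda>t. 1 / u s t * u s t) = \<mu> (\<lambda>t. 1)"
      by (rule mu_cong) (use ne in \<open>auto intro!: continuous_intros uc\<close>)
    also have "\<mu> (\<lambda>t. 1) h = h" using mu_const[OF h(1), of 1] by (simp add: scaleC_one)
    finally show False using that h by (simp add: U_def blinfun.zero_right)
  qed
  define r where "r = Inf U"
  have bdd: "bdd_below U" using lower by (intro bdd_belowI[of _ "-1"])
  \<comment> \<open>The positive part is 1-Lipschitz in s, so annihilation passes to the
    infimum.\<close>
  have plus: "\<mu> (u r) h = 0" if h: "h \<in> H" for h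
  proof -
    have "norm (\<mu> (u r) h) \<le> 0 + e" if e: "e > 0" for e
    proof -
      have "r < r + e / (norm h + 1)" using e by (simp add: add_nonneg_pos)
      then obtain s where s: "s \<in> U" "s < r + e / (norm h + 1)"
        using cInf_less_iff[OF _ bdd] \<open>1 \<in> U\<close> unfolding r_def by blast
      have "r \<le> s" unfolding r_def by (rule cInf_lower[OF s(1) bdd])
      have "\<mu> (u r) h = \<mu> (u r) h - \<mu> (u s) h" using s(1) h by (simp add: U_def)
      also have "\<dots> = \<mu> (\<lambda>t. u r t - u s t) h" by (rule mu_diff[OF uc uc])
      also have "norm \<dots> \<le> (e / (norm h + 1)) * norm h"
      proof (rule norm_mu_le[OF _ _ _ h])
        show "\<bar>u r t - u s t\<bar> \<le> e / (norm h + 1)" for t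
          using \<open>r \<le> s\<close> s(2) by (auto simp: u_def max_def)
      qed (use e in \<open>auto intro: continuous_intros uc\<close>)
      also have "\<dots> \<le> e" by (rule divide_plus_1_mult_le[OF norm_ge_zero e])
      finally show ?thesis by simp
    qed
    then have "norm (\<mu> (u r) h) \<le> 0" by (rule field_le_epsilon)
    then show ?thesis by simp
  qed
  have minus: "\<mu> (\<lambda>t. max (r - t $ i) 0) h = 0" if h: "h \<in> H" for h
  proof -
    have "norm (\<mu> (\<lambda>t. max (r - t $ i) 0) h) \<le> 0 + e" if e: "e > 0" for e
    proof -
      define d where "d = e / (norm h + 1)"
      have d: "d > 0" using e by (simp add: d_def add_nonneg_pos)
      have "r - d \<notin> U" using cInf_lower[OF _ bdd, of "r - d"] d unfolding r_def by auto
      have vc: "continuous_on S3 (\<lambda>t::real^4. max (q - t $ i) 0)" for q by (intro continuous_intros)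
      have "(\<forall>h\<in>H. \<mu> (u (r - d)) h = 0) \<or> (\<forall>h\<in>H. \<mu> (\<lambda>t. max (r - d - t $ i) 0) h = 0)"
        by (rule mu_zero_divisor[OF uc vc]) (auto simp: u_def max_def)
      then have 0: "\<mu> (\<lambda>t. max (r - d - t $ i) 0) h = 0" using \<open>r - d \<notin> U\<close> h by (auto simp: U_def)
      have "\<mu> (\<lambda>t. max (r - t $ i) 0) h = \<mu> (\<lambda>t. max (r - t $ i) 0) h - \<mu> (\<lambda>t. max (r - d - t $ i) 0) h"
        by (simp add: 0)
      also have "\<dots> = \<mu> (\<lambda>t. max (r - t $ i) 0 - max (r - d - t $ i) 0) h" by (rule mu_diff[OF vc vc])
      also have "norm \<dots> \<le> d * norm h"
      proof (rule norm_mu_le[OF _ _ _ h])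
        show "\<bar>max (r - t $ i) 0 - max (r - d - t $ i) 0\<bar> \<le> d" for t :: "real^4"
          using d by (auto simp: max_def)
      qed (use d in \<open>auto intro!: continuous_on_diff vc\<close>)
      also have "\<dots> \<le> e" unfolding d_def by (rule divide_plus_1_mult_le[OF norm_ge_zero e])
      finally show ?thesis by simp
    qed
    then have "norm (\<mu> (\<lambda>t. max (r - t $ i) 0) h) \<le> 0" by (rule field_le_epsilon)
    then show ?thesis by simp
  qed
  have "\<mu> (\<lambda>t. t $ i) h = complex_of_real r *\<^sub>C h" if h: "h \<in> H" for h
  proof -
    have "\<mu> (\<lambda>t. t $ i) h - \<mu> (\<lambda>t. r) h = \<mu> (\<lambda>t. t $ i - r) h"
      by (rule mu_diff) (intro continuous_intros)+
    also have "(\<lambda>t::real^4. t $ i - r) = (\<lambda>t. u r t - max (r - t $ i) 0)" by (auto simp: u_def max_def)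
    also have "\<mu> (\<lambda>t. u r t - max (r - t $ i) 0) h = \<mu> (u r) h - \<mu> (\<lambda>t. max (r - t $ i) 0) h"
      by (rule mu_diff[symmetric, OF uc]) (intro continuous_intros)
    also have "\<dots> = 0" using plus[OF h] minus[OF h] by simp
    finally show ?thesis by (simp add: mu_const[OF h])
  qed
  then show ?thesis by blast
qed

text \<open>The four scalars are the coordinates of a point of the sphere because the sum of the
  squares of the coordinate multiplications is E, which acts as the identity on H.\<close>

lemma point_of_S3: "\<exists>x\<in>S3. \<forall>i. \<forall>h\<in>H. \<pi> (mult_diag (coord i)) h = complex_of_real (x $ i) *\<^sub>C h"
proof -
  obtain r where r: "\<And>i h. h \<in> H \<Longrightarrow> \<pi> (mult_diag (coord i)) h = complex_of_real (r i) *\<^sub>C h"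
    using coord_scalar by metis
  define x :: "real^4" where "x = (\<chi> i. r i)"
  obtain h where h: "h \<in> H" "h \<noteq> 0" using H_nontrivial by blast
  let ?M = "\<lambda>i. mult_diag (coord i)"
  have m: "?M i \<in> A" "?M i o\<^sub>L ?M i \<in> A" for i
    by (intro compose mult_diag_coord_mem c_pos)+
  have "(?M 1 o\<^sub>L ?M 1) + (?M 2 o\<^sub>L ?M 2) + (?M 3 o\<^sub>L ?M 3) + (?M 4 o\<^sub>L ?M 4) = proj_L2"
    by (rule blinfun_eqI) (simp add: blinfun.add_left mult_diag_apply mult_op_const scaleC_one sum_coord_squares)
  then have "\<pi> ((?M 1 o\<^sub>L ?M 1) + (?M 2 o\<^sub>L ?M 2) + (?M 3 o\<^sub>L ?M 3) + (?M 4 o\<^sub>L ?M 4)) h = h"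
    using pi_E[OF h(1)] by simp
  then have "complex_of_real (r 1 * r 1 + r 2 * r 2 + r 3 * r 3 + r 4 * r 4) *\<^sub>C h = 1 *\<^sub>C h"
    using m h(1) by (simp add: pi_add pi_compose add blinfun.add_left r H_simps scaleC_scaleC scaleC_add_left scaleC_one)
  then have "(complex_of_real (r 1 * r 1 + r 2 * r 2 + r 3 * r 3 + r 4 * r 4) - 1) *\<^sub>C h = 0"
    by (simp add: scaleC_diff_left)
  then have "norm ((complex_of_real (r 1 * r 1 + r 2 * r 2 + r 3 * r 3 + r 4 * r 4) - 1) *\<^sub>C h) = 0" by simp
  then have "complex_of_real (r 1 * r 1 + r 2 * r 2 + r 3 * r 3 + r 4 * r 4) = complex_of_real 1"
    unfolding norm_scaleC using h(2) by simp
  then have "r 1 * r 1 + r 2 * r 2 + r 3 * r 3 + r 4 * r 4 = 1" by (simp only: of_real_eq_iff)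
  then have "x \<in> S3" by (simp add: S3_sum_squares x_def power2_eq_square)
  then show ?thesis using r by (intro bexI[of _ x]) (auto simp: x_def)
qed

text \<open>No state comparison is needed here: D is null under \<phi>, hence so are the squares of
  all s - s(x). The lemma on null squares then gives \<phi>(a s) h = s(x) \<phi>(a) h for every a
  and every generator s.\<close>

lemma phi_eq_pi_singular:
  assumes b: "b \<in> A"
  shows "\<phi> b = \<pi> b"
proof -
  obtain x where x: "x \<in> S3"
    and pt: "\<And>i h. h \<in> H \<Longrightarrow> \<pi> (mult_diag (coord i)) h = complex_of_real (x $ i) *\<^sub>C h"
    using point_of_S3 by blast
  let ?x = "\<lambda>i. complex_of_real (x $ i)"
  have pi_gens: "\<pi> X h = ?x 1 *\<^sub>C h" "\<pi> (cadjoint X) h = ?x 1 *\<^sub>C h" "\<pi> (T_op i) h = ?x i *\<^sub>C h" if "h \<in> H" for i h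
    by (simp_all add: pi_X pi_X_adj T_op_eq pt[OF that])
  have D_mem: "defect c x \<in> A"
    unfolding defect_def by (intro diff scaleC add one X_mem X_adj_mem T_mem)
  have phi_defect: "\<phi> (defect c x) h = 0" if h: "h \<in> H" for h
  proof -
    have "\<phi> (defect c x) h = h - complex_of_real (x $ 1 / 2) *\<^sub>C (\<pi> X h + \<pi> (cadjoint X) h)
        - ?x 2 *\<^sub>C \<pi> (T_op 2) h - ?x 3 *\<^sub>C \<pi> (T_op 3) h - ?x 4 *\<^sub>C \<pi> (T_op 4) h"
      unfolding defect_def
      by (simp only: phi_diff phi_add phi_scaleC diff add scaleC one X_mem X_adj_mem T_mem phi_gens pi_id[OF h]
          blinfun.diff_left blinfun.add_left scaleC_blinfun.rep_eq)
    also have "\<dots> = complex_of_real (1 - (x $ 1)\<^sup>2 - (x $ 2)\<^sup>2 - (x $ 3)\<^sup>2 - (x $ 4)\<^sup>2) *\<^sub>C h"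
      by (simp add: pi_gens[OF h] scaleC_scaleC scaleC_diff_left scaleC_one power2_eq_square flip: scaleC_add_left)
    also have "1 - (x $ 1)\<^sup>2 - (x $ 2)\<^sup>2 - (x $ 3)\<^sup>2 - (x $ 4)\<^sup>2 = 0"
      using x unfolding S3_sum_squares by linarith
    finally show ?thesis by (simp add: scaleC_zero_left)
  qed
  have null: "\<phi> (a o\<^sub>L s) h = z *\<^sub>C \<phi> a h"
    if s: "s \<in> A" and a: "a \<in> A" and h: "h \<in> H"
      and le: "\<And>g y. (norm (s (g, y) - z *\<^sub>C (g, y)))\<^sup>2 \<le> 6 * (point_form x g + (cmod y)\<^sup>2)" for s a h z
  proof -
    define r where "r = s - z *\<^sub>C id_blinfun"
    have r: "r \<in> A" unfolding r_def by (intro diff scaleC one s)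
    \<comment> \<open>The 6 is the constant of \<open>gens_diff_le\<close>, the 1 - c the factor of
      \<open>defect_ge\<close>; with this multiple, K D - r^* r is positive.\<close>
    define K where "K = complex_of_real (6 / (1 - c))"
    define G where "G = K *\<^sub>C defect c x - (cadjoint r o\<^sub>L r)"
    have G: "G \<in> A" unfolding G_def by (intro diff scaleC D_mem compose adj r)
    have "cinner (G v) v \<in> \<real>\<^sub>\<ge>\<^sub>0" for v
    proof -
      obtain g y where v: "v = (g, y)" by (cases v)
      have "(1 - c) * (norm (r v))\<^sup>2 \<le> (1 - c) * (6 * (point_form x g + (cmod y)\<^sup>2))"
        using le[of g y] c_less by (intro mult_left_mono) (auto simp: r_def v blinfun.diff_left scaleC_blinfun.rep_eq)
      also have "\<dots> = 6 * ((1 - c) * (point_form x g + (cmod y)\<^sup>2))" by (rule mult.left_commute)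
      also have "\<dots> \<le> 6 * Re (cinner (defect c x (g, y)) (g, y))"
        by (intro mult_left_mono defect_ge x c_pos c_less) simp
      finally have "(norm (r v))\<^sup>2 \<le> 6 / (1 - c) * Re (cinner (defect c x v) v)"
        using c_less by (simp add: field_simps v)
      moreover have "cinner (G v) v = complex_of_real (6 / (1 - c) * Re (cinner (defect c x v) v) - (norm (r v))\<^sup>2)"
        by (simp add: G_def K_def blinfun.diff_left scaleC_blinfun.rep_eq cinner_simps cinner_cadjoint' clinear[OF r]
            cinner_self v cinner_defect)
      ultimately show ?thesis by (simp only:) (rule nonneg_of_real, simp)
    qed
    then have "0 \<le> Re (cinner (\<phi> G h) h)" using phi_pos[OF G] nonneg_RealsD by blast
    also have "\<phi> G h = - \<phi> (cadjoint r o\<^sub>L r) h"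
      unfolding G_def using D_mem r h
      by (simp add: phi_diff phi_scaleC scaleC compose adj blinfun.diff_left scaleC_blinfun.rep_eq phi_defect scaleC_zero_right)
    finally have "Re (cinner (\<phi> (cadjoint r o\<^sub>L r) h) h) \<le> 0" by (simp add: cinner_minus_left)
    then have "cinner (\<phi> (cadjoint r o\<^sub>L r) h) h = 0"
      using nonneg_RealsD[OF phi_square_pos[OF r, of h]] by (simp add: complex_eq_iff)
    then have "\<phi> (a o\<^sub>L r) h = 0" using phi_null_square(2)[OF a r h] by simp
    moreover have "a o\<^sub>L r = (a o\<^sub>L s) - z *\<^sub>C a"
      by (rule blinfun_eqI) (simp add: r_def blinfun.diff_left blinfun.diff_right scaleC_blinfun.rep_eq clinear_opD[OF clinear[OF a]])
    ultimately show ?thesis using a s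
      by (simp add: phi_diff phi_scaleC compose scaleC blinfun.diff_left scaleC_blinfun.rep_eq)
  qed
  \<comment> \<open>The left factor a is universally quantified so that in a product p q first q and
    then p can be split off; a = 1 gives the claim at the end.\<close>
  have "\<forall>a\<in>A. \<forall>h\<in>H. \<phi> (a o\<^sub>L b) h = \<phi> a (\<pi> b h)"
    using b
  proof (rule Cstar_cspan_induct)
    show "clinear_op g" "cadjoint g \<in> gens c" if "g \<in> gens c" for g using that clinear_gens cadjoint_gens by blast+
    show "\<forall>a\<in>A. \<forall>h\<in>H. \<phi> (a o\<^sub>L g) h = \<phi> a (\<pi> g h)" if g: "g \<in> gens c" for g
    proof (intro ballI)
      fix a h assume a: "a \<in> A" and h: "h \<in> H"
      note cl = clinear_opD[OF phi_clinear[OF a]]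
      note le = gens_diff_le[OF x c_pos c_less]
      from g consider i where "i = 2 \<or> i = 3 \<or> i = 4" "g = T_op i" | "g = X" | "g = cadjoint X" | "g = id_blinfun"
        by (auto simp: gens_def)
      then show "\<phi> (a o\<^sub>L g) h = \<phi> a (\<pi> g h)"
      proof cases
        case 1
        then have "g \<in> A" using T_mem by auto
        from null[OF this a h, of "?x i"] show ?thesis using 1 le(1) by (simp add: pi_gens h cl)
      next
        case 2
        from null[OF X_mem a h le(2)] show ?thesis using 2 by (simp add: pi_gens h cl)
      next
        case 3
        from null[OF X_adj_mem a h le(3)] show ?thesis using 3 by (simp add: pi_gens h cl)
      next
        case 4
        then show ?thesis by (simp add: blinfun_compose_id pi_id h)
      qed
    qed
    have "a o\<^sub>L 0 = 0" for a :: "L2C \<Rightarrow>\<^sub>L L2C" by (rule blinfun_eqI) (simp add: blinfun.zero_right)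
    then show "\<forall>a\<in>A. \<forall>h\<in>H. \<phi> (a o\<^sub>L 0) h = \<phi> a (\<pi> 0 h)" by (simp add: phi_zero pi_zero blinfun.zero_right)
    fix p assume p: "p \<in> A" "\<forall>a\<in>A. \<forall>h\<in>H. \<phi> (a o\<^sub>L p) h = \<phi> a (\<pi> p h)"
    have "a o\<^sub>L z *\<^sub>C p = z *\<^sub>C (a o\<^sub>L p)" if "a \<in> A" for a z
      by (rule blinfun_eqI) (simp add: scaleC_blinfun.rep_eq clinear_opD[OF clinear[OF that]])
    then show "\<forall>a\<in>A. \<forall>h\<in>H. \<phi> (a o\<^sub>L z *\<^sub>C p) h = \<phi> a (\<pi> (z *\<^sub>C p) h)" for z
      using p by (simp add: phi_scaleC pi_scaleC compose scaleC_blinfun.rep_eq clinear_opD[OF phi_clinear])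
    fix q assume q: "q \<in> A" "\<forall>a\<in>A. \<forall>h\<in>H. \<phi> (a o\<^sub>L q) h = \<phi> a (\<pi> q h)"
    have "a o\<^sub>L (p + q) = (a o\<^sub>L p) + (a o\<^sub>L q)" for a :: "L2C \<Rightarrow>\<^sub>L L2C"
      by (rule blinfun_eqI) (simp add: blinfun.add_left blinfun.add_right)
    then show "\<forall>a\<in>A. \<forall>h\<in>H. \<phi> (a o\<^sub>L (p + q)) h = \<phi> a (\<pi> (p + q) h)"
      using p q by (simp add: phi_add pi_add compose blinfun.add_left blinfun.add_right)
    have "a o\<^sub>L (p o\<^sub>L q) = (a o\<^sub>L p) o\<^sub>L q" for a :: "L2C \<Rightarrow>\<^sub>L L2C"
      by (rule blinfun_eqI) simp
    then show "\<forall>a\<in>A. \<forall>h\<in>H. \<phi> (a o\<^sub>L (p o\<^sub>L q)) h = \<phi> a (\<pi> (p o\<^sub>L q) h)"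
      using p q by (simp add: pi_compose compose pi_H)
  next
    fix f :: "nat \<Rightarrow> _" and p
    assume f: "\<And>n. f n \<in> A" "p \<in> A" "\<And>n. \<forall>a\<in>A. \<forall>h\<in>H. \<phi> (a o\<^sub>L f n) h = \<phi> a (\<pi> (f n) h)" "f \<longlonglongrightarrow> p"
    show "\<forall>a\<in>A. \<forall>h\<in>H. \<phi> (a o\<^sub>L p) h = \<phi> a (\<pi> p h)"
    proof (intro ballI)
      fix a h assume a: "a \<in> A" and h: "h \<in> H"
      have "(\<lambda>n. \<phi> (a o\<^sub>L f n) h) \<longlonglongrightarrow> \<phi> (a o\<^sub>L p) h"
        by (rule tendsto_phi[OF _ _ tendsto_blinfun_compose[OF tendsto_const f(4)] h]) (auto intro: compose a f)
      moreover have "(\<lambda>n. \<phi> a (\<pi> (f n) h)) \<longlonglongrightarrow> \<phi> a (\<pi> p h)"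
        by (intro tendsto_intros tendsto_pi[OF f(1,2,4) h])
      ultimately show "\<phi> (a o\<^sub>L p) h = \<phi> a (\<pi> p h)" using f(3) a h LIMSEQ_unique by auto
    qed
  qed
  then have "\<phi> b h = \<pi> b h" if "h \<in> H" for h
    using that one by (metis blinfun_compose_id(2) phi_id pi_H b)
  then show ?thesis by (intro bops_on_eqI phi_bops pi_bops b)
qed

end

lemma phi_eq_pi_sphere:
  assumes a: "a \<in> A"
  shows "\<phi> a = \<pi> a"
proof (cases "\<pi> const_proj = 0")
  case True
  then show ?thesis using phi_eq_pi_singular a by blast
next
  case False
  then obtain k where "\<pi> const_proj k \<noteq> 0" using blinfun_eqI[of "\<pi> const_proj" 0] by auto
  define h where "h = \<pi> const_proj k"
  have h: "h \<in> H" "h \<noteq> 0" using \<open>\<pi> const_proj k \<noteq> 0\<close> pi_H[OF const_proj_mem[OF c_pos]] by (auto simp: h_def)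
  have "\<pi> const_proj h = h"
    using arg_cong[OF pi_compose[OF const_proj_mem[OF c_pos] const_proj_mem[OF c_pos]], of "\<lambda>T. T k"] by (simp add: h_def const_proj_const_proj)
  then show ?thesis using phi_eq_pi[OF irr agree_range_Q[OF h(1)] h(2) a] by simp
qed

end

theorem theorem2p5:
  fixes c :: real
  assumes "0 < c" and "c < 1"
  shows "\<not> hyperrigid TYPE(L2_S3 \<times> complex) (S_sys c) \<and>
    (\<forall>(H :: 'h::chilbert_space set) \<pi>.
       irreducible_representation (Cstar (S_sys c)) H \<pi> \<longrightarrow>
       unique_extension_property (S_sys c) H \<pi>)"
proof (intro conjI allI impI)
  show "\<not> hyperrigid TYPE(L2_S3 \<times> complex) (S_sys c)"
    using assms by (intro not_hyperrigid_S_sys) simp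
  fix H :: "'h set" and \<pi>
  assume irr: "irreducible_representation (Cstar (S_sys c)) H \<pi>"
  show "unique_extension_property (S_sys c) H \<pi>"
    unfolding unique_extension_property_def
  proof (intro allI impI ballI, elim conjE)
    fix \<phi> a
    assume \<phi>: "ucp (Cstar (S_sys c)) H \<phi>" "\<forall>s\<in>S_sys c. \<phi> s = \<pi> s" and a: "a \<in> Cstar (S_sys c)"
    interpret sphere_extension c H \<pi> \<phi>
    proof unfold_locales
      show "representation (CS c) H \<pi>"
        using irr by (simp add: irreducible_representation_def S_sys_gens)
      show "ucp (CS c) H \<phi>" using \<phi>(1) by (simp add: S_sys_gens)
      show "cadjoint g \<in> gens c" if "g \<in> gens c" for g using that by (rule cadjoint_gens)
      show "\<phi> g = \<pi> g" if "g \<in> gens c" for g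
        using \<phi>(2) that cspan_superset[of "gens c"] by (auto simp: S_sys_gens)
      show "irreducible_representation (CS c) H \<pi>" using irr by (simp add: S_sys_gens)
    qed (use assms in auto)
    show "\<phi> a = \<pi> a" using phi_eq_pi_sphere a by (simp add: S_sys_gens)
  qed
qed

end
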